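(* Let $d\ge 6$ and let $(S_k)_{k\ge0}$ be a simple random walk on $\mathbb{Z}^d$ with $S_0=0$, with range $\mathcal{R}_n=\{S_0,\dots,S_n\}$. There is a constant $\sigma_d>0$ such that \[ \frac{\mathrm{Cap}(\mathcal{R}_n)-\mathbb{E}[\mathrm{Cap}(\mathcal{R}_n)]}{\sqrt n}\Longrightarrow \sigma_d\,\mathcal{N}(0,1)\qquad\text{as } n\to\infty, \] where $\Longrightarrow$ denotes convergence in distribution and $\mathcal{N}(0,1)$ is a standard normal random variable.
   Context: For a finite set $A\subseteq\mathbb{Z}^d$ ($d\ge3$), its capacity is $\mathrm{Cap}(A)=\sum_{x\in A}\mathbb{P}_x(T_A^+=\infty)$, where $T_A^+=\inf\{t\ge1: S_t\in A\}$ is the first return time to $A$ of a simple random walk $S$ and $\mathbb{P}_x$ is the law of the walk started at $x$. *)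

theory Defs
  imports "HOL-Probability.Probability"
begin

definition unit_steps :: "(int ^ 'd) set" where
  "unit_steps = {v. \<exists>i. v = axis i 1 \<or> v = axis i (-1)}"

definition step_pmf :: "(int ^ 'd) pmf" where
  "step_pmf = pmf_of_set unit_steps"

definition SRW :: "(int ^ 'd) stream measure" where
  "SRW = stream_space (measure_pmf step_pmf)"

definition walk :: "int ^ 'd \<Rightarrow> (int ^ 'd) stream \<Rightarrow> nat \<Rightarrow> int ^ 'd" where
  "walk x w t = x + (\<Sum>i<t. w !! i)"

definition escape_prob :: "(int ^ 'd) set \<Rightarrow> int ^ 'd \<Rightarrow> real" where
  "escape_prob A x = measure SRW {w \<in> space SRW. \<forall>t\<ge>1. walk x w t \<notin> A}"

definition Cap :: "(int ^ 'd) set \<Rightarrow> real" where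
  "Cap A = (\<Sum>x\<in>A. escape_prob A x)"

definition walk_range :: "(int ^ 'd) stream \<Rightarrow> nat \<Rightarrow> (int ^ 'd) set" where
  "walk_range w n = walk 0 w ` {0..n}"

end

(*
The walk enters only through its first n steps, so expectations are finite averages over lists of
steps.  The capacity is the asymptotic growth rate of the expected volume of the sausage A - S_0,
..., A - S_n; counting points of the sausage gives, for finite A and B,
  0 <= Cap A + Cap B - Cap (A Un B) <= 2 * sum of G(a - b) over a in A, b in B
and, for x outside B, Cap (insert x B) - Cap B >= P_x(no return to insert x B)^2.

For d >= 6 the heat kernel is O(t^-3), and a second moment computation bounds the interaction of
two adjacent stretches of the range of length at most n by O(n^(1/4)) in L^2.  Halving repeatedly,
the centred capacity of k blocks of length L differs from the sum of the k independent centred block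
capacities by O(L^(1/4) sqrt k) in L^2, which is a fraction O(L^(-1/4)) of sqrt (k L), uniformly
in k.  Hence the normalised standard deviations form a Cauchy sequence, and the characteristic
function is within O(L^(-1/4)) of one governed by the classical central limit theorem for blocks of
fixed length L; let n tend to infinity and then L.

The limit variance is positive because replacing a block that goes back and forth on one edge by a
long straight excursion and its return raises the expected capacity by a fixed amount; the number of
excursions minus the number of back-and-forth blocks is therefore correlated with the capacity.
*)
theory Submission
  imports Defs
begin

subsection \<open>Averages over step lists\<close>

text \<open>Escape probabilities fall when a set grows, so inequalities for the capacity cannot be
  read off its defining sum term by term; sausage cardinalities can be compared step list by step
  list, and only their linear growth survives in the limit. The obstacle to the limit theorem is
  that adjacent blocks interact. Adding all interaction terms by the triangle inequality would cost
  a factor k. Under halving, the errors of the two halves are independent, so their variances add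
  and only the one junction term needs the triangle inequality; this leaves sqrt k. The second
  moment of a junction is bounded by a squared harmonic sum; the power 1/4 is a convenient majorant
  of the logarithm, and what counts is that it lies below the exponent 1/2 of the fluctuations. The
  decay t^-3 is obtained without Fourier analysis: given how many steps were taken along each axis,
  the coordinates are independent one-dimensional walks, and six factors of order (number of
  steps)^(-1/2) give the exponent 3.\<close>

definition step_avg :: "((int ^ 'd::finite) \<Rightarrow> 'b::real_normed_field) \<Rightarrow> 'b" where
  "step_avg f = (\<Sum>v\<in>unit_steps. f v) / of_nat (card (unit_steps :: (int ^ 'd) set))"

text \<open>The value type is any real normed field, so that real moments and complex characteristic
  functions obey the same rules.\<close>

primrec list_avg :: "nat \<Rightarrow> ((int ^ 'd::finite) list \<Rightarrow> 'b::real_normed_field) \<Rightarrow> 'b" where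
  "list_avg 0 f = f []"
| "list_avg (Suc n) f = step_avg (\<lambda>v. list_avg n (\<lambda>l. f (v # l)))"

lemma unit_steps_eq: "(unit_steps :: (int ^ 'd::finite) set) = range (\<lambda>i. axis i 1) \<union> range (\<lambda>i. axis i (-1))"
  by (auto simp: unit_steps_def)

lemma finite_unit_steps [simp]: "finite (unit_steps :: (int ^ 'd::finite) set)"
  by (simp add: unit_steps_eq)

lemma unit_steps_nonempty [simp]: "(unit_steps :: (int ^ 'd::finite) set) \<noteq> {}"
  by (simp add: unit_steps_eq)

lemma card_unit_steps_pos [simp]: "card (unit_steps :: (int ^ 'd::finite) set) > 0"
  by (simp add: card_gt_0_iff)

lemma axis_in_unit_steps [simp]:
  "axis i 1 \<in> (unit_steps :: (int ^ 'd::finite) set)" "axis i (-1) \<in> (unit_steps :: (int ^ 'd::finite) set)"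
  by (auto simp: unit_steps_def)

lemma uminus_axis: "- axis i (x::int) = (axis i (-x) :: int ^ 'd::finite)"
  by (simp add: axis_def vec_eq_iff)

lemma uminus_unit_steps: "uminus ` (unit_steps :: (int ^ 'd::finite) set) = unit_steps"
  unfolding unit_steps_eq image_Un image_image uminus_axis by auto

lemma step_avg_const [simp]: "step_avg (\<lambda>v :: int ^ 'd::finite. c) = c"
  by (simp add: step_avg_def)

lemma step_avg_add: "step_avg (\<lambda>v. f v + g v) = step_avg f + step_avg g"
  by (simp add: step_avg_def sum.distrib add_divide_distrib)

lemma step_avg_cmult: "step_avg (\<lambda>v. c * f v) = c * step_avg f"
  by (simp add: step_avg_def sum_distrib_left)

lemma step_avg_mono:
  fixes f :: "int ^ 'd::finite \<Rightarrow> real"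
  shows "(\<And>v. v \<in> unit_steps \<Longrightarrow> f v \<le> g v) \<Longrightarrow> step_avg f \<le> step_avg g"
  by (auto simp: step_avg_def intro!: divide_right_mono sum_mono)

lemma step_avg_cong:
  "(\<And>v. v \<in> unit_steps \<Longrightarrow> f v = g v) \<Longrightarrow> step_avg f = step_avg g"
  by (simp add: step_avg_def)

lemma step_avg_uminus: "step_avg (\<lambda>v. f (- v)) = step_avg f"
proof -
  have "(\<Sum>v\<in>unit_steps. f (- v)) = (\<Sum>v\<in>uminus ` unit_steps. f v)"
    by (subst sum.reindex) auto
  then show ?thesis by (simp add: step_avg_def uminus_unit_steps)
qed

lemma step_avg_sum: "step_avg (\<lambda>v. \<Sum>i\<in>I. f i v) = (\<Sum>i\<in>I. step_avg (f i))"
  unfolding step_avg_def by (subst sum.swap) (simp add: sum_divide_distrib)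

lemma list_avg_const [simp]: "list_avg n (\<lambda>l :: (int ^ 'd::finite) list. c) = c"
  by (induction n) auto

lemma list_avg_add: "list_avg n (\<lambda>l. f l + g l) = list_avg n f + list_avg n g"
  by (induction n arbitrary: f g) (auto simp: step_avg_add)

lemma list_avg_cmult: "list_avg n (\<lambda>l. c * f l) = c * list_avg n f"
  by (induction n arbitrary: f) (auto simp: step_avg_cmult)

lemma list_avg_multc: "list_avg n (\<lambda>l. f l * c) = list_avg n f * c"
  using list_avg_cmult[of n c f] by (simp add: mult.commute)

lemma list_avg_divide: "list_avg n (\<lambda>l. f l / c) = list_avg n f / c"
  using list_avg_multc[of n f "1 / c"] by simp

lemma list_avg_uminus: "list_avg n (\<lambda>l. - f l) = - list_avg n f"
  using list_avg_cmult[of n "-1" f] by simp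

lemma list_avg_diff: "list_avg n (\<lambda>l. f l - g l) = list_avg n f - list_avg n g"
  using list_avg_add[of n f "\<lambda>l. - g l"] by (simp add: list_avg_uminus)

lemma list_avg_sum: "list_avg n (\<lambda>l. \<Sum>i\<in>I. f i l) = (\<Sum>i\<in>I. list_avg n (f i))"
  by (induction n arbitrary: f) (auto simp: step_avg_sum)

lemma list_avg_mono:
  fixes f :: "(int ^ 'd::finite) list \<Rightarrow> real"
  shows "(\<And>l. length l = n \<Longrightarrow> set l \<subseteq> unit_steps \<Longrightarrow> f l \<le> g l) \<Longrightarrow> list_avg n f \<le> list_avg n g"
proof (induction n arbitrary: f g)
  case (Suc n)
  show ?case unfolding list_avg.simps
    by (rule step_avg_mono, rule Suc.IH, rule Suc.prems) auto
qed simp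

lemma list_avg_cong:
  "(\<And>l. length l = n \<Longrightarrow> set l \<subseteq> unit_steps \<Longrightarrow> f l = g l) \<Longrightarrow> list_avg n f = list_avg n g"
proof (induction n arbitrary: f g)
  case (Suc n)
  show ?case unfolding list_avg.simps
    by (rule step_avg_cong, rule Suc.IH, rule Suc.prems) auto
qed simp

lemma list_avg_nonneg:
  fixes f :: "(int ^ 'd::finite) list \<Rightarrow> real"
  shows "(\<And>l. length l = n \<Longrightarrow> set l \<subseteq> unit_steps \<Longrightarrow> 0 \<le> f l) \<Longrightarrow> 0 \<le> list_avg n f"
  using list_avg_mono[of n "\<lambda>_. 0" f] by simp

lemma list_avg_le_const:
  fixes f :: "(int ^ 'd::finite) list \<Rightarrow> real"
  shows "(\<And>l. length l = n \<Longrightarrow> set l \<subseteq> unit_steps \<Longrightarrow> f l \<le> c) \<Longrightarrow> list_avg n f \<le> c"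
  using list_avg_mono[of n f "\<lambda>_. c"] by simp

lemma list_avg_append: "list_avg (a + b) f = list_avg a (\<lambda>l. list_avg b (\<lambda>l'. f (l @ l')))"
  by (induction a arbitrary: f) auto

lemma list_avg_step_swap: "list_avg n (\<lambda>l. step_avg (f l)) = step_avg (\<lambda>v. list_avg n (\<lambda>l. f l v))"
  by (simp add: step_avg_def list_avg_divide list_avg_sum)

lemma list_avg_swap: "list_avg a (\<lambda>x. list_avg b (\<lambda>y. f x y)) = list_avg b (\<lambda>y. list_avg a (\<lambda>x. f x y))"
  by (induction a arbitrary: f) (auto simp: list_avg_step_swap)

text \<open>Together with \<open>list_avg_map_uminus\<close> this is time reversal: the past of a
  walk, seen from its present point, is averaged like a fresh walk. The induction splits off the
  last step and moves it to the front.\<close>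

lemma list_avg_rev: "list_avg n (\<lambda>l. f (rev l)) = list_avg n f"
proof (induction n arbitrary: f)
  case (Suc n)
  have "list_avg (Suc n) f = list_avg (n + 1) f" by simp
  also have "\<dots> = list_avg n (\<lambda>l. step_avg (\<lambda>v. f (l @ [v])))"
    by (subst list_avg_append) simp
  also have "\<dots> = list_avg n (\<lambda>l. step_avg (\<lambda>v. f (rev l @ [v])))"
    by (subst Suc.IH[symmetric]) simp
  finally show ?case by (simp add: list_avg_step_swap)
qed simp

lemma list_avg_map_uminus: "list_avg n (\<lambda>l. f (map uminus l)) = list_avg n f"
proof (induction n arbitrary: f)
  case (Suc n)
  show ?case
    using step_avg_uminus[of "\<lambda>v. list_avg n (\<lambda>l. f (v # l))"] Suc.IH[of "\<lambda>l. f (- v # l)" for v]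
    by simp
qed simp

lemma norm_list_avg_le: "norm (list_avg n f) \<le> list_avg n (\<lambda>l. norm (f l))"
proof (induction n arbitrary: f)
  case (Suc n)
  have "norm (list_avg (Suc n) f) \<le> step_avg (\<lambda>v. norm (list_avg n (\<lambda>l. f (v # l))))"
    by (simp add: step_avg_def norm_divide divide_right_mono norm_sum)
  also have "\<dots> \<le> step_avg (\<lambda>v. list_avg n (\<lambda>l. norm (f (v # l))))"
    by (intro step_avg_mono Suc.IH)
  finally show ?case by simp
qed simp

lemma list_avg_of_real: "list_avg n (\<lambda>l. of_real (f l)) = of_real (list_avg n f)"
  by (induction n arbitrary: f) (auto simp: step_avg_def)

lemma list_avg_Re: "Re (list_avg n f) = list_avg n (\<lambda>l. Re (f l))"
  by (induction n arbitrary: f) (auto simp: step_avg_def)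

lemma list_avg_Im: "Im (list_avg n f) = list_avg n (\<lambda>l. Im (f l))"
  by (induction n arbitrary: f) (auto simp: step_avg_def)

lemma list_avg_tendsto:
  "(\<And>l. length l = n \<Longrightarrow> ((\<lambda>k. f k l) \<longlongrightarrow> g l) F) \<Longrightarrow> ((\<lambda>k. list_avg n (f k)) \<longlongrightarrow> list_avg n g) F"
proof (induction n arbitrary: f g)
  case (Suc n)
  show ?case unfolding list_avg.simps step_avg_def
    by (intro tendsto_divide tendsto_sum Suc.IH Suc.prems tendsto_const) auto
qed auto

lemma list_avg_Cauchy_Schwarz:
  fixes f g :: "(int ^ 'd::finite) list \<Rightarrow> real"
  shows "(list_avg n (\<lambda>l. f l * g l))\<^sup>2 \<le> list_avg n (\<lambda>l. (f l)\<^sup>2) * list_avg n (\<lambda>l. (g l)\<^sup>2)"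
proof -
  define A B C where "A = list_avg n (\<lambda>l. (f l)\<^sup>2)" and "B = list_avg n (\<lambda>l. f l * g l)"
    and "C = list_avg n (\<lambda>l. (g l)\<^sup>2)"
  have q: "A - 2 * t * B + t\<^sup>2 * C \<ge> 0" for t
  proof -
    have "0 \<le> list_avg n (\<lambda>l. (f l - t * g l)\<^sup>2)" by (rule list_avg_nonneg) simp
    also have "(\<lambda>l. (f l - t * g l)\<^sup>2) = (\<lambda>l. ((f l)\<^sup>2 - (2 * t) * (f l * g l)) + t\<^sup>2 * (g l)\<^sup>2)"
      by (auto simp: power2_eq_square algebra_simps)
    finally show ?thesis by (simp add: list_avg_add list_avg_diff list_avg_cmult A_def B_def C_def)
  qed
  have C0: "C \<ge> 0" unfolding C_def by (rule list_avg_nonneg) simp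
  have "B\<^sup>2 \<le> A * C"
  proof (cases "C = 0")
    case True
    have "B = 0"
    proof (rule ccontr)
      assume "B \<noteq> 0"
      \<comment> \<open>With \<open>C = 0\<close> the quadratic is the affine function
        \<open>A - 2 * t * B\<close>, which equals -1 at this \<open>t\<close>.\<close>
      then show False using q[of "(A + 1) / (2 * B)"] True by simp
    qed
    then show ?thesis using True by simp
  next
    case False
    then show ?thesis using q[of "B / C"] C0
      by (simp add: power2_eq_square field_simps)
  qed
  then show ?thesis by (simp add: A_def B_def C_def)
qed

section \<open>Mean-square norms, centring and independence of disjoint stretches\<close>

definition l2norm :: "nat \<Rightarrow> ((int ^ 'd::finite) list \<Rightarrow> real) \<Rightarrow> real" where
  "l2norm n f = sqrt (list_avg n (\<lambda>l. (f l)\<^sup>2))"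

lemma list_avg_sq_nonneg [simp]: "0 \<le> list_avg n (\<lambda>l :: (int ^ 'd::finite) list. (f l :: real)\<^sup>2)"
  by (rule list_avg_nonneg) simp

lemma l2norm_nonneg [simp]: "0 \<le> l2norm n f"
  by (simp add: l2norm_def)

lemma l2norm_power2: "(l2norm n f)\<^sup>2 = list_avg n (\<lambda>l. (f l)\<^sup>2)"
  by (simp add: l2norm_def)

lemma abs_list_avg_mult_le: "\<bar>list_avg n (\<lambda>l. f l * g l)\<bar> \<le> l2norm n f * l2norm n g"
  unfolding l2norm_def real_sqrt_mult[symmetric]
  by (rule real_le_rsqrt) (use list_avg_Cauchy_Schwarz[of n f g] in simp)

lemma l2norm_triangle: "l2norm n (\<lambda>l. f l + g l) \<le> l2norm n f + l2norm n g"
proof (rule power2_le_imp_le)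
  have "(l2norm n (\<lambda>l. f l + g l))\<^sup>2 = list_avg n (\<lambda>l. ((f l)\<^sup>2 + 2 * (f l * g l)) + (g l)\<^sup>2)"
    unfolding l2norm_power2 by (rule list_avg_cong) (simp add: power2_eq_square algebra_simps)
  also have "\<dots> = (l2norm n f)\<^sup>2 + 2 * list_avg n (\<lambda>l. f l * g l) + (l2norm n g)\<^sup>2"
    by (simp add: list_avg_add list_avg_cmult l2norm_power2)
  also have "\<dots> \<le> (l2norm n f + l2norm n g)\<^sup>2"
    using abs_list_avg_mult_le[of n f g] by (simp add: power2_sum)
  finally show "(l2norm n (\<lambda>l. f l + g l))\<^sup>2 \<le> (l2norm n f + l2norm n g)\<^sup>2" .
qed simp

lemma l2norm_cong: "(\<And>l. length l = n \<Longrightarrow> set l \<subseteq> unit_steps \<Longrightarrow> f l = g l) \<Longrightarrow> l2norm n f = l2norm n g"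
  unfolding l2norm_def by (simp cong: list_avg_cong)

lemma l2norm_uminus: "l2norm n (\<lambda>l. - f l) = l2norm n f"
  by (simp add: l2norm_def)

lemma l2norm_diff_triangle: "\<bar>l2norm n f - l2norm n g\<bar> \<le> l2norm n (\<lambda>l. f l - g l)"
  using l2norm_triangle[of n "\<lambda>l. f l - g l" g] l2norm_triangle[of n "\<lambda>l. g l - f l" f]
    l2norm_uminus[of n "\<lambda>l. f l - g l"] by simp

lemma list_avg_abs_le_l2norm: "list_avg n (\<lambda>l. \<bar>f l\<bar>) \<le> l2norm n f"
  using abs_list_avg_mult_le[of n "\<lambda>l. \<bar>f l\<bar>" "\<lambda>_. 1"] by (simp add: l2norm_def)

lemma l2norm_le_bound: "(\<And>l. length l = n \<Longrightarrow> set l \<subseteq> unit_steps \<Longrightarrow> \<bar>f l\<bar> \<le> c) \<Longrightarrow> 0 \<le> c \<Longrightarrow> l2norm n f \<le> c"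
  unfolding l2norm_def
  by (rule real_le_lsqrt) (auto intro!: list_avg_le_const simp: abs_le_square_iff[symmetric])

definition centred :: "nat \<Rightarrow> ((int ^ 'd::finite) list \<Rightarrow> real) \<Rightarrow> (int ^ 'd) list \<Rightarrow> real" where
  "centred n f = (\<lambda>l. f l - list_avg n f)"

lemma list_avg_centred [simp]: "list_avg n (centred n f) = 0"
  by (simp add: centred_def list_avg_diff)

lemma l2norm_centred_le: "l2norm n (centred n f) \<le> l2norm n f"
proof -
  have "list_avg n (\<lambda>l. (centred n f l)\<^sup>2)
    = list_avg n (\<lambda>l. ((f l)\<^sup>2 - (2 * list_avg n f) * f l) + (list_avg n f)\<^sup>2)"
    by (rule list_avg_cong) (simp add: centred_def power2_eq_square algebra_simps)
  also have "\<dots> = list_avg n (\<lambda>l. (f l)\<^sup>2) - (list_avg n f)\<^sup>2"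
    by (simp only: list_avg_add list_avg_diff list_avg_cmult list_avg_const) (simp add: power2_eq_square)
  finally show ?thesis by (simp add: l2norm_def)
qed

text \<open>The two stretches are independent, so the mixed term is a product of means, and a single
  vanishing mean removes it.\<close>

lemma l2norm_append_indep:
  assumes "list_avg a f = 0"
  shows "(l2norm (a + b) (\<lambda>l. f (take a l) + g (drop a l)))\<^sup>2 = (l2norm a f)\<^sup>2 + (l2norm b g)\<^sup>2"
proof -
  have "(l2norm (a + b) (\<lambda>l. f (take a l) + g (drop a l)))\<^sup>2
    = list_avg a (\<lambda>l. list_avg b (\<lambda>l'. (f l + g l')\<^sup>2))"
    unfolding l2norm_power2 list_avg_append by (intro list_avg_cong) simp
  also have "\<dots> = list_avg a (\<lambda>l. list_avg b (\<lambda>l'. ((f l)\<^sup>2 + (2 * f l) * g l') + (g l')\<^sup>2))"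
    by (simp add: power2_sum algebra_simps)
  also have "\<dots> = list_avg a (\<lambda>l. ((f l)\<^sup>2 + (2 * list_avg b g) * f l) + list_avg b (\<lambda>l'. (g l')\<^sup>2))"
    by (simp add: list_avg_add list_avg_cmult list_avg_multc)
  also have "\<dots> = (l2norm a f)\<^sup>2 + (l2norm b g)\<^sup>2"
    by (simp add: list_avg_add list_avg_cmult assms l2norm_power2)
  finally show ?thesis .
qed

subsection \<open>Ranges, sausages and capacity\<close>

primrec lrange :: "(int ^ 'd::finite) list \<Rightarrow> (int ^ 'd) set" where
  "lrange [] = {0}"
| "lrange (v # l) = insert 0 ((+) v ` lrange l)"

lemma finite_lrange [simp]: "finite (lrange l)"
  by (induction l) auto

lemma zero_in_lrange [simp]: "0 \<in> lrange l"
  by (cases l) auto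

lemma card_lrange_le: "card (lrange l) \<le> length l + 1"
proof (induction l)
  case (Cons v l)
  have "card (lrange (v # l)) \<le> Suc (card ((+) v ` lrange l))" by (simp add: card_insert_if)
  then show ?case using Cons card_image_le[of "lrange l" "(+) v"] by simp
qed simp

lemma lrange_append: "lrange (l @ l') = lrange l \<union> (+) (sum_list l) ` lrange l'"
  by (induction l) (auto simp: image_Un image_image add.assoc)

lemma lrange_eq: "lrange l = (\<lambda>t. sum_list (take t l)) ` {..length l}"
proof (induction l)
  case (Cons v l)
  have "{..length (v # l)} = insert 0 (Suc ` {..length l})"
    by (auto simp: image_iff) (metis atMost_iff not0_implies_Suc Suc_le_mono)
  then show ?case by (simp add: Cons image_image)
qed simp

text \<open>Reading the walk backwards from its endpoint. This lets the junction of two stretches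
  serve as a common origin in \<open>cross_le\<close> and \<open>capr_middle\<close>.\<close>

lemma lrange_rev: "lrange l = (\<lambda>x. sum_list l - x) ` lrange (rev l)"
proof (induction l)
  case (Cons v l)
  have "(+) v ` lrange l = (\<lambda>x. v + (sum_list l - x)) ` lrange (rev l)"
    by (subst Cons) (simp add: image_image)
  moreover have "v + sum_list l - sum_list (rev l) = v" by (simp add: sum_list_rev)
  moreover have "v \<in> (+) v ` lrange l" using zero_in_lrange[of l] by force
  ultimately show ?case
    by (auto simp: lrange_append image_Un image_image sum_list_rev algebra_simps)
qed simp

lemma sum_lrange_le:
  fixes f :: "int ^ 'd::finite \<Rightarrow> real"
  assumes "\<And>x. f x \<ge> 0"
  shows "(\<Sum>x\<in>lrange l. f x) \<le> (\<Sum>t\<le>length l. f (sum_list (take t l)))"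
  unfolding lrange_eq using sum_image_le[of "{..length l}" f "\<lambda>t. sum_list (take t l)"] assms by simp

text \<open>The starting point is not tested, because the return time looks only at times from 1
  on.\<close>

primrec avoid :: "(int ^ 'd::finite) set \<Rightarrow> int ^ 'd \<Rightarrow> (int ^ 'd) list \<Rightarrow> bool" where
  "avoid A x [] = True"
| "avoid A x (v # l) = (x + v \<notin> A \<and> avoid A (x + v) l)"

lemma avoid_append: "avoid A x (l @ l') \<longleftrightarrow> avoid A x l \<and> avoid A (x + sum_list l) l'"
  by (induction l arbitrary: x) (auto simp: add.assoc)

lemma avoid_Cons_iff: "avoid A x (v # l) \<longleftrightarrow> (\<forall>y\<in>lrange l. x + v + y \<notin> A)"
  by (induction l arbitrary: x v) (auto simp: add.assoc)

lemma avoid_iff: "avoid A x l \<longleftrightarrow> (\<forall>t\<in>{1..length l}. x + sum_list (take t l) \<notin> A)"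
proof (cases l)
  case (Cons v l')
  have "{1..length l} = Suc ` {..length l'}" by (simp add: Cons atMost_atLeast0 image_Suc_atLeastAtMost)
  then show ?thesis by (simp add: Cons avoid_Cons_iff lrange_eq add.assoc del: avoid.simps)
qed simp

definition esc :: "nat \<Rightarrow> (int ^ 'd::finite) set \<Rightarrow> int ^ 'd \<Rightarrow> real" where
  "esc n A x = list_avg n (\<lambda>l. of_bool (avoid A x l))"

section \<open>Finite averages as integrals over the stream of steps\<close>

interpretation SRW: prob_space "SRW :: (int ^ 'd::finite) stream measure"
  unfolding SRW_def by (rule prob_space.prob_space_stream_space[OF prob_space_measure_pmf])

lemma space_SRW [simp]: "space (SRW :: (int ^ 'd::finite) stream measure) = UNIV"
  by (simp add: SRW_def space_stream_space)

lemma sets_SRW: "sets (SRW :: (int ^ 'd::finite) stream measure) = sets (stream_space (count_space UNIV))"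
  unfolding SRW_def by (rule sets_stream_space_cong) simp

lemma measurable_stake_SRW [measurable]:
  "stake n \<in> measurable (SRW :: (int ^ 'd::finite) stream measure) (count_space UNIV)"
  using measurable_stake[of n] measurable_cong_sets[OF sets_SRW refl] by blast

lemma step_avg_eq_integral: "(\<integral>\<^sup>+v. ennreal (f v) \<partial>measure_pmf step_pmf) = ennreal (step_avg f)"
  if "\<And>v :: int ^ 'd::finite. f v \<ge> 0" for f :: "_ \<Rightarrow> real"
  unfolding step_pmf_def step_avg_def
  by (subst nn_integral_pmf_of_set)
     (simp_all add: that sum_nonneg sum_ennreal divide_ennreal ennreal_of_nat_eq_real_of_nat)

lemma nn_integral_stake:
  fixes f :: "(int ^ 'd::finite) list \<Rightarrow> real"
  assumes "\<And>l. f l \<ge> 0"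
  shows "(\<integral>\<^sup>+w. ennreal (f (stake n w)) \<partial>SRW) = ennreal (list_avg n f)"
  using assms
proof (induction n arbitrary: f)
  case 0
  then show ?case by (simp add: SRW.emeasure_space_1[simplified])
next
  case (Suc n)
  have m: "(\<lambda>w. ennreal (f (stake (Suc n) w))) \<in> borel_measurable (stream_space (measure_pmf step_pmf))"
    unfolding SRW_def[symmetric]
    by (rule measurable_compose[OF measurable_stake_SRW]) simp
  have "(\<integral>\<^sup>+w. ennreal (f (stake (Suc n) w)) \<partial>SRW)
      = (\<integral>\<^sup>+v. (\<integral>\<^sup>+w. ennreal (f (v # stake n w)) \<partial>SRW) \<partial>measure_pmf step_pmf)"
    unfolding SRW_def by (subst prob_space.nn_integral_stream_space[OF prob_space_measure_pmf m]) simp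
  also have "\<dots> = (\<integral>\<^sup>+v. ennreal (list_avg n (\<lambda>l. f (v # l))) \<partial>measure_pmf step_pmf)"
    by (intro nn_integral_cong Suc.IH Suc.prems)
  also have "\<dots> = ennreal (list_avg (Suc n) f)"
    by (subst step_avg_eq_integral) (auto intro!: list_avg_nonneg Suc.prems)
  finally show ?case .
qed

lemma borel_measurable_stake [measurable]:
  "(\<lambda>w. f (stake n w)) \<in> borel_measurable (SRW :: (int ^ 'd::finite) stream measure)"
  by (rule measurable_compose[OF measurable_stake_SRW]) simp

lemma integrable_stake:
  fixes f :: "(int ^ 'd::finite) list \<Rightarrow> 'b::{banach, second_countable_topology}"
  assumes "\<And>l. length l = n \<Longrightarrow> norm (f l) \<le> C"
  shows "integrable SRW (\<lambda>w. f (stake n w))"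
  by (rule SRW.integrable_const_bound[where B = C]) (auto simp: assms)

lemma integral_stake:
  fixes f :: "(int ^ 'd::finite) list \<Rightarrow> real"
  assumes "\<And>l. length l = n \<Longrightarrow> \<bar>f l\<bar> \<le> C"
  shows "(\<integral>w. f (stake n w) \<partial>SRW) = list_avg n f"
proof -
  \<comment> \<open>Adding \<open>C\<close> makes the integrand nonnegative, as
    \<open>nn_integral_stake\<close> demands for all lists; the bound is available only at length
    \<open>n\<close>, hence the value 0 elsewhere.\<close>
  define h where "h l = (if length l = n then f l + C else 0)" for l
  have h0: "h l \<ge> 0" for l using assms[of l] by (auto simp: h_def)
  have "(\<integral>w. h (stake n w) \<partial>SRW) = list_avg n h"
    by (rule integral_eq_nn_integral[THEN trans])
       (auto simp: h0 nn_integral_stake list_avg_nonneg)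
  moreover have "list_avg n h = list_avg n f + C"
    by (subst list_avg_cong[of n h "\<lambda>l. f l + C"]) (auto simp: h_def list_avg_add)
  moreover have "(\<integral>w. h (stake n w) \<partial>SRW) = (\<integral>w. f (stake n w) + C \<partial>SRW)"
    by (simp add: h_def)
  moreover have "(\<integral>w. f (stake n w) + C \<partial>SRW) = (\<integral>w. f (stake n w) \<partial>SRW) + C"
    by (subst Bochner_Integration.integral_add)
       (auto intro!: integrable_stake[where C = C] simp: assms SRW.prob_space[simplified])
  ultimately show ?thesis by simp
qed

lemma integral_stake_complex:
  fixes f :: "(int ^ 'd::finite) list \<Rightarrow> complex"
  assumes "\<And>l. length l = n \<Longrightarrow> norm (f l) \<le> C"
  shows "(\<integral>w. f (stake n w) \<partial>SRW) = list_avg n f"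
proof (rule complex_eqI)
  have i: "integrable SRW (\<lambda>w. f (stake n w))" by (rule integrable_stake[OF assms])
  show "Re (\<integral>w. f (stake n w) \<partial>SRW) = Re (list_avg n f)"
    using integral_Re[OF i] integral_stake[of n "\<lambda>l. Re (f l)" C] order_trans[OF abs_Re_le_cmod assms]
    by (simp add: list_avg_Re)
  show "Im (\<integral>w. f (stake n w) \<partial>SRW) = Im (list_avg n f)"
    using integral_Im[OF i] integral_stake[of n "\<lambda>l. Im (f l)" C] order_trans[OF abs_Im_le_cmod assms]
    by (simp add: list_avg_Im)
qed

lemma sum_list_stake: "sum_list (stake t w) = (\<Sum>i<t. w !! i)"
proof (induction t)
  case (Suc t)
  have "stake (Suc t) w = stake t w @ [w !! t]" by (rule stake_Suc)
  then show ?case by (simp add: Suc del: stake.simps)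
qed simp

lemma walk_eq: "walk x w t = x + sum_list (stake t w)"
  by (simp add: walk_def sum_list_stake)

lemma walk_range_eq: "walk_range w n = lrange (stake n w)"
  unfolding walk_range_def lrange_eq atLeast0AtMost length_stake
  by (rule image_cong) (auto simp: walk_eq take_stake min_def)

lemma measure_avoid: "measure SRW {w. avoid A x (stake n w)} = esc n A x"
proof -
  have "{w. avoid A x (stake n w)} \<in> sets SRW"
    using measurable_sets[OF measurable_stake_SRW, of "{l. avoid A x l}" n] by (simp add: vimage_def)
  then have "measure SRW {w. avoid A x (stake n w)} = (\<integral>w. indicator {w. avoid A x (stake n w)} w \<partial>SRW)"
    by simp
  also have "\<dots> = (\<integral>w. of_bool (avoid A x (stake n w)) \<partial>SRW)"
    by (rule Bochner_Integration.integral_cong) (auto simp: indicator_def)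
  also have "\<dots> = esc n A x"
    unfolding esc_def by (rule integral_stake[where C = 1]) simp
  finally show ?thesis .
qed

lemma avoid_stake_mono: "m \<le> n \<Longrightarrow> avoid A x (stake n w) \<Longrightarrow> avoid A x (stake m w)"
  using stake_add[of m w "n - m"] avoid_append[of A x "stake m w" "stake (n - m) (sdrop m w)"] by simp

lemma escape_prob_set: "{w \<in> space SRW. \<forall>t\<ge>1. walk x w t \<notin> A} = (\<Inter>n. {w. avoid A x (stake n w)})"
proof -
  have "avoid A x (stake n w) \<longleftrightarrow> (\<forall>t\<in>{1..n}. walk x w t \<notin> A)" for n w
    unfolding avoid_iff walk_eq by (auto simp: take_stake min_def)
  then show ?thesis by (simp add: set_eq_iff) (meson atLeastAtMost_iff order_refl)
qed

lemma esc_tendsto: "(\<lambda>n. esc n A x) \<longlonglongrightarrow> escape_prob A x"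
proof -
  have s: "{w. avoid A x (stake n w)} \<in> sets SRW" for n
    using measurable_sets[OF measurable_stake_SRW, of "{l. avoid A x l}" n] by (simp add: vimage_def)
  have "(\<lambda>n. measure SRW {w. avoid A x (stake n w)}) \<longlonglongrightarrow> measure SRW (\<Inter>n. {w. avoid A x (stake n w)})"
    by (rule SRW.finite_Lim_measure_decseq) (auto simp: s decseq_def dest: avoid_stake_mono)
  then show ?thesis by (simp only: measure_avoid escape_prob_def escape_prob_set)
qed

lemma decseq_esc: "decseq (\<lambda>n. esc n A x)"
proof (rule decseq_SucI)
  fix n
  have "esc (n + 1) A x \<le> esc n A x"
    unfolding esc_def list_avg_append
    by (rule list_avg_mono, rule list_avg_le_const) (simp add: avoid_append)
  then show "esc (Suc n) A x \<le> esc n A x" by simp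
qed

lemma escape_prob_le_esc: "escape_prob A x \<le> esc n A x"
  by (rule decseq_ge[OF decseq_esc esc_tendsto])

lemma escape_prob_nonneg [simp]: "0 \<le> escape_prob A x"
  by (simp add: escape_prob_def)

lemma escape_prob_le_1: "escape_prob A x \<le> 1"
  by (simp add: escape_prob_def)

section \<open>Capacity as the growth rate of the expected sausage volume\<close>

definition sausage :: "(int ^ 'd::finite) set \<Rightarrow> (int ^ 'd) list \<Rightarrow> (int ^ 'd) set" where
  "sausage A l = (\<Union>a\<in>A. \<Union>y\<in>lrange l. {a - y})"

text \<open>This is why \<open>sausage\<close> is formed with differences: a point belongs to it
  when the walk started there meets \<open>A\<close>.\<close>

lemma in_sausage_iff: "z \<in> sausage A l \<longleftrightarrow> (\<exists>y\<in>lrange l. z + y \<in> A)"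
  by (auto simp: sausage_def algebra_simps)

lemma finite_sausage [simp]: "finite A \<Longrightarrow> finite (sausage A l)"
  by (simp add: sausage_def)

lemma sausage_Un: "sausage (A \<union> B) l = sausage A l \<union> sausage B l"
  by (auto simp: sausage_def)

lemma sausage_mono: "A \<subseteq> B \<Longrightarrow> sausage A l \<subseteq> sausage B l"
  by (auto simp: sausage_def)

definition vol :: "nat \<Rightarrow> (int ^ 'd::finite) set \<Rightarrow> real" where
  "vol n A = list_avg n (\<lambda>l. real (card (sausage A l)))"

text \<open>A point of the sausage is counted at the last time it is covered.\<close>

lemma card_sausage_Cons:
  assumes "finite A"
  shows "card (sausage A (v # l)) = card (sausage A l) + card {a \<in> A. avoid A a (v # l)}"
proof -
  let ?S = "(\<lambda>z. z - v) ` sausage A l"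
  have "sausage A (v # l) = ?S \<union> {a \<in> A. avoid A a (v # l)}"
  proof (rule set_eqI)
    fix z
    have "z \<in> ?S \<longleftrightarrow> z + v \<in> sausage A l" by (force simp: image_iff)
    also have "\<dots> \<longleftrightarrow> (\<exists>y\<in>lrange l. z + v + y \<in> A)" by (simp add: in_sausage_iff)
    finally show "z \<in> sausage A (v # l) \<longleftrightarrow> z \<in> ?S \<union> {a \<in> A. avoid A a (v # l)}"
      by (auto simp: in_sausage_iff avoid_Cons_iff add.assoc simp del: avoid.simps)
  qed
  moreover have "?S \<inter> {a \<in> A. avoid A a (v # l)} = {}"
    by (auto simp: in_sausage_iff avoid_Cons_iff simp del: avoid.simps)
  ultimately have "card (sausage A (v # l)) = card ?S + card {a \<in> A. avoid A a (v # l)}"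
    using assms by (simp add: card_Un_disjoint del: avoid.simps)
  then show ?thesis by (simp add: card_image inj_on_def del: avoid.simps)
qed

lemma vol_Suc:
  assumes "finite A"
  shows "vol (Suc n) A - vol n A = (\<Sum>a\<in>A. esc (Suc n) A a)"
proof -
  have "vol (Suc n) A = step_avg (\<lambda>v. list_avg n (\<lambda>l. real (card (sausage A l)) +
      (\<Sum>a\<in>A. of_bool (avoid A a (v # l)))))"
    unfolding vol_def list_avg.simps card_sausage_Cons[OF assms] of_nat_add
    using assms by (simp add: sum_of_bool_eq Int_def del: avoid.simps)
  also have "\<dots> = vol n A + (\<Sum>a\<in>A. esc (Suc n) A a)"
    by (simp add: list_avg_add list_avg_sum step_avg_add step_avg_sum vol_def esc_def del: avoid.simps)
  finally show ?thesis by simp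
qed

lemma vol_Suc_tendsto_Cap:
  assumes "finite A"
  shows "(\<lambda>n. vol (Suc n) A - vol n A) \<longlonglongrightarrow> Cap A"
  unfolding vol_Suc[OF assms] Cap_def
  by (intro tendsto_sum LIMSEQ_Suc[OF esc_tendsto])

text \<open>If the increments settled above \<open>K\<close>, then \<open>u\<close> would eventually
  outgrow the linear bound. All capacity inequalities below come from it: a bound on combinations of
  \<open>vol n\<close> that is linear in \<open>n\<close> becomes a bound on the same combination of
  \<open>Cap\<close>.\<close>

lemma increment_limit_le:
  fixes u :: "nat \<Rightarrow> real"
  assumes lim: "(\<lambda>n. u (Suc n) - u n) \<longlonglongrightarrow> c" and le: "\<And>n. u n \<le> K * (real n + 1)"
  shows "c \<le> K"
proof (rule ccontr)
  assume "\<not> c \<le> K"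
  then have "(c + K) / 2 < c" by simp
  from order_tendstoD(1)[OF lim this] obtain N where N: "\<And>n. n \<ge> N \<Longrightarrow> (c + K) / 2 < u (Suc n) - u n"
    unfolding eventually_sequentially by blast
  have g: "u (N + j) \<ge> u N + real j * ((c + K) / 2)" for j
  proof (induction j)
    case (Suc j)
    then show ?case using N[of "N + j"] by (simp add: field_simps)
  qed simp
  \<comment> \<open>From \<open>N\<close> on, \<open>u\<close> gains at least
    \<open>(c + K) / 2\<close> per step where only \<open>K\<close> is allowed. The lead of
    \<open>(c - K) / 2\<close> per step beats any constant; the threshold is this comparison
    multiplied by 2.\<close>
  have "c - K > 0" using \<open>\<not> c \<le> K\<close> by simp
  then obtain j :: nat where "real j * (c - K) > 2 * (K * (real N + 1) - u N)"
    using reals_Archimedean3 by blast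
  moreover have "real j * (c - K) \<le> 2 * (K * (real N + 1) - u N)"
    using g[of j] le[of "N + j"] by (simp add: field_simps)
  ultimately show False by simp
qed

text \<open>Not visible from the definition, since enlarging the set adds summands but lowers each
  escape probability; for sausages the monotonicity is plain.\<close>

lemma Cap_mono:
  assumes "A \<subseteq> B" "finite B"
  shows "Cap A \<le> Cap B"
proof -
  have A: "finite A" using assms finite_subset by auto
  have "Cap A - Cap B \<le> 0"
  proof (rule increment_limit_le)
    show "(\<lambda>n. (vol (Suc n) A - vol (Suc n) B) - (vol n A - vol n B)) \<longlonglongrightarrow> Cap A - Cap B"
      using tendsto_diff[OF vol_Suc_tendsto_Cap[OF A] vol_Suc_tendsto_Cap[OF assms(2)]]
      by (simp add: algebra_simps)
    show "vol n A - vol n B \<le> 0 * (real n + 1)" for n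
      using assms by (auto simp: vol_def intro!: list_avg_mono card_mono sausage_mono)
  qed
  then show ?thesis by simp
qed

lemma Cap_Un_le:
  assumes "finite A" "finite B"
  shows "Cap (A \<union> B) \<le> Cap A + Cap B"
proof -
  have "Cap (A \<union> B) - Cap A - Cap B \<le> 0"
  proof (rule increment_limit_le)
    have "finite (A \<union> B)" using assms by simp
    from tendsto_diff[OF tendsto_diff[OF vol_Suc_tendsto_Cap[OF this] vol_Suc_tendsto_Cap[OF assms(1)]]
      vol_Suc_tendsto_Cap[OF assms(2)]]
    show "(\<lambda>n. (vol (Suc n) (A \<union> B) - vol (Suc n) A - vol (Suc n) B) - (vol n (A \<union> B) - vol n A - vol n B))
       \<longlonglongrightarrow> Cap (A \<union> B) - Cap A - Cap B"
      by (simp add: algebra_simps)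
    have "vol n (A \<union> B) \<le> vol n A + vol n B" for n
      unfolding vol_def list_avg_add[symmetric] sausage_Un of_nat_add[symmetric]
      by (intro list_avg_mono) (simp only: of_nat_le_iff card_Un_le)
    then show "vol n (A \<union> B) - vol n A - vol n B \<le> 0 * (real n + 1)" for n by (simp add: algebra_simps)
  qed
  then show ?thesis by simp
qed

lemma Cap_nonneg [simp]: "0 \<le> Cap A"
  unfolding Cap_def by (rule sum_nonneg) simp

lemma Cap_le_card: "Cap A \<le> real (card A)"
  unfolding Cap_def using sum_mono[of A "escape_prob A" "\<lambda>_. 1"] by (simp add: escape_prob_le_1)

lemma Cap_translate: "Cap ((+) z ` A) = Cap A"
proof -
  have "avoid ((+) z ` A) (z + x) l \<longleftrightarrow> avoid A x l" for x l
    by (induction l arbitrary: x) (auto simp: add.assoc image_iff)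
  then have "esc n ((+) z ` A) (z + x) = esc n A x" for n x by (simp add: esc_def)
  then have "escape_prob ((+) z ` A) (z + x) = escape_prob A x" for x
    using LIMSEQ_unique[OF esc_tendsto[of "(+) z ` A" "z + x"]] esc_tendsto[of A x] by simp
  then show ?thesis unfolding Cap_def by (subst sum.reindex) auto
qed

subsection \<open>A heat kernel bound in dimension at least six\<close>

definition hk :: "nat \<Rightarrow> int ^ 'd::finite \<Rightarrow> real" where
  "hk t x = list_avg t (\<lambda>l. of_bool (sum_list l = x))"

text \<open>The mass function of the one-dimensional simple walk after \<open>m\<close> fair
  steps.\<close>

primrec srw1 :: "nat \<Rightarrow> int \<Rightarrow> real" where
  "srw1 0 y = of_bool (y = 0)"
| "srw1 (Suc m) y = (srw1 m (y - 1) + srw1 m (y + 1)) / 2"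

lemma srw1_nonneg [simp]: "0 \<le> srw1 m y"
  by (induction m arbitrary: y) auto

lemma srw1_le_1: "srw1 m y \<le> 1"
proof (induction m arbitrary: y)
  case (Suc m)
  show ?case using Suc.IH[of "y - 1"] Suc.IH[of "y + 1"] by simp
qed simp

text \<open>As \<open>j\<close> is a natural number, this records both the parity of the support and
  its lower end. Beyond the upper end the binomial coefficient of \<open>srw1_eq_binomial\<close>
  vanishes by itself.\<close>

lemma srw1_support: "srw1 m y \<noteq> 0 \<Longrightarrow> \<exists>j. y = 2 * int j - int m"
proof (induction m arbitrary: y)
  case 0
  then show ?case by (auto intro: exI[of _ 0] split: if_splits)
next
  case (Suc m)
  then have "srw1 m (y - 1) \<noteq> 0 \<or> srw1 m (y + 1) \<noteq> 0" by auto
  then show ?case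
  proof
    assume "srw1 m (y - 1) \<noteq> 0"
    from Suc.IH[OF this] obtain j where "y - 1 = 2 * int j - int m" by blast
    then show ?thesis by (intro exI[of _ "Suc j"]) simp
  next
    assume "srw1 m (y + 1) \<noteq> 0"
    from Suc.IH[OF this] obtain j where "y + 1 = 2 * int j - int m" by blast
    then show ?thesis by (intro exI[of _ j]) simp
  qed
qed

lemma srw1_eq_binomial: "srw1 m (2 * int j - int m) = real (m choose j) / 2 ^ m"
proof (induction m arbitrary: j)
  case 0
  then show ?case by (cases j) auto
next
  case (Suc m)
  have e: "2 * int j - int (Suc m) + 1 = 2 * int j - int m" by simp
  show ?case
  proof (cases j)
    case 0
    \<comment> \<open>The left neighbour lies below the support: the boundary case of Pascal's
      rule.\<close>
    have "srw1 m (- int m - 2) = 0"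
      using srw1_support[of m "- int m - 2"] by fastforce
    then show ?thesis using Suc.IH[of 0] 0 by (simp add: algebra_simps)
  next
    case (Suc i)
    have "2 * int j - int (Suc m) - 1 = 2 * int i - int m" by (simp add: Suc)
    then show ?thesis
      unfolding srw1.simps e using Suc.IH[of i] Suc.IH[of j] by (simp add: Suc field_simps)
  qed
qed

lemma central_binomial_Suc:
  "real (2 * Suc k choose Suc k) * real (k + 1) = 2 * (2 * real k + 1) * real (2 * k choose k)"
proof -
  define B where "B = (2 * Suc k choose Suc k)"
  define b where "b = (2 * k choose k)"
  have "Suc k * B = Suc (Suc (2 * k)) * (Suc (2 * k) choose k)"
    using Suc_times_binomial[of k "Suc (2 * k)"] by (simp add: B_def)
  also have "(Suc (2 * k) choose k) = (Suc (2 * k) choose Suc k)"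
    by (subst binomial_symmetric) simp_all
  finally have "Suc k * B = 2 * (Suc k * (Suc (2 * k) choose Suc k))" by simp
  also have "Suc k * (Suc (2 * k) choose Suc k) = Suc (2 * k) * b"
    unfolding b_def by (rule Suc_times_binomial)
  finally have "real (Suc k * B) = real (2 * (Suc (2 * k) * b))" by simp
  then show ?thesis unfolding B_def[symmetric] b_def[symmetric] by (simp add: algebra_simps)
qed

text \<open>A Wallis product: the expression starts at 1 and decreases, the ratio of consecutive
  values being \<open>(2 * k + 1) * (2 * k + 3) / (2 * k + 2) ^ 2\<close>, whose numerator is one
  less than its denominator.\<close>

lemma central_binomial_sq_le: "(real (2 * k choose k) / 4 ^ k)\<^sup>2 * (2 * real k + 1) \<le> 1"
proof (induction k)
  case (Suc k)
  define b where "b = real (2 * k choose k) / 4 ^ k"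
  have "real (2 * Suc k choose Suc k) = 2 * (2 * real k + 1) * real (2 * k choose k) / real (k + 1)"
    by (subst central_binomial_Suc[symmetric]) simp
  also have "\<dots> / 4 ^ Suc k = b * ((2 * real k + 1) / (2 * real k + 2))"
    unfolding b_def by (simp add: divide_simps) (simp add: algebra_simps)
  finally have e: "real (2 * Suc k choose Suc k) / 4 ^ Suc k = b * ((2 * real k + 1) / (2 * real k + 2))" .
  have "(real (2 * Suc k choose Suc k) / 4 ^ Suc k)\<^sup>2 * (2 * real (Suc k) + 1)
    = (b\<^sup>2 * (2 * real k + 1)) * ((2 * real k + 1) * (2 * real k + 3) / (2 * real k + 2)\<^sup>2)"
    unfolding e by (simp add: power_mult_distrib power_divide) (simp add: power2_eq_square algebra_simps)
  also have "\<dots> \<le> 1 * 1"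
  proof (rule mult_mono)
    show "b\<^sup>2 * (2 * real k + 1) \<le> 1" using Suc by (simp add: b_def)
    show "(2 * real k + 1) * (2 * real k + 3) / (2 * real k + 2)\<^sup>2 \<le> 1"
      by (subst divide_le_eq_1_pos, simp) (simp add: power2_eq_square algebra_simps)
  qed simp_all
  finally show ?case by simp
qed simp

lemma srw1_le: "srw1 m y \<le> 1 / sqrt (real m + 1)"
proof (cases "srw1 m y = 0")
  case False
  have c: "real (2 * k choose k) / 4 ^ k \<le> 1 / sqrt (2 * real k + 1)" for k
  proof -
    define b where "b = real (2 * k choose k) / 4 ^ k"
    have "sqrt (b\<^sup>2 * (2 * real k + 1)) \<le> 1"
      using central_binomial_sq_le[of k] by (simp add: b_def)
    moreover have "b \<ge> 0" by (simp add: b_def)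
    ultimately have "b * sqrt (2 * real k + 1) \<le> 1" by (simp add: real_sqrt_mult)
    then show ?thesis unfolding b_def[symmetric] by (simp add: field_simps)
  qed
  from srw1_support[OF False] obtain j where j: "y = 2 * int j - int m" by blast
  have "srw1 m y \<le> real (m choose (m div 2)) / 2 ^ m"
    unfolding j srw1_eq_binomial by (intro divide_right_mono) (auto simp: binomial_maximum)
  also have "\<dots> \<le> 1 / sqrt (real m + 1)"
  proof (cases "even m")
    case True
    then obtain k where "m = 2 * k" by (auto elim: evenE)
    then show ?thesis using c[of k] by (simp add: power_mult)
  next
    case False
    then obtain k where k: "m = 2 * k + 1" by (auto elim: oddE)
    \<comment> \<open>For odd \<open>m\<close> the central coefficient is half of the next even one,
      and the extra factor 2 turns \<open>2 ^ m\<close> into \<open>4 ^ Suc k\<close>.\<close>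
    have "(2 * Suc k choose Suc k) = (Suc (2 * k) choose k) + (Suc (2 * k) choose Suc k)" by simp
    also have "(Suc (2 * k) choose Suc k) = (Suc (2 * k) choose k)"
      by (subst binomial_symmetric) simp_all
    finally have "real (m choose (m div 2)) / 2 ^ m = real (2 * Suc k choose Suc k) / 4 ^ Suc k"
      by (simp add: k power_mult)
    also have "\<dots> \<le> 1 / sqrt (2 * real (Suc k) + 1)" by (rule c)
    also have "\<dots> \<le> 1 / sqrt (real m + 1)" by (simp add: k frac_le)
    finally show ?thesis .
  qed
  finally show ?thesis .
qed simp

section \<open>Random axis counts: the walk as a multinomial mixture of products of one-dimensional
  walks\<close>

primrec axis_avg :: "nat \<Rightarrow> (('d::finite \<Rightarrow> nat) \<Rightarrow> real) \<Rightarrow> ('d \<Rightarrow> nat) \<Rightarrow> real" where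
  "axis_avg 0 h n = h n"
| "axis_avg (Suc t) h n = (\<Sum>i\<in>UNIV. axis_avg t h (n(i := Suc (n i)))) / real CARD('d)"

lemma axis_avg_mono: "(\<And>n. h n \<le> h' n) \<Longrightarrow> axis_avg t h n \<le> axis_avg t h' n"
  by (induction t arbitrary: n) (auto intro!: divide_right_mono sum_mono)

lemma axis_avg_sum: "axis_avg t (\<lambda>n. \<Sum>i\<in>I. h i n) n = (\<Sum>i\<in>I. axis_avg t (h i) n)"
proof (induction t arbitrary: n)
  case (Suc t)
  show ?case unfolding axis_avg.simps Suc.IH by (subst sum.swap) (simp add: sum_divide_distrib)
qed simp

lemma axis_avg_cmult: "axis_avg t (\<lambda>n. c * h n) n = c * axis_avg t h n"
  by (induction t arbitrary: n) (auto simp: sum_distrib_left[symmetric])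

text \<open>The law of the walk given that \<open>n i\<close> steps were taken along axis
  \<open>i\<close>: the coordinates are then independent.\<close>

definition prod_srw1 :: "('d::finite \<Rightarrow> nat) \<Rightarrow> int ^ 'd \<Rightarrow> real" where
  "prod_srw1 n x = (\<Prod>i\<in>UNIV. srw1 (n i) (x $ i))"

lemma step_avg_axes:
  "step_avg (f :: int ^ 'd::finite \<Rightarrow> real) = (\<Sum>i\<in>UNIV. f (axis i 1) + f (axis i (-1))) / (2 * real CARD('d))"
proof -
  let ?P = "range (\<lambda>i. axis i 1 :: int ^ 'd)" and ?N = "range (\<lambda>i. axis i (-1) :: int ^ 'd)"
  have d: "?P \<inter> ?N = {}" by (auto simp: axis_eq_axis)
  have ip: "inj (\<lambda>i. axis i 1 :: int ^ 'd)" and im: "inj (\<lambda>i. axis i (-1) :: int ^ 'd)"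
    by (auto simp: inj_def axis_eq_axis)
  have "card (unit_steps :: (int ^ 'd) set) = 2 * CARD('d)"
    unfolding unit_steps_eq using d by (simp add: card_Un_disjoint card_image ip im)
  moreover have "sum f unit_steps = (\<Sum>i\<in>UNIV. f (axis i 1)) + (\<Sum>i\<in>UNIV. f (axis i (-1)))"
    unfolding unit_steps_eq using d by (simp add: sum.union_disjoint sum.reindex ip im o_def)
  ultimately show ?thesis by (simp add: step_avg_def sum.distrib)
qed

text \<open>Averaging over the two directions of one axis advances the walk in that coordinate by
  one step and leaves the others alone.\<close>

lemma prod_srw1_step:
  "prod_srw1 n (x - axis i 1) + prod_srw1 n (x - axis i (-1)) = 2 * prod_srw1 (n(i := Suc (n i))) x"
proof -
  define R where "R = (\<Prod>j\<in>UNIV - {i}. srw1 (n j) (x $ j))"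
  have e: "prod_srw1 n (x - axis i c) = srw1 (n i) (x $ i - c) * R" for c
    unfolding prod_srw1_def R_def
    by (subst prod.remove[of _ i]) (auto simp: axis_def intro!: prod.cong)
  have "prod_srw1 (n(i := Suc (n i))) x = srw1 (Suc (n i)) (x $ i) * R"
    unfolding prod_srw1_def R_def
    by (subst prod.remove[of _ i]) (auto intro!: prod.cong)
  then show ?thesis unfolding e by (simp add: algebra_simps)
qed

lemma list_avg_prod_srw1:
  "list_avg t (\<lambda>l. prod_srw1 n (x - sum_list l)) = axis_avg t (\<lambda>n. prod_srw1 n x) n"
proof (induction t arbitrary: n)
  case (Suc t)
  have "list_avg (Suc t) (\<lambda>l. prod_srw1 n (x - sum_list l))
      = list_avg t (\<lambda>l. step_avg (\<lambda>v. prod_srw1 n ((x - sum_list l) - v)))"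
    by (simp add: list_avg_step_swap algebra_simps)
  also have "\<dots> = list_avg t (\<lambda>l. \<Sum>i\<in>UNIV. prod_srw1 (n(i := Suc (n i))) (x - sum_list l) / real CARD('a))"
    unfolding step_avg_axes prod_srw1_step by (simp add: sum_divide_distrib sum_distrib_left)
  also have "\<dots> = axis_avg (Suc t) (\<lambda>n. prod_srw1 n x) n"
    by (simp add: list_avg_sum list_avg_divide Suc.IH sum_divide_distrib fun_upd_def)
  finally show ?case .
qed simp

lemma hk_eq_axis_avg: "hk t x = axis_avg t (\<lambda>n. prod_srw1 n x) (\<lambda>_. 0)"
proof -
  have "prod_srw1 (\<lambda>_. 0) (x - s) = of_bool (s = x)" for s :: "int ^ 'a"
    by (auto simp: prod_srw1_def vec_eq_iff) metis
  then show ?thesis unfolding hk_def list_avg_prod_srw1[symmetric] by simp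
qed

text \<open>The joint law of the axis counts is avoided: a product of six factors is at most the
  sixth power of the largest, hence at most the sum of all sixth powers, and each summand depends on
  one count only. Six factors of exponent 1/2 produce the exponent 3.\<close>

lemma prod_srw1_le:
  assumes "card I = 6"
  shows "prod_srw1 n x \<le> (\<Sum>i\<in>I. 1 / (real (n i) + 1) ^ 3)"
proof -
  define a where "a i = 1 / sqrt (real (n i) + 1)" for i
  have I: "finite I" "I \<noteq> {}" using assms by (auto intro: card_ge_0_finite)
  have "prod_srw1 n x = (\<Prod>i\<in>UNIV - I. srw1 (n i) (x $ i)) * (\<Prod>i\<in>I. srw1 (n i) (x $ i))"
    unfolding prod_srw1_def by (rule prod.subset_diff) auto
  also have "\<dots> \<le> 1 * (\<Prod>i\<in>I. a i)"
    by (intro mult_mono prod_mono prod_le_1 prod_nonneg) (auto simp: srw1_le_1 srw1_le a_def)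
  also have "(\<Prod>i\<in>I. a i) \<le> (\<Prod>i\<in>I. Max (a ` I))"
    using I by (intro prod_mono) (auto simp: a_def)
  also have "\<dots> = Max (a ` I) ^ 6" by (simp add: assms)
  also have "\<dots> \<le> (\<Sum>i\<in>I. a i ^ 6)"
  proof -
    have "Max (a ` I) \<in> a ` I" using I by (intro Max_in) auto
    then obtain i where "i \<in> I" "Max (a ` I) = a i" by auto
    then show ?thesis using I member_le_sum[of i I "\<lambda>i. a i ^ 6"] by simp
  qed
  also have "(\<Sum>i\<in>I. a i ^ 6) = (\<Sum>i\<in>I. 1 / (real (n i) + 1) ^ 3)"
  proof (rule sum.cong)
    fix i
    have "sqrt (real (n i) + 1) ^ 6 = (sqrt (real (n i) + 1) ^ 2) ^ 3" unfolding power_mult[symmetric] by simp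
    then show "a i ^ 6 = 1 / (real (n i) + 1) ^ 3" by (simp add: a_def power_divide)
  qed simp
  finally show ?thesis by simp
qed

text \<open>A single axis count is binomial, since each step falls on axis \<open>i\<close> with
  probability \<open>a\<close>. Conditioning on the first step turns the induction into Pascal's
  rule.\<close>

lemma axis_avg_coordinate:
  fixes h :: "nat \<Rightarrow> real" and i :: "'d::finite"
  defines "a \<equiv> 1 / real CARD('d)"
  shows "axis_avg t (\<lambda>n. h (n i)) n
    = (\<Sum>j\<le>t. real (t choose j) * a ^ j * (1 - a) ^ (t - j) * h (n i + j))"
proof (induction t arbitrary: n)
  case (Suc t)
  define b where "b = 1 - a"
  define F where "F k = (\<Sum>j\<le>t. real (t choose j) * a ^ j * b ^ (t - j) * h (k + j))" for k
  have "(\<Sum>k\<in>UNIV. axis_avg t (\<lambda>n. h (n i)) (n(k := Suc (n k))))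
      = (\<Sum>k\<in>UNIV. F ((n(k := Suc (n k))) i))"
    unfolding Suc.IH F_def b_def ..
  also have "\<dots> = F (Suc (n i)) + (\<Sum>k\<in>UNIV - {i}. F (n i))"
    by (subst sum.remove[of _ i]) auto
  also have "\<dots> = F (Suc (n i)) + (real CARD('d) - 1) * F (n i)"
    by (simp add: card_Diff_singleton of_nat_diff)
  finally have "axis_avg (Suc t) (\<lambda>n. h (n i)) n = a * F (Suc (n i)) + b * F (n i)"
    by (simp add: a_def b_def field_simps)
  also have "\<dots> = (\<Sum>j\<le>Suc t. real (Suc t choose j) * a ^ j * b ^ (Suc t - j) * h (n i + j))"
  proof -
    have "b * F (n i) = b ^ Suc t * h (n i) + (\<Sum>j\<le>t. real (t choose Suc j) * a ^ Suc j * b ^ (t - j) * h (n i + Suc j))"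
    proof -
      have "b * F (n i) = (\<Sum>j\<le>Suc t. real (t choose j) * a ^ j * b ^ (Suc t - j) * h (n i + j))"
        by (simp add: F_def sum_distrib_left Suc_diff_le algebra_simps binomial_eq_0)
      then show ?thesis by (subst (asm) sum.atMost_Suc_shift) simp
    qed
    moreover have "a * F (Suc (n i)) = (\<Sum>j\<le>t. real (t choose j) * a ^ Suc j * b ^ (t - j) * h (n i + Suc j))"
      by (simp add: F_def sum_distrib_left algebra_simps)
    ultimately show ?thesis
      by (subst sum.atMost_Suc_shift) (simp add: sum.distrib[symmetric] algebra_simps)
  qed
  finally show ?case by (simp add: b_def)
qed simp

text \<open>The rising product stands in for a cube because the binomial coefficient absorbs it
  exactly, raising both entries by 3. What remains is part of the expansion of
  \<open>(a + b) ^ (t + 3)\<close>, which is 1.\<close>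

lemma axis_avg_inverse_cube_le:
  fixes i :: "'d::finite"
  shows "axis_avg t (\<lambda>n. 1 / ((real (n i) + 1) * (real (n i) + 2) * (real (n i) + 3))) (\<lambda>_. 0)
    \<le> real CARD('d) ^ 3 / ((real t + 1) * (real t + 2) * (real t + 3))"
proof -
  define a where "a = 1 / real CARD('d)"
  define b where "b = 1 - a"
  define T where "T = (real t + 1) * (real t + 2) * (real t + 3)"
  have ab: "a > 0" "b \<ge> 0" "a + b = 1" by (auto simp: a_def b_def field_simps)
  have T: "T > 0" by (simp add: T_def)
  have ch: "real (t choose j) / ((real j + 1) * (real j + 2) * (real j + 3)) = real (t + 3 choose (j + 3)) / T" for j
  proof -
    have s: "real (Suc k) * real (Suc n choose Suc k) = real (Suc n) * real (n choose k)" for n k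
      unfolding of_nat_mult[symmetric] Suc_times_binomial ..
    have "(real j + 3) * real (t + 3 choose (j + 3)) = (real t + 3) * real (t + 2 choose (j + 2))"
      using s[of "j + 2" "t + 2"] by (simp add: eval_nat_numeral algebra_simps)
    moreover have "(real j + 2) * real (t + 2 choose (j + 2)) = (real t + 2) * real (t + 1 choose (j + 1))"
      using s[of "j + 1" "t + 1"] by (simp add: eval_nat_numeral algebra_simps)
    moreover have "(real j + 1) * real (t + 1 choose (j + 1)) = (real t + 1) * real (t choose j)"
      using s[of j t] by (simp add: algebra_simps)
    ultimately have "((real j + 1) * (real j + 2) * (real j + 3)) * real (t + 3 choose (j + 3)) = T * real (t choose j)"
      unfolding T_def by algebra
    then show ?thesis using T by (simp add: divide_simps) (simp add: algebra_simps)
  qed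
  have "axis_avg t (\<lambda>n. 1 / ((real (n i) + 1) * (real (n i) + 2) * (real (n i) + 3))) (\<lambda>_. 0)
    = (\<Sum>j\<le>t. a ^ j * b ^ (t - j) * (real (t choose j) / ((real j + 1) * (real j + 2) * (real j + 3))))"
    unfolding axis_avg_coordinate[of t "\<lambda>k. 1 / ((real k + 1) * (real k + 2) * (real k + 3))"]
    by (simp add: a_def b_def mult_ac)
  also have "\<dots> = (\<Sum>j\<le>t. real (t + 3 choose (j + 3)) * a ^ (j + 3) * b ^ ((t + 3) - (j + 3))) / (a ^ 3 * T)"
    unfolding ch sum_divide_distrib using ab T by (intro sum.cong) (auto simp: power_add field_simps)
  also have "\<dots> \<le> 1 / (a ^ 3 * T)"
  proof (rule divide_right_mono)
    have "(\<Sum>j\<le>t. real (t + 3 choose (j + 3)) * a ^ (j + 3) * b ^ ((t + 3) - (j + 3)))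
      = (\<Sum>k\<in>(\<lambda>j. j + 3) ` {..t}. real (t + 3 choose k) * a ^ k * b ^ ((t + 3) - k))"
      by (subst sum.reindex) (auto simp: inj_on_def)
    also have "\<dots> \<le> (\<Sum>k\<le>t + 3. real (t + 3 choose k) * a ^ k * b ^ ((t + 3) - k))"
      using ab by (intro sum_mono2) auto
    also have "\<dots> = (a + b) ^ (t + 3)" by (simp add: binomial_ring)
    finally show "(\<Sum>j\<le>t. real (t + 3 choose (j + 3)) * a ^ (j + 3) * b ^ ((t + 3) - (j + 3))) \<le> 1"
      using ab by simp
    show "0 \<le> a ^ 3 * T" using ab T by simp
  qed
  also have "\<dots> = real CARD('d) ^ 3 / T" by (simp add: a_def power_divide)
  finally show ?thesis by (simp add: T_def)
qed

lemma hk_le: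
  fixes x :: "int ^ 'd::finite"
  assumes "CARD('d) \<ge> 6"
  shows "hk t x \<le> 36 * real CARD('d) ^ 3 / (real t + 1) ^ 3"
proof -
  obtain I :: "'d set" where I: "card I = 6"
    using obtain_subset_with_card_n[OF assms] by blast
  \<comment> \<open>The factor 6 is sharp at \<open>k = 0\<close>; together with the six axes in
    \<open>I\<close> it gives the constant 36.\<close>
  have q: "1 / (real k + 1) ^ 3 \<le> 6 * (1 / ((real k + 1) * (real k + 2) * (real k + 3)))" for k
  proof -
    have "(real k + 2) * (real k + 3) \<le> 6 * (real k + 1)\<^sup>2"
      by (simp add: power2_eq_square algebra_simps)
    then have "(real k + 1) * ((real k + 2) * (real k + 3)) \<le> (real k + 1) * (6 * (real k + 1)\<^sup>2)"
      by (rule mult_left_mono) simp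
    then have "6 / (6 * (real k + 1) ^ 3) \<le> 6 / ((real k + 1) * (real k + 2) * (real k + 3))"
      by (intro divide_left_mono) (auto simp: power2_eq_square power3_eq_cube mult_ac)
    then show ?thesis by simp
  qed
  have "hk t x \<le> axis_avg t (\<lambda>n. \<Sum>i\<in>I. 1 / (real (n i) + 1) ^ 3) (\<lambda>_. 0)"
    unfolding hk_eq_axis_avg by (intro axis_avg_mono prod_srw1_le I)
  also have "\<dots> \<le> axis_avg t (\<lambda>n. \<Sum>i\<in>I. 6 * (1 / ((real (n i) + 1) * (real (n i) + 2) * (real (n i) + 3)))) (\<lambda>_. 0)"
    by (intro axis_avg_mono sum_mono q)
  also have "\<dots> \<le> (\<Sum>i\<in>I. 6 * (real CARD('d) ^ 3 / ((real t + 1) * (real t + 2) * (real t + 3))))"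
    unfolding axis_avg_sum axis_avg_cmult by (intro sum_mono mult_left_mono axis_avg_inverse_cube_le) simp
  also have "\<dots> = 36 * real CARD('d) ^ 3 / ((real t + 1) * (real t + 2) * (real t + 3))"
    by (simp add: I)
  also have "\<dots> \<le> 36 * real CARD('d) ^ 3 / (real t + 1) ^ 3"
  proof (rule divide_left_mono)
    show "(real t + 1) ^ 3 \<le> (real t + 1) * (real t + 2) * (real t + 3)"
      by (simp add: power3_eq_cube algebra_simps)
  qed auto
  finally show ?thesis .
qed

subsection \<open>The Green function and the capacity of unions\<close>

lemma hk_nonneg [simp]: "0 \<le> hk t x"
  unfolding hk_def by (rule list_avg_nonneg) simp

lemma sum_list_map_uminus: "sum_list (map uminus l) = - (sum_list l :: int ^ 'd::finite)"
  by (induction l) auto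

lemma hk_uminus: "hk t (- x) = hk t x"
proof -
  have "hk t x = list_avg t (\<lambda>l. of_bool (sum_list (map uminus l) = x))"
    unfolding hk_def by (rule list_avg_map_uminus[symmetric])
  also have "\<dots> = hk t (- x)"
    unfolding hk_def sum_list_map_uminus by (intro list_avg_cong) (auto simp: of_bool_def)
  finally show ?thesis ..
qed

text \<open>Chapman-Kolmogorov; the sign in front of the sum is free by the symmetry of the
  kernel.\<close>

lemma hk_add: "list_avg u (\<lambda>l. hk t (z + sum_list l)) = hk (t + u) z"
proof -
  have "hk t (z + s) = list_avg t (\<lambda>l'. of_bool (s + sum_list l' = - z))" for s :: "int ^ 'a"
  proof -
    have "hk t (z + s) = hk t (- (z + s))" by (rule hk_uminus[symmetric])
    also have "\<dots> = list_avg t (\<lambda>l'. of_bool (s + sum_list l' = - z))"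
      unfolding hk_def by (simp only: eq_neg_iff_add_eq_0 add_ac)
    finally show ?thesis .
  qed
  then have "list_avg u (\<lambda>l. hk t (z + sum_list l)) = hk (u + t) (- z)"
    unfolding hk_def list_avg_append by (simp add: sum_list_append)
  then show ?thesis by (simp add: hk_uminus add.commute)
qed

lemma inverse_cube_telescope: "1 / (real m + 1) ^ 3 \<le> 2 / (real m + 1)\<^sup>2 - 2 / (real m + 2)\<^sup>2"
proof -
  define r where "r = real m + 1"
  have r: "r \<ge> 1" by (simp add: r_def)
  have "r * 2 * (r + 1)\<^sup>2 - 2 * r * r\<^sup>2 - (r + 1)\<^sup>2 = 3 * r\<^sup>2 - 1" by (simp add: power2_eq_square algebra_simps)
  also have "\<dots> \<ge> 0" using one_le_power[OF r, of 2] by simp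
  finally have "(r + 1)\<^sup>2 \<le> 2 * r * (r + 1)\<^sup>2 - 2 * r * r\<^sup>2" by simp
  then have "(r + 1)\<^sup>2 / (r ^ 3 * (r + 1)\<^sup>2) \<le> (2 * r * (r + 1)\<^sup>2 - 2 * r * r\<^sup>2) / (r ^ 3 * (r + 1)\<^sup>2)"
    using r by (intro divide_right_mono) auto
  then have "1 / r ^ 3 \<le> 2 / r\<^sup>2 - 2 / (r + 1)\<^sup>2"
    using r by (simp add: diff_divide_distrib power2_eq_square power3_eq_cube)
  then show ?thesis by (simp add: r_def add.commute)
qed

lemma sum_inverse_cube_le: "(\<Sum>t<T. 1 / (real (t + u) + 1) ^ 3) \<le> 2 / (real u + 1)\<^sup>2"
proof -
  have "(\<Sum>t<T. 1 / (real (t + u) + 1) ^ 3) \<le> 2 / (real u + 1)\<^sup>2 - 2 / (real (u + T) + 1)\<^sup>2"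
  proof (induction T)
    case (Suc T)
    then show ?case using inverse_cube_telescope[of "T + u"] by (simp add: add_ac)
  qed simp
  also have "\<dots> \<le> 2 / (real u + 1)\<^sup>2" by simp
  finally show ?thesis .
qed

lemma sum_inverse_square_le: "(\<Sum>t<T. 1 / (real (t + u) + 1)\<^sup>2) \<le> 2 / (real u + 1)"
proof -
  have "(\<Sum>t<T. 1 / (real (t + u) + 1)\<^sup>2) \<le> 2 / (real u + 1) - 2 / (real (u + T) + 1)"
  proof (induction T)
    case (Suc T)
    have "1 / r\<^sup>2 \<le> 2 / r - 2 / (r + 1)" if "r \<ge> 1" for r :: real
      using that by (simp add: divide_simps power2_eq_square)
    from this[of "real (T + u) + 1"] show ?case using Suc by (simp add: add_ac)
  qed simp
  also have "\<dots> \<le> 2 / (real u + 1)" by simp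
  finally show ?thesis .
qed

definition green :: "int ^ 'd::finite \<Rightarrow> real" where
  "green x = (\<Sum>t. hk t x)"

lemma green_uminus: "green (- x) = green x"
  by (simp add: green_def hk_uminus)

text \<open>The positions at two times are determined by independent increments over
  \<open>s\<close> and \<open>u\<close> steps; all later steps average out.\<close>

lemma list_avg_two_times:
  fixes F :: "int ^ 'd::finite \<Rightarrow> int ^ 'd \<Rightarrow> 'b::real_normed_field"
  assumes "s + u \<le> a"
  shows "list_avg a (\<lambda>l. F (sum_list (take s l)) (sum_list (take (s + u) l)))
    = list_avg s (\<lambda>l. list_avg u (\<lambda>l'. F (sum_list l) (sum_list l + sum_list l')))"
proof -
  define r where "r = a - s - u"
  have a: "a = s + (u + r)" using assms by (simp add: r_def)
  show ?thesis
    unfolding a list_avg_append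
  proof (intro list_avg_cong)
    fix l l' :: "(int ^ 'd) list" assume l: "length l = s" "length l' = u"
    have "list_avg r (\<lambda>l''. F (sum_list (take s (l @ l' @ l''))) (sum_list (take (s + u) (l @ l' @ l''))))
      = list_avg r (\<lambda>l'' :: (int ^ 'd) list. F (sum_list l) (sum_list l + sum_list l'))"
      using l by (intro list_avg_cong) simp
    then show "list_avg r (\<lambda>l''. F (sum_list (take s (l @ l' @ l''))) (sum_list (take (s + u) (l @ l' @ l''))))
      = F (sum_list l) (sum_list l + sum_list l')" by simp
  qed
qed

text \<open>Points are added, not subtracted, because both lists lead away from the junction: the
  first one is meant to be the earlier stretch read backwards, as in
  \<open>cross_le\<close>.\<close>

definition range_interaction :: "(int ^ 'd::finite) list \<Rightarrow> (int ^ 'd) list \<Rightarrow> real" where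
  "range_interaction l l' = (\<Sum>x\<in>lrange l. \<Sum>y\<in>lrange l'. green (x + y))"

definition cross :: "(int ^ 'd::finite) list \<Rightarrow> (int ^ 'd) list \<Rightarrow> real" where
  "cross l l' = Cap (lrange l) + Cap (lrange l') - Cap (lrange (l @ l'))"

lemma cross_nonneg: "0 \<le> cross l l'"
  using Cap_Un_le[of "lrange l" "(+) (sum_list l) ` lrange l'"]
  by (simp add: cross_def lrange_append Cap_translate)

definition harm0 :: "nat \<Rightarrow> real" where
  "harm0 n = (\<Sum>j\<le>n. 1 / (real j + 1))"

lemma harm0_nonneg [simp]: "0 \<le> harm0 n"
  unfolding harm0_def by (rule sum_nonneg) simp

text \<open>The harmonic sum is at most 1 + ln x, and ln x is 4 times the logarithm of x^(1/4),
  hence at most 4 (x^(1/4) - 1); the 1 is absorbed.\<close>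

lemma harm0_le: "harm0 n \<le> 4 * (real n + 1) powr (1 / 4)"
proof -
  have "harm0 n \<le> 1 + ln (real n + 1)"
  proof (induction n)
    case (Suc n)
    have "ln ((real n + 1) / (real n + 2)) \<le> (real n + 1) / (real n + 2) - 1"
      by (rule ln_le_minus_one) simp
    then have "1 / (real n + 2) \<le> ln (real n + 2) - ln (real n + 1)"
      by (simp add: ln_div field_simps)
    then show ?case using Suc by (simp add: harm0_def add_ac)
  qed (simp add: harm0_def)
  moreover have "ln ((real n + 1) powr (1 / 4)) \<le> (real n + 1) powr (1 / 4) - 1"
    by (rule ln_le_minus_one) simp
  ultimately show ?thesis by (simp add: ln_powr)
qed

text \<open>Pairs of times are indexed by the earlier one and the gap, the variables in which
  increments are independent. Diagonal pairs are counted in both halves, which nonnegativity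
  permits.\<close>

lemma sum_square_split_le:
  fixes F G :: "nat \<Rightarrow> nat \<Rightarrow> real"
  assumes F: "\<And>i j. F i j \<ge> 0" and G: "\<And>i u. G i u \<ge> 0" and "a \<le> n"
    and le: "\<And>i u. i + u \<le> a \<Longrightarrow> F i (i + u) + F (i + u) i \<le> G i u"
  shows "(\<Sum>i\<le>a. \<Sum>j\<le>a. F i j) \<le> (\<Sum>i\<le>n. \<Sum>u\<le>n. G i u)"
proof -
  let ?D = "{(i, u). i + u \<le> a}"
  have fD: "finite ?D" by (rule finite_subset[of _ "{..a} \<times> {..a}"]) auto
  have "(\<Sum>i\<le>a. \<Sum>j\<le>a. F i j) = (\<Sum>(i, j)\<in>{..a} \<times> {..a}. F i j)" by (simp add: sum.cartesian_product)
  also have "\<dots> \<le> (\<Sum>(i, j)\<in>{..a} \<times> {..a}. (if i \<le> j then F i j else 0) + (if j \<le> i then F i j else 0))"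
    using F by (intro sum_mono) auto
  also have "\<dots> = (\<Sum>(i, j)\<in>{..a} \<times> {..a}. if i \<le> j then F i j else 0) + (\<Sum>(i, j)\<in>{..a} \<times> {..a}. if j \<le> i then F i j else 0)"
    by (simp add: sum.distrib case_prod_unfold)
  also have "(\<Sum>(i, j)\<in>{..a} \<times> {..a}. if i \<le> j then F i j else 0) = (\<Sum>(i, u)\<in>?D. F i (i + u))"
  proof -
    have "(\<Sum>(i, j)\<in>{..a} \<times> {..a}. if i \<le> j then F i j else 0) = (\<Sum>(i, j)\<in>{p \<in> {..a} \<times> {..a}. fst p \<le> snd p}. F i j)"
      by (subst sum.inter_filter) (auto simp: case_prod_unfold intro!: sum.cong)
    also have "\<dots> = (\<Sum>(i, u)\<in>?D. F i (i + u))"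
      by (rule sum.reindex_bij_witness[of _ "\<lambda>(i, u). (i, i + u)" "\<lambda>(i, j). (i, j - i)"]) auto
    finally show ?thesis .
  qed
  also have "(\<Sum>(i, j)\<in>{..a} \<times> {..a}. if j \<le> i then F i j else 0) = (\<Sum>(i, u)\<in>?D. F (i + u) i)"
  proof -
    have "(\<Sum>(i, j)\<in>{..a} \<times> {..a}. if j \<le> i then F i j else 0) = (\<Sum>(i, j)\<in>{p \<in> {..a} \<times> {..a}. snd p \<le> fst p}. F i j)"
      by (subst sum.inter_filter) (auto simp: case_prod_unfold intro!: sum.cong)
    also have "\<dots> = (\<Sum>(i, u)\<in>?D. F (i + u) i)"
      by (rule sum.reindex_bij_witness[of _ "\<lambda>(i, u). (i + u, i)" "\<lambda>(i, j). (j, i - j)"]) auto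
    finally show ?thesis .
  qed
  also have "(\<Sum>(i, u)\<in>?D. F i (i + u)) + (\<Sum>(i, u)\<in>?D. F (i + u) i) \<le> (\<Sum>(i, u)\<in>?D. G i u)"
    unfolding sum.distrib[symmetric] using le by (intro sum_mono) auto
  also have "\<dots> \<le> (\<Sum>(i, u)\<in>{..n} \<times> {..n}. G i u)"
    using G assms(3) by (intro sum_mono2) auto
  also have "\<dots> = (\<Sum>i\<le>n. \<Sum>u\<le>n. G i u)" by (simp add: sum.cartesian_product)
  finally show ?thesis .
qed

text \<open>Up to the final theorem the dimension enters only through this decay.\<close>

locale heat_bound =
  fixes dim :: "'d::finite itself" and C0 :: real
  assumes hk_bound: "hk t (x :: int ^ 'd) \<le> C0 / (real t + 1) ^ 3"
begin

lemma C0_ge_1: "C0 \<ge> 1"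
  using hk_bound[of 0 0] by (simp add: hk_def)

text \<open>Bounds the tail of the Green series from time \<open>u\<close> on, and therefore the
  mean of \<open>green\<close> after \<open>u\<close> further steps.\<close>

definition gb :: "nat \<Rightarrow> real" where
  "gb u = 2 * C0 / (real u + 1)\<^sup>2"

lemma gb_nonneg [simp]: "0 \<le> gb u"
  using C0_ge_1 by (simp add: gb_def)

lemma gb_antimono: "u \<le> v \<Longrightarrow> gb v \<le> gb u"
  using C0_ge_1 unfolding gb_def by (intro divide_left_mono power_mono) auto

lemma sum_hk_le: "(\<Sum>t<T. hk (t + u) (z :: int ^ 'd)) \<le> gb u"
proof -
  have "(\<Sum>t<T. hk (t + u) z) \<le> (\<Sum>t<T. C0 * (1 / (real (t + u) + 1) ^ 3))"
    using hk_bound by (intro sum_mono) (simp only: mult_1_right times_divide_eq_right)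
  also have "\<dots> \<le> C0 * (2 / (real u + 1)\<^sup>2)"
    unfolding sum_distrib_left[symmetric] using C0_ge_1 by (intro mult_left_mono sum_inverse_cube_le) simp
  finally show ?thesis by (simp add: gb_def mult.commute)
qed

lemma summable_hk: "summable (\<lambda>t. hk t (z :: int ^ 'd))"
  using sum_hk_le[where u = 0] by (intro summableI_nonneg_bounded) auto

lemma green_nonneg [simp]: "0 \<le> green (z :: int ^ 'd)"
  unfolding green_def by (intro suminf_nonneg summable_hk) simp

lemma sum_hk_le_green:
  assumes "finite J" "inj_on f J"
  shows "(\<Sum>j\<in>J. hk (f j) (z :: int ^ 'd)) \<le> green z"
proof -
  have "(\<Sum>j\<in>J. hk (f j) z) = (\<Sum>t\<in>f ` J. hk t z)" using assms by (simp add: sum.reindex)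
  also have "\<dots> \<le> green z" unfolding green_def using assms by (intro sum_le_suminf summable_hk) auto
  finally show ?thesis .
qed

text \<open>Averaging over \<open>u\<close> steps shifts every time in the Green series by
  \<open>u\<close>, so only a tail is left; this is done for partial sums and then passed to the
  limit.\<close>

lemma green_avg_le: "list_avg u (\<lambda>l. green (z + sum_list l)) \<le> gb u" for z :: "int ^ 'd"
proof (rule LIMSEQ_le_const2)
  show "(\<lambda>T. list_avg u (\<lambda>l. \<Sum>t<T. hk t (z + sum_list l))) \<longlonglongrightarrow> list_avg u (\<lambda>l. green (z + sum_list l))"
    unfolding green_def by (intro list_avg_tendsto summable_LIMSEQ summable_hk)
  show "\<exists>N. \<forall>n\<ge>N. list_avg u (\<lambda>l. \<Sum>t<n. hk t (z + sum_list l)) \<le> gb u"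
    unfolding list_avg_sum hk_add using sum_hk_le by blast
qed

text \<open>The defect of the volumes is the overlap of the two sausages. An overlap point is some
  \<open>a - S_i = b - S_j\<close>, and for each of the \<open>n + 1\<close> times \<open>i\<close>
  the expected number of matching times \<open>j\<close> is at most two Green functions.\<close>

lemma Cap_Un_ge:
  fixes A B :: "(int ^ 'd) set"
  assumes "finite A" "finite B"
  shows "Cap A + Cap B - Cap (A \<union> B) \<le> 2 * (\<Sum>a\<in>A. \<Sum>b\<in>B. green (a - b))"
proof (rule increment_limit_le)
  have fU: "finite (A \<union> B)" using assms by simp
  show "(\<lambda>n. (vol (Suc n) A + vol (Suc n) B - vol (Suc n) (A \<union> B)) - (vol n A + vol n B - vol n (A \<union> B)))
      \<longlonglongrightarrow> Cap A + Cap B - Cap (A \<union> B)"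
    using tendsto_diff[OF tendsto_add[OF vol_Suc_tendsto_Cap[OF assms(1)] vol_Suc_tendsto_Cap[OF assms(2)]]
      vol_Suc_tendsto_Cap[OF fU]] by (simp add: algebra_simps)
  fix n
  let ?S = "\<lambda>i (l :: (int ^ 'd) list). sum_list (take i l)"
  have "vol n A + vol n B - vol n (A \<union> B) = list_avg n (\<lambda>l. real (card (sausage A l \<inter> sausage B l)))"
  proof -
    have "real (card (sausage (A \<union> B) l)) + real (card (sausage A l \<inter> sausage B l))
        = real (card (sausage A l)) + real (card (sausage B l))" for l
      unfolding sausage_Un of_nat_add[symmetric] using card_Un_Int[of "sausage A l" "sausage B l"] assms by simp
    then have "vol n (A \<union> B) + list_avg n (\<lambda>l. real (card (sausage A l \<inter> sausage B l))) = vol n A + vol n B"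
      unfolding vol_def list_avg_add[symmetric] by simp
    then show ?thesis by simp
  qed
  also have "\<dots> \<le> list_avg n (\<lambda>l. \<Sum>a\<in>A. \<Sum>b\<in>B. \<Sum>i\<le>n. \<Sum>j\<le>n. of_bool (a - ?S i l = b - ?S j l))"
  proof (rule list_avg_mono)
    fix l :: "(int ^ 'd) list" assume l: "length l = n"
    \<comment> \<open>An overlap point may have several representations; counting all of them only
      enlarges the bound.\<close>
    define Q where "Q = {q \<in> A \<times> B \<times> {..n} \<times> {..n}. case q of (a, b, i, j) \<Rightarrow> a - ?S i l = b - ?S j l}"
    have fQ: "finite Q" unfolding Q_def using assms by auto
    have "sausage A l \<inter> sausage B l \<subseteq> (\<lambda>(a, b, i, j). a - ?S i l) ` Q"
      unfolding sausage_def lrange_eq l Q_def by (force simp: image_iff)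
    then have "card (sausage A l \<inter> sausage B l) \<le> card Q"
      using card_mono[OF finite_imageI[OF fQ]] card_image_le[OF fQ] le_trans by blast
    moreover have "real (card Q) = (\<Sum>a\<in>A. \<Sum>b\<in>B. \<Sum>i\<le>n. \<Sum>j\<le>n. of_bool (a - ?S i l = b - ?S j l))"
    proof -
      have "real (card Q) = (\<Sum>q\<in>A \<times> B \<times> {..n} \<times> {..n}. case q of (a, b, i, j) \<Rightarrow> of_bool (a - ?S i l = b - ?S j l))"
        unfolding Q_def using assms by (simp add: case_prod_unfold sum_of_bool_eq Int_def)
      then show ?thesis by (simp add: sum.cartesian_product del: sum_of_bool_eq)
    qed
    ultimately show "real (card (sausage A l \<inter> sausage B l))
      \<le> (\<Sum>a\<in>A. \<Sum>b\<in>B. \<Sum>i\<le>n. \<Sum>j\<le>n. of_bool (a - ?S i l = b - ?S j l))"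
      by (metis of_nat_le_iff)
  qed
  also have "\<dots> = (\<Sum>a\<in>A. \<Sum>b\<in>B. \<Sum>i\<le>n. \<Sum>j\<le>n. list_avg n (\<lambda>l. of_bool (a - ?S i l = b - ?S j l)))"
    by (simp add: list_avg_sum del: sum_of_bool_eq)
  also have "\<dots> \<le> (\<Sum>a\<in>A. \<Sum>b\<in>B. \<Sum>i\<le>n. 2 * green (a - b))"
  proof (intro sum_mono)
    fix a b i assume i: "i \<in> {..n}"
    have up: "list_avg n (\<lambda>l. of_bool (a - ?S i l = b - ?S j l)) = hk (j - i) (a - b)" if "i \<le> j" "j \<le> n" for j
    proof -
      have "list_avg n (\<lambda>l. of_bool (a - ?S i l = b - ?S (i + (j - i)) l))
          = list_avg i (\<lambda>l. list_avg (j - i) (\<lambda>l'. of_bool (a - sum_list l = b - (sum_list l + sum_list l'))))"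
        by (rule list_avg_two_times[where F = "\<lambda>x y. of_bool (a - x = b - y)"]) (use that in simp)
      also have "\<dots> = list_avg i (\<lambda>l :: (int ^ 'd) list. hk (j - i) (b - a))"
        unfolding hk_def by (intro list_avg_cong) (auto simp: of_bool_def algebra_simps)
      also have "\<dots> = hk (j - i) (a - b)" using hk_uminus[of "j - i" "a - b"] by simp
      finally show ?thesis using that by simp
    qed
    have down: "list_avg n (\<lambda>l. of_bool (a - ?S i l = b - ?S j l)) = hk (i - j) (a - b)" if "j < i" for j
    proof -
      have "list_avg n (\<lambda>l. of_bool (a - ?S (j + (i - j)) l = b - ?S j l))
          = list_avg j (\<lambda>l. list_avg (i - j) (\<lambda>l'. of_bool (a - (sum_list l + sum_list l') = b - sum_list l)))"
        by (rule list_avg_two_times[where F = "\<lambda>x y. of_bool (a - y = b - x)"]) (use that i in simp)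
      also have "\<dots> = list_avg j (\<lambda>l :: (int ^ 'd) list. hk (i - j) (a - b))"
        unfolding hk_def by (intro list_avg_cong) (auto simp: of_bool_def algebra_simps)
      finally show ?thesis using that by simp
    qed
    \<comment> \<open>Within the times before \<open>i\<close>, and within those from
      \<open>i\<close> on, the time lags are distinct, so each part is dominated by one Green
      series. This is the factor 2.\<close>
    have "{..n} = {..<i} \<union> {i..n}" using i by auto
    then have "(\<Sum>j\<le>n. list_avg n (\<lambda>l. of_bool (a - ?S i l = b - ?S j l)))
      = (\<Sum>j\<in>{..<i}. list_avg n (\<lambda>l. of_bool (a - ?S i l = b - ?S j l))) + (\<Sum>j\<in>{i..n}. list_avg n (\<lambda>l. of_bool (a - ?S i l = b - ?S j l)))"
      by (simp only:) (rule sum.union_disjoint, auto)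
    also have "\<dots> = (\<Sum>j\<in>{..<i}. hk (i - j) (a - b)) + (\<Sum>j\<in>{i..n}. hk (j - i) (a - b))"
      using up down by simp
    also have "\<dots> \<le> green (a - b) + green (a - b)"
      by (intro add_mono sum_hk_le_green) (auto simp: inj_on_def)
    finally show "(\<Sum>j\<le>n. list_avg n (\<lambda>l. of_bool (a - ?S i l = b - ?S j l))) \<le> 2 * green (a - b)" by simp
  qed
  also have "\<dots> = 2 * (\<Sum>a\<in>A. \<Sum>b\<in>B. green (a - b)) * (real n + 1)"
    by (simp add: sum_distrib_left sum_distrib_right algebra_simps)
  finally show "vol n A + vol n B - vol n (A \<union> B) \<le> 2 * (\<Sum>a\<in>A. \<Sum>b\<in>B. green (a - b)) * (real n + 1)" .
qed

lemma cross_le: "cross l l' \<le> 2 * range_interaction (rev l) l'" for l l' :: "(int ^ 'd) list"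
proof -
  let ?s = "sum_list l"
  have "cross l l' \<le> 2 * (\<Sum>a\<in>lrange l. \<Sum>b\<in>(+) ?s ` lrange l'. green (a - b))"
    using Cap_Un_ge[of "lrange l" "(+) ?s ` lrange l'"] by (simp add: cross_def lrange_append Cap_translate)
  also have "(\<Sum>a\<in>lrange l. \<Sum>b\<in>(+) ?s ` lrange l'. green (a - b))
      = (\<Sum>x\<in>lrange (rev l). \<Sum>y\<in>lrange l'. green ((?s - x) - (?s + y)))"
    unfolding lrange_rev[of l] by (simp add: sum.reindex inj_on_def)
  also have "\<dots> = range_interaction (rev l) l'"
    unfolding range_interaction_def
  proof (intro sum.cong refl)
    fix x y show "green ((?s - x) - (?s + y)) = green (x + y)"
      using green_uminus[of "x + y"] by (simp add: algebra_simps)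
  qed
  finally show ?thesis by simp
qed

section \<open>Second moment of the interaction of two stretches\<close>

definition green_pair :: "nat \<Rightarrow> nat \<Rightarrow> nat \<Rightarrow> nat \<Rightarrow> nat \<Rightarrow> nat \<Rightarrow> real" where
  "green_pair a b s s' t t' = list_avg a (\<lambda>l :: (int ^ 'd) list. list_avg b (\<lambda>l' :: (int ^ 'd) list.
     green (sum_list (take s l) + sum_list (take t l')) * green (sum_list (take s' l) + sum_list (take t' l'))))"

lemma green_pair_nonneg [simp]: "0 \<le> green_pair a b s s' t t'"
  unfolding green_pair_def by (intro list_avg_nonneg) simp

lemma green_pair_commute: "green_pair a b s s' t t' = green_pair a b s' s t' t"
  by (simp add: green_pair_def mult.commute)

lemma green_pair_expand:
  assumes "s + u \<le> a" "t + v \<le> b"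
  shows "list_avg a (\<lambda>l. list_avg b (\<lambda>l'. F (sum_list (take s l)) (sum_list (take (s + u) l)) (sum_list (take t l')) (sum_list (take (t + v) l'))))
    = list_avg s (\<lambda>x. list_avg u (\<lambda>x'. list_avg t (\<lambda>y. list_avg v (\<lambda>y'.
        F (sum_list x) (sum_list x + sum_list x') (sum_list y) (sum_list y + sum_list y')))))"
proof -
  have "list_avg b (\<lambda>l'. F p q (sum_list (take t l')) (sum_list (take (t + v) l')))
     = list_avg t (\<lambda>y. list_avg v (\<lambda>y'. F p q (sum_list y) (sum_list y + sum_list y')))" for p q
    by (rule list_avg_two_times[OF assms(2)])
  then show ?thesis
    by (simp add: list_avg_two_times[OF assms(1), where F = "\<lambda>p q. list_avg t (\<lambda>y. list_avg v (\<lambda>y'. F p q (sum_list y) (sum_list y + sum_list y')))"])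
qed

text \<open>Both times of the second factor come later. Given the first \<open>s\<close> and
  \<open>t\<close> steps, it still sees \<open>u + v\<close> fresh ones; averaging these out first
  leaves the first factor alone with \<open>s + t\<close> steps.\<close>

lemma green_pair_le_parallel:
  assumes "s + u \<le> a" "t + v \<le> b"
  shows "green_pair a b s (s + u) t (t + v) \<le> gb (s + t) * gb (u + v)"
proof -
  let ?g = "green :: int ^ 'd \<Rightarrow> real"
  have "green_pair a b s (s + u) t (t + v)
    = list_avg s (\<lambda>x. list_avg u (\<lambda>x'. list_avg t (\<lambda>y. list_avg v (\<lambda>y'.
        ?g (sum_list x + sum_list y) * ?g ((sum_list x + sum_list x') + (sum_list y + sum_list y'))))))"
    unfolding green_pair_def by (rule green_pair_expand[OF assms, where F = "\<lambda>p p' q q'. ?g (p + q) * ?g (p' + q')"])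
  also have "\<dots> = list_avg s (\<lambda>x. list_avg t (\<lambda>y. list_avg u (\<lambda>x'. list_avg v (\<lambda>y'.
        ?g (sum_list x + sum_list y) * ?g ((sum_list x + sum_list x') + (sum_list y + sum_list y'))))))"
    by (subst list_avg_swap) simp
  also have "\<dots> = list_avg s (\<lambda>x. list_avg t (\<lambda>y. ?g (sum_list x + sum_list y) *
      list_avg (u + v) (\<lambda>l. ?g ((sum_list x + sum_list y) + sum_list l))))"
    unfolding list_avg_append sum_list_append by (simp add: list_avg_cmult algebra_simps)
  also have "\<dots> \<le> list_avg s (\<lambda>x. list_avg t (\<lambda>y. ?g (sum_list x + sum_list y) * gb (u + v)))"
    by (intro list_avg_mono mult_left_mono green_avg_le) simp
  also have "\<dots> = list_avg (s + t) (\<lambda>l. ?g (0 + sum_list l)) * gb (u + v)"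
    unfolding list_avg_append sum_list_append by (simp add: list_avg_multc)
  also have "\<dots> \<le> gb (s + t) * gb (u + v)"
    by (intro mult_right_mono green_avg_le) simp
  finally show ?thesis .
qed

text \<open>Each factor is late in one walk and early in the other, so the \<open>u\<close> fresh
  steps occur in one factor only and the \<open>v\<close> fresh steps only in the other. Either
  group may be averaged out first, which gives the two bounds.\<close>

lemma green_pair_le_opposite:
  assumes "s + u \<le> a" "t + v \<le> b"
  shows "green_pair a b s (s + u) (t + v) t \<le> gb u * gb (s + t + v)"
    and "green_pair a b s (s + u) (t + v) t \<le> gb v * gb (s + t + u)"
proof -
  let ?g = "green :: int ^ 'd \<Rightarrow> real"
  have e: "green_pair a b s (s + u) (t + v) t
    = list_avg s (\<lambda>x. list_avg u (\<lambda>x'. list_avg t (\<lambda>y. list_avg v (\<lambda>y'.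
        ?g (sum_list x + (sum_list y + sum_list y')) * ?g ((sum_list x + sum_list x') + sum_list y)))))"
    unfolding green_pair_def by (rule green_pair_expand[OF assms, where F = "\<lambda>p p' q q'. ?g (p + q') * ?g (p' + q)"])
  also have "\<dots> = list_avg s (\<lambda>x. list_avg t (\<lambda>y. list_avg u (\<lambda>x'. list_avg v (\<lambda>y'.
        ?g (sum_list x + (sum_list y + sum_list y')) * ?g ((sum_list x + sum_list x') + sum_list y)))))"
    by (subst list_avg_swap) simp
  also have "\<dots> = list_avg s (\<lambda>x. list_avg t (\<lambda>y. list_avg v (\<lambda>y'. list_avg u (\<lambda>x'.
        ?g (sum_list x + (sum_list y + sum_list y')) * ?g ((sum_list x + sum_list x') + sum_list y)))))"
    by (subst (3) list_avg_swap) simp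
  also have "\<dots> = list_avg s (\<lambda>x. list_avg t (\<lambda>y. list_avg v (\<lambda>y'.
        ?g (sum_list x + (sum_list y + sum_list y')) * list_avg u (\<lambda>x'. ?g ((sum_list x + sum_list y) + sum_list x')))))"
    by (simp add: list_avg_cmult algebra_simps)
  also have "\<dots> \<le> list_avg s (\<lambda>x. list_avg t (\<lambda>y. list_avg v (\<lambda>y'.
        ?g (sum_list x + (sum_list y + sum_list y')) * gb u)))"
    by (intro list_avg_mono mult_left_mono green_avg_le) simp
  also have "\<dots> = list_avg (s + (t + v)) (\<lambda>l. ?g (0 + sum_list l)) * gb u"
    unfolding list_avg_append sum_list_append by (simp add: list_avg_multc)
  also have "\<dots> \<le> gb (s + (t + v)) * gb u"
    by (intro mult_right_mono green_avg_le) simp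
  finally show "green_pair a b s (s + u) (t + v) t \<le> gb u * gb (s + t + v)" by (simp add: mult.commute add.assoc)
  have "green_pair a b s (s + u) (t + v) t
    = list_avg s (\<lambda>x. list_avg u (\<lambda>x'. list_avg t (\<lambda>y.
        ?g (sum_list x + (sum_list x' + sum_list y)) * list_avg v (\<lambda>y'. ?g ((sum_list x + sum_list y) + sum_list y')))))"
    unfolding e by (simp add: list_avg_multc list_avg_cmult algebra_simps)
  also have "\<dots> \<le> list_avg s (\<lambda>x. list_avg u (\<lambda>x'. list_avg t (\<lambda>y.
        ?g (sum_list x + (sum_list x' + sum_list y)) * gb v)))"
    by (intro list_avg_mono mult_left_mono green_avg_le) simp
  also have "\<dots> = list_avg (s + (u + t)) (\<lambda>l. ?g (0 + sum_list l)) * gb v"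
    unfolding list_avg_append sum_list_append by (simp add: list_avg_multc)
  also have "\<dots> \<le> gb (s + (u + t)) * gb v"
    by (intro mult_right_mono green_avg_le) simp
  finally show "green_pair a b s (s + u) (t + v) t \<le> gb v * gb (s + t + u)" by (simp add: mult.commute add_ac)
qed

lemma sum_gb_le: "(\<Sum>s\<le>n. gb (s + t)) \<le> 4 * C0 / (real t + 1)"
proof -
  have "(\<Sum>s\<le>n. gb (s + t)) = 2 * C0 * (\<Sum>s<Suc n. 1 / (real (s + t) + 1)\<^sup>2)"
    by (simp add: gb_def sum_distrib_left lessThan_Suc_atMost del: sum.lessThan_Suc)
  also have "\<dots> \<le> 2 * C0 * (2 / (real t + 1))"
    using C0_ge_1 by (intro mult_left_mono sum_inverse_square_le) simp
  finally show ?thesis by simp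
qed

lemma sum_gb_from_le: "(\<Sum>u\<le>n. if v \<le> u then gb u else 0) \<le> 4 * C0 / (real v + 1)"
proof -
  have "(\<Sum>u\<le>n. if v \<le> u then gb u else 0) = (\<Sum>u\<in>{v..n}. gb u)"
    by (subst sum.inter_filter[symmetric]) (auto intro!: sum.cong)
  also have "\<dots> \<le> (\<Sum>u\<in>(\<lambda>s. s + v) ` {..n}. gb u)"
  proof (rule sum_mono2)
    show "{v..n} \<subseteq> (\<lambda>s. s + v) ` {..n}"
    proof
      fix u assume "u \<in> {v..n}"
      then show "u \<in> (\<lambda>s. s + v) ` {..n}" by (intro image_eqI[of _ _ "u - v"]) auto
    qed
  qed auto
  also have "\<dots> = (\<Sum>s\<le>n. gb (s + v))" by (simp add: sum.reindex inj_on_def)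
  finally show ?thesis using sum_gb_le[where n = n and t = v] by simp
qed

lemma sum_gb_harm: "(\<Sum>t\<le>n. 4 * C0 / (real t + 1)) = 4 * C0 * harm0 n"
  by (simp add: harm0_def sum_distrib_left)

lemma sum_gb_gb_le: "(\<Sum>s\<le>n. \<Sum>t\<le>n. gb (s + t)) \<le> 4 * C0 * harm0 n"
proof -
  have "(\<Sum>s\<le>n. \<Sum>t\<le>n. gb (s + t)) = (\<Sum>t\<le>n. \<Sum>s\<le>n. gb (s + t))" by (rule sum.swap)
  also have "\<dots> \<le> (\<Sum>t\<le>n. 4 * C0 / (real t + 1))" by (intro sum_mono sum_gb_le)
  finally show ?thesis by (simp add: sum_gb_harm)
qed

text \<open>The first term serves the parallel order, the others the opposite order. In the latter
  the larger gap is placed in the isolated \<open>gb\<close> factor, so that summing over it leaves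
  a tail in the smaller gap.\<close>

definition pair_bound :: "nat \<Rightarrow> nat \<Rightarrow> nat \<Rightarrow> nat \<Rightarrow> real" where
  "pair_bound s u t v = gb (s + t) * gb (u + v)
     + ((if v \<le> u then gb u else 0) * gb (s + t + v) + (if u \<le> v then gb v else 0) * gb (s + t + u))"

lemma pair_bound_nonneg [simp]: "0 \<le> pair_bound s u t v"
  by (simp add: pair_bound_def)

lemma green_pair_le_pair_bound:
  assumes "s + u \<le> a" "t + v \<le> b"
  shows "green_pair a b s (s + u) t (t + v) \<le> pair_bound s u t v"
    and "green_pair a b s (s + u) (t + v) t \<le> pair_bound s u t v"
proof -
  have "0 \<le> (if v \<le> u then gb u else 0) * gb (s + t + v) + (if u \<le> v then gb v else 0) * gb (s + t + u)"
    by simp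
  then show "green_pair a b s (s + u) t (t + v) \<le> pair_bound s u t v"
    using green_pair_le_parallel[OF assms] unfolding pair_bound_def by linarith
  have P: "0 \<le> gb (s + t) * gb (u + v)" by simp
  show "green_pair a b s (s + u) (t + v) t \<le> pair_bound s u t v"
  proof (cases "v \<le> u")
    case True
    then have "pair_bound s u t v = gb (s + t) * gb (u + v) + (gb u * gb (s + t + v) + (if u \<le> v then gb v else 0) * gb (s + t + u))"
      by (simp add: pair_bound_def)
    moreover have "0 \<le> (if u \<le> v then gb v else 0) * gb (s + t + u)" by simp
    ultimately show ?thesis using P green_pair_le_opposite(1)[OF assms] by linarith
  next
    case False
    then have "pair_bound s u t v = gb (s + t) * gb (u + v) + gb v * gb (s + t + u)"
      by (simp add: pair_bound_def)
    then show ?thesis using P green_pair_le_opposite(2)[OF assms] by linarith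
  qed
qed

lemma sum_pair_bound_le:
  "(\<Sum>s\<le>n. \<Sum>u\<le>n. \<Sum>t\<le>n. \<Sum>v\<le>n. pair_bound s u t v) \<le> 3 * (4 * C0 * harm0 n)\<^sup>2"
proof -
  let ?h = "4 * C0 * harm0 n"
  have h0: "0 \<le> ?h" using C0_ge_1 by simp
  have 1: "(\<Sum>s\<le>n. \<Sum>u\<le>n. \<Sum>t\<le>n. \<Sum>v\<le>n. gb (s + t) * gb (u + v)) \<le> ?h\<^sup>2"
  proof -
    have "(\<Sum>s\<le>n. \<Sum>u\<le>n. \<Sum>t\<le>n. \<Sum>v\<le>n. gb (s + t) * gb (u + v))
      = (\<Sum>s\<le>n. \<Sum>u\<le>n. (\<Sum>t\<le>n. gb (s + t)) * (\<Sum>v\<le>n. gb (u + v)))"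
      by (simp add: sum_product)
    also have "\<dots> = (\<Sum>s\<le>n. \<Sum>t\<le>n. gb (s + t)) * (\<Sum>u\<le>n. \<Sum>v\<le>n. gb (u + v))"
      by (simp add: sum_product)
    also have "\<dots> \<le> ?h * ?h"
      using h0 by (intro mult_mono sum_gb_gb_le) (auto intro!: sum_nonneg)
    finally show ?thesis by (simp add: power2_eq_square)
  qed
  have 2: "(\<Sum>s\<le>n. \<Sum>u\<le>n. \<Sum>t\<le>n. \<Sum>v\<le>n. (if v \<le> u then gb u else 0) * gb (s + t + v)) \<le> ?h\<^sup>2"
  proof -
    \<comment> \<open>Dropping \<open>v\<close> decouples the sums: \<open>s\<close> leaves
      \<open>4 * C0 / (t + 1)\<close>, the range \<open>v \<le> u\<close> leaves
      \<open>4 * C0 / (v + 1)\<close>, and \<open>t\<close> and \<open>v\<close> then give one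
      harmonic sum each.\<close>
    have in1: "(\<Sum>s\<le>n. gb (s + t + v)) \<le> 4 * C0 / (real t + 1)" for t v
    proof -
      have "(\<Sum>s\<le>n. gb (s + t + v)) \<le> (\<Sum>s\<le>n. gb (s + t))" by (intro sum_mono gb_antimono) simp
      then show ?thesis using sum_gb_le[where n = n and t = t] by simp
    qed
    have "(\<Sum>s\<le>n. \<Sum>u\<le>n. \<Sum>t\<le>n. \<Sum>v\<le>n. (if v \<le> u then gb u else 0) * gb (s + t + v))
      = (\<Sum>u\<le>n. \<Sum>t\<le>n. \<Sum>v\<le>n. \<Sum>s\<le>n. (if v \<le> u then gb u else 0) * gb (s + t + v))"
      by (subst sum.swap, rule sum.cong[OF refl], subst sum.swap, rule sum.cong[OF refl], rule sum.swap)
    also have "\<dots> = (\<Sum>u\<le>n. \<Sum>t\<le>n. \<Sum>v\<le>n. (if v \<le> u then gb u else 0) * (\<Sum>s\<le>n. gb (s + t + v)))"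
      by (simp add: sum_distrib_left)
    also have "\<dots> \<le> (\<Sum>u\<le>n. \<Sum>t\<le>n. \<Sum>v\<le>n. (if v \<le> u then gb u else 0) * (4 * C0 / (real t + 1)))"
      by (intro sum_mono mult_left_mono in1) simp
    also have "\<dots> = (\<Sum>u\<le>n. \<Sum>v\<le>n. (if v \<le> u then gb u else 0) * ?h)"
    proof (rule sum.cong[OF refl])
      fix u
      have "(\<Sum>t\<le>n. \<Sum>v\<le>n. (if v \<le> u then gb u else 0) * (4 * C0 / (real t + 1)))
        = (\<Sum>v\<le>n. \<Sum>t\<le>n. (if v \<le> u then gb u else 0) * (4 * C0 / (real t + 1)))" by (rule sum.swap)
      then show "(\<Sum>t\<le>n. \<Sum>v\<le>n. (if v \<le> u then gb u else 0) * (4 * C0 / (real t + 1)))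
        = (\<Sum>v\<le>n. (if v \<le> u then gb u else 0) * ?h)"
        by (simp only: sum_distrib_left[symmetric] sum_gb_harm)
    qed
    also have "\<dots> = (\<Sum>v\<le>n. \<Sum>u\<le>n. (if v \<le> u then gb u else 0)) * ?h"
      by (subst sum.swap) (simp only: sum_distrib_right)
    also have "\<dots> \<le> ?h * ?h"
    proof (rule mult_right_mono[OF _ h0])
      have "(\<Sum>v\<le>n. \<Sum>u\<le>n. (if v \<le> u then gb u else 0)) \<le> (\<Sum>v\<le>n. 4 * C0 / (real v + 1))"
        by (intro sum_mono sum_gb_from_le)
      then show "(\<Sum>v\<le>n. \<Sum>u\<le>n. (if v \<le> u then gb u else 0)) \<le> ?h" by (simp add: sum_gb_harm)
    qed
    finally show ?thesis by (simp add: power2_eq_square)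
  qed
  \<comment> \<open>The mirror image of 2 with \<open>u\<close> and \<open>v\<close>
    exchanged.\<close>
  have 3: "(\<Sum>s\<le>n. \<Sum>u\<le>n. \<Sum>t\<le>n. \<Sum>v\<le>n. (if u \<le> v then gb v else 0) * gb (s + t + u)) \<le> ?h\<^sup>2"
  proof -
    have "(\<Sum>s\<le>n. \<Sum>u\<le>n. \<Sum>t\<le>n. \<Sum>v\<le>n. (if u \<le> v then gb v else 0) * gb (s + t + u))
      = (\<Sum>s\<le>n. \<Sum>v\<le>n. \<Sum>t\<le>n. \<Sum>u\<le>n. (if u \<le> v then gb v else 0) * gb (s + t + u))"
    proof (rule sum.cong[OF refl])
      fix s
      have "(\<Sum>u\<le>n. \<Sum>t\<le>n. \<Sum>v\<le>n. (if u \<le> v then gb v else 0) * gb (s + t + u))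
        = (\<Sum>t\<le>n. \<Sum>u\<le>n. \<Sum>v\<le>n. (if u \<le> v then gb v else 0) * gb (s + t + u))" by (rule sum.swap)
      also have "\<dots> = (\<Sum>t\<le>n. \<Sum>v\<le>n. \<Sum>u\<le>n. (if u \<le> v then gb v else 0) * gb (s + t + u))"
        by (rule sum.cong[OF refl], rule sum.swap)
      also have "\<dots> = (\<Sum>v\<le>n. \<Sum>t\<le>n. \<Sum>u\<le>n. (if u \<le> v then gb v else 0) * gb (s + t + u))" by (rule sum.swap)
      finally show "(\<Sum>u\<le>n. \<Sum>t\<le>n. \<Sum>v\<le>n. (if u \<le> v then gb v else 0) * gb (s + t + u))
        = (\<Sum>v\<le>n. \<Sum>t\<le>n. \<Sum>u\<le>n. (if u \<le> v then gb v else 0) * gb (s + t + u))" .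
    qed
    then show ?thesis using 2 by simp
  qed
  show ?thesis
    unfolding pair_bound_def sum.distrib using add_mono[OF 1 add_mono[OF 2 3]] by simp
qed

lemma range_interaction_nonneg: "0 \<le> range_interaction l l'" for l l' :: "(int ^ 'd) list"
  unfolding range_interaction_def by (intro sum_nonneg) simp

lemma range_interaction_second_moment:
  assumes "a \<le> n" "b \<le> n"
  shows "list_avg a (\<lambda>l :: (int ^ 'd) list. list_avg b (\<lambda>l'. (range_interaction l l')\<^sup>2)) \<le> 12 * (4 * C0 * harm0 n)\<^sup>2"
proof -
  let ?X = "\<lambda>s (l :: (int ^ 'd) list). sum_list (take s l)"
  have "list_avg a (\<lambda>l :: (int ^ 'd) list. list_avg b (\<lambda>l'. (range_interaction l l')\<^sup>2))
    \<le> list_avg a (\<lambda>l. list_avg b (\<lambda>l'. (\<Sum>s\<le>a. \<Sum>t\<le>b. green (?X s l + ?X t l'))\<^sup>2))"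
  proof (intro list_avg_mono power_mono range_interaction_nonneg)
    fix l l' :: "(int ^ 'd) list" assume l: "length l = a" "length l' = b"
    have "range_interaction l l' \<le> (\<Sum>x\<in>lrange l. \<Sum>t\<le>b. green (x + ?X t l'))"
      unfolding range_interaction_def using sum_lrange_le[of "\<lambda>y. green (x + y)" l' for x] l by (intro sum_mono) simp
    also have "\<dots> \<le> (\<Sum>s\<le>a. \<Sum>t\<le>b. green (?X s l + ?X t l'))"
      using sum_lrange_le[of "\<lambda>x. \<Sum>t\<le>b. green (x + ?X t l')" l] l by (simp add: sum_nonneg)
    finally show "range_interaction l l' \<le> (\<Sum>s\<le>a. \<Sum>t\<le>b. green (?X s l + ?X t l'))" .
  qed
  also have "\<dots> = (\<Sum>s\<le>a. \<Sum>s'\<le>a. \<Sum>t\<le>b. \<Sum>t'\<le>b. green_pair a b s s' t t')"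
    unfolding green_pair_def by (simp add: power2_eq_square sum_product list_avg_sum)
  \<comment> \<open>The factor 4 counts the orderings: two for the times in each of the two
    walks.\<close>
  also have "\<dots> \<le> (\<Sum>s\<le>n. \<Sum>u\<le>n. \<Sum>t\<le>n. \<Sum>v\<le>n. 4 * pair_bound s u t v)"
  proof (rule sum_square_split_le[OF _ _ assms(1)])
    fix s u assume su: "s + u \<le> a"
    have "(\<Sum>t\<le>b. \<Sum>t'\<le>b. green_pair a b s (s + u) t t' + green_pair a b (s + u) s t t')
      \<le> (\<Sum>t\<le>n. \<Sum>v\<le>n. 4 * pair_bound s u t v)"
    proof (rule sum_square_split_le[OF _ _ assms(2)])
      fix t v assume tv: "t + v \<le> b"
      show "green_pair a b s (s + u) t (t + v) + green_pair a b (s + u) s t (t + v) +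
        (green_pair a b s (s + u) (t + v) t + green_pair a b (s + u) s (t + v) t) \<le> 4 * pair_bound s u t v"
        using green_pair_le_pair_bound[OF su tv] green_pair_commute[of a b "s + u" s t "t + v"]
          green_pair_commute[of a b "s + u" s "t + v" t] by simp
    qed auto
    then show "(\<Sum>t\<le>b. \<Sum>t'\<le>b. green_pair a b s (s + u) t t') + (\<Sum>t\<le>b. \<Sum>t'\<le>b. green_pair a b (s + u) s t t')
      \<le> (\<Sum>t\<le>n. \<Sum>v\<le>n. 4 * pair_bound s u t v)"
      by (simp add: sum.distrib)
  qed (auto intro!: sum_nonneg)
  also have "\<dots> \<le> 12 * (4 * C0 * harm0 n)\<^sup>2"
    using sum_pair_bound_le[of n] by (simp add: sum_distrib_left[symmetric])
  finally show ?thesis .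
qed

lemma l2norm_cross_le:
  assumes "a \<le> n" "b \<le> n"
  shows "l2norm (a + b) (\<lambda>l :: (int ^ 'd) list. cross (take a l) (drop a l)) \<le> 128 * C0 * (real n + 1) powr (1 / 4)"
proof -
  have "list_avg (a + b) (\<lambda>l :: (int ^ 'd) list. (cross (take a l) (drop a l))\<^sup>2)
    = list_avg a (\<lambda>l :: (int ^ 'd) list. list_avg b (\<lambda>l'. (cross l l')\<^sup>2))"
    unfolding list_avg_append by (intro list_avg_cong) simp
  also have "\<dots> \<le> list_avg a (\<lambda>l :: (int ^ 'd) list. list_avg b (\<lambda>l'. (2 * range_interaction (rev l) l')\<^sup>2))"
    by (intro list_avg_mono power_mono cross_le cross_nonneg)
  also have "\<dots> = list_avg a (\<lambda>l :: (int ^ 'd) list. list_avg b (\<lambda>l'. (2 * range_interaction l l')\<^sup>2))"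
    by (rule list_avg_rev[of a "\<lambda>l. list_avg b (\<lambda>l'. (2 * range_interaction l l')\<^sup>2)"])
  also have "\<dots> = 4 * list_avg a (\<lambda>l :: (int ^ 'd) list. list_avg b (\<lambda>l'. (range_interaction l l')\<^sup>2))"
    by (simp add: power_mult_distrib list_avg_cmult)
  also have "\<dots> \<le> 4 * (12 * (4 * C0 * harm0 n)\<^sup>2)"
    using range_interaction_second_moment[OF assms] by simp
  \<comment> \<open>The constant 48 is rounded up to the square 64; the 128 of the statement is 8 *
    4 * 4.\<close>
  also have "\<dots> \<le> (8 * (4 * C0 * harm0 n))\<^sup>2"
    by (simp add: power_mult_distrib)
  finally have "l2norm (a + b) (\<lambda>l :: (int ^ 'd) list. cross (take a l) (drop a l)) \<le> 8 * (4 * C0 * harm0 n)"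
    unfolding l2norm_def using C0_ge_1 by (intro real_le_lsqrt) auto
  also have "\<dots> \<le> 8 * (4 * C0 * (4 * (real n + 1) powr (1 / 4)))"
    using C0_ge_1 harm0_le[of n] by (intro mult_left_mono) auto
  finally show ?thesis by simp
qed

end

subsection \<open>Comparison with independent blocks\<close>

primrec block_sum :: "nat \<Rightarrow> ((int ^ 'd::finite) list \<Rightarrow> real) \<Rightarrow> nat \<Rightarrow> (int ^ 'd) list \<Rightarrow> real" where
  "block_sum L F 0 l = 0"
| "block_sum L F (Suc k) l = F (take L l) + block_sum L F k (drop L l)"

lemma block_sum_append:
  "length l = a * L \<Longrightarrow> block_sum L F (a + b) (l @ l') = block_sum L F a l + block_sum L F b l'"
proof (induction a arbitrary: l)
  case (Suc a)
  then have "length (drop L l) = a * L" by simp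
  from Suc.IH[OF this] show ?case using Suc.prems by simp
qed simp

lemma block_sum_take: "block_sum L F k (take (k * L) l) = block_sum L F k l"
  by (induction k arbitrary: l) (auto simp: drop_take min_absorb1)

lemma block_sum_diff_const: "block_sum L (\<lambda>l. F l - c) k l = block_sum L F k l - real k * c"
  by (induction k arbitrary: l) (auto simp: algebra_simps)

lemma list_avg_take:
  fixes f :: "(int ^ 'd::finite) list \<Rightarrow> 'b::real_normed_field"
  shows "list_avg (a + b) (\<lambda>l. f (take a l)) = list_avg a f"
proof -
  have "list_avg (a + b) (\<lambda>l. f (take a l)) = list_avg a (\<lambda>l. list_avg b (\<lambda>l' :: (int ^ 'd) list. f l))"
    unfolding list_avg_append by (intro list_avg_cong) simp
  then show ?thesis by simp
qed

lemma list_avg_drop: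
  fixes f :: "(int ^ 'd::finite) list \<Rightarrow> 'b::real_normed_field"
  shows "list_avg (a + b) (\<lambda>l. f (drop a l)) = list_avg b f"
proof -
  have "list_avg (a + b) (\<lambda>l. f (drop a l)) = list_avg a (\<lambda>l :: (int ^ 'd) list. list_avg b f)"
    unfolding list_avg_append by (intro list_avg_cong) simp
  then show ?thesis by simp
qed

lemma l2norm_take: "l2norm (a + b) (\<lambda>l. f (take a l)) = l2norm a f"
  unfolding l2norm_def using list_avg_take[of a b "\<lambda>l. (f l)\<^sup>2"] by simp

lemma block_sum_Suc: "block_sum L F (Suc k) = (\<lambda>l. F (take L l) + block_sum L F k (drop L l))"
  by (rule ext) simp

lemma list_avg_block_sum: "list_avg (k * L) (block_sum L F k) = real k * list_avg L F"
proof (induction k)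
  case (Suc k)
  have "list_avg (Suc k * L) (block_sum L F (Suc k)) = list_avg L F + list_avg (k * L) (block_sum L F k)"
    unfolding block_sum_Suc by (simp add: list_avg_add list_avg_take list_avg_drop del: block_sum.simps)
  then show ?case using Suc by (simp add: algebra_simps del: block_sum.simps)
qed simp

lemma l2norm_block_sum:
  assumes "list_avg L F = 0"
  shows "l2norm (k * L) (block_sum L F k) = sqrt (real k) * l2norm L F"
proof -
  have "(l2norm (k * L) (block_sum L F k))\<^sup>2 = real k * (l2norm L F)\<^sup>2"
  proof (induction k)
    case (Suc k)
    have "(l2norm (Suc k * L) (block_sum L F (Suc k)))\<^sup>2 = (l2norm L F)\<^sup>2 + (l2norm (k * L) (block_sum L F k))\<^sup>2"
      using l2norm_append_indep[OF assms, of "k * L" "block_sum L F k"] unfolding block_sum_Suc by simp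
    then show ?case using Suc by (simp add: algebra_simps del: block_sum.simps)
  qed (simp add: l2norm_def)
  also have "\<dots> = (sqrt (real k) * l2norm L F)\<^sup>2" by (simp add: power_mult_distrib)
  finally show ?thesis by (simp add: power2_eq_iff_nonneg)
qed

lemma list_avg_iexp_block_sum:
  "list_avg (k * L) (\<lambda>l. iexp (t * block_sum L F k l)) = (list_avg L (\<lambda>l. iexp (t * F l))) ^ k"
proof (induction k)
  case (Suc k)
  have "list_avg (Suc k * L) (\<lambda>l. iexp (t * block_sum L F (Suc k) l))
    = list_avg (L + k * L) (\<lambda>l. iexp (t * F (take L l)) * iexp (t * block_sum L F k (drop L l)))"
    by (simp add: exp_add[symmetric] algebra_simps)
  also have "\<dots> = list_avg L (\<lambda>l. list_avg (k * L) (\<lambda>l'. iexp (t * F l) * iexp (t * block_sum L F k l')))"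
    unfolding list_avg_append by (intro list_avg_cong) simp
  also have "\<dots> = list_avg L (\<lambda>l. iexp (t * F l)) * list_avg (k * L) (\<lambda>l. iexp (t * block_sum L F k l))"
    by (simp only: list_avg_cmult list_avg_multc)
  finally show ?case using Suc by simp
qed simp

section \<open>The capacity of a range and its deviation from a sum over blocks\<close>

definition capr :: "(int ^ 'd::finite) list \<Rightarrow> real" where
  "capr l = Cap (lrange l)"

lemma capr_nonneg [simp]: "0 \<le> capr l"
  by (simp add: capr_def)

lemma capr_le: "capr l \<le> real (length l) + 1"
  unfolding capr_def using order_trans[OF Cap_le_card, of "lrange l" "real (length l + 1)"] card_lrange_le[of l]
  by simp

lemma capr_append: "capr (l @ l') = capr l + capr l' - cross l l'"
  by (simp add: capr_def cross_def)

lemma capr_append_ge: "capr l \<le> capr (l @ l')"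
  unfolding capr_def by (rule Cap_mono) (auto simp: lrange_append)

lemma abs_centred_capr_le:
  fixes l :: "(int ^ 'd::finite) list"
  assumes "length l = n"
  shows "\<bar>centred n capr l\<bar> \<le> real n + 1"
proof -
  have "list_avg n (capr :: (int ^ 'd) list \<Rightarrow> real) \<le> real n + 1" by (rule list_avg_le_const) (use capr_le in force)
  moreover have "0 \<le> list_avg n (capr :: (int ^ 'd) list \<Rightarrow> real)" by (rule list_avg_nonneg) simp
  ultimately show ?thesis using capr_le[of l] capr_nonneg[of l] assms unfolding centred_def by linarith
qed

definition block_error :: "nat \<Rightarrow> nat \<Rightarrow> (int ^ 'd::finite) list \<Rightarrow> real" where
  "block_error L k l = capr l - block_sum L capr k l"

lemma block_error_append:
  assumes "length l = a * L"
  shows "block_error L (a + b) (l @ l') = block_error L a l + block_error L b l' - cross l l'"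
  by (simp add: block_error_def capr_append block_sum_append[OF assms])

context heat_bound begin

definition block_std :: "nat \<Rightarrow> nat \<Rightarrow> real" where
  "block_std L k = l2norm (k * L) (centred (k * L) (block_error L k :: (int ^ 'd) list \<Rightarrow> real))"

text \<open>The errors of the two parts are independent and combine by Pythagoras; only the junction
  term depends on both and is added by the triangle inequality.\<close>

lemma block_std_add:
  "block_std L (a + b) \<le> sqrt ((block_std L a)\<^sup>2 + (block_std L b)\<^sup>2) + 128 * C0 * (real ((a + b) * L) + 1) powr (1 / 4)"
proof -
  let ?n = "a * L + b * L"
  let ?D = "\<lambda>k. block_error L k :: (int ^ 'd) list \<Rightarrow> real"
  let ?cr = "\<lambda>l :: (int ^ 'd) list. cross (take (a * L) l) (drop (a * L) l)"
  have eq: "?D (a + b) l = ?D a (take (a * L) l) + ?D b (drop (a * L) l) - ?cr l" if "length l = ?n" for l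
    using block_error_append[of "take (a * L) l" a L b "drop (a * L) l"] that by simp
  have "list_avg ?n (?D (a + b)) = list_avg ?n (\<lambda>l. ?D a (take (a * L) l) + ?D b (drop (a * L) l) - ?cr l)"
    by (intro list_avg_cong eq) simp
  then have m: "list_avg ?n (?D (a + b)) = list_avg (a * L) (?D a) + list_avg (b * L) (?D b) - list_avg ?n ?cr"
    by (simp add: list_avg_add list_avg_diff list_avg_take list_avg_drop)
  have "block_std L (a + b) = l2norm ?n (centred ?n (?D (a + b)))"
    by (simp add: block_std_def add_mult_distrib)
  also have "\<dots> = l2norm ?n (\<lambda>l. (centred (a * L) (?D a) (take (a * L) l) + centred (b * L) (?D b) (drop (a * L) l))
      + - centred ?n ?cr l)"
    by (rule l2norm_cong) (simp add: centred_def m eq)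
  also have "\<dots> \<le> l2norm ?n (\<lambda>l. centred (a * L) (?D a) (take (a * L) l) + centred (b * L) (?D b) (drop (a * L) l))
      + l2norm ?n (\<lambda>l. - centred ?n ?cr l)"
    by (rule l2norm_triangle)
  also have "l2norm ?n (\<lambda>l. centred (a * L) (?D a) (take (a * L) l) + centred (b * L) (?D b) (drop (a * L) l))
      = sqrt ((block_std L a)\<^sup>2 + (block_std L b)\<^sup>2)"
    unfolding block_std_def by (subst l2norm_append_indep[symmetric]) simp_all
  also have "l2norm ?n (\<lambda>l. - centred ?n ?cr l) \<le> l2norm ?n ?cr"
    unfolding l2norm_uminus by (rule l2norm_centred_le)
  also have "\<dots> \<le> 128 * C0 * (real ?n + 1) powr (1 / 4)"
    by (rule l2norm_cross_le) auto
  finally show ?thesis by (simp add: add_mult_distrib)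
qed

lemma block_std_nonneg [simp]: "0 \<le> block_std L k"
  by (simp add: block_std_def)

text \<open>2560 is 10 * 2 * 128: the factor 128 belongs to a junction, 2 is the fourth root of 16
  lost in \<open>block_std_le\<close>, and 10 makes the junction error one tenth of the correction
  term.\<close>

definition BC :: real where
  "BC = 2560 * C0"

lemma BC_pos: "BC > 0"
  using C0_ge_1 by (simp add: BC_def)

text \<open>The correction term \<open>k powr (1 / 4)\<close> is what makes the halving induction close: it
  is multiplied by more than \<open>11 / 10\<close> in each step, which absorbs the new error.\<close>

lemma block_std_le:
  assumes "L \<ge> 1" "k \<ge> 1"
  shows "block_std L k \<le> BC * real L powr (1 / 4) * (sqrt (real k) - real k powr (1 / 4))"
  using assms(2)
proof (induction k rule: less_induct)
  case (less k)
  let ?r = "\<lambda>k. real k powr (1 / 4)"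
  have r4: "?r k ^ 4 = real k" and r2: "(?r k)\<^sup>2 = sqrt (real k)" if "k \<ge> 1" for k
    using that by (simp_all add: powr_power powr_half_sqrt)
  define B where "B = BC * ?r L"
  have B0: "B \<ge> 0" using BC_pos by (simp add: B_def)
  show ?case
  proof (cases "k = 1")
    \<comment> \<open>At \<open>k = 1\<close> the right-hand side is 0, and a single block has no
      error.\<close>
    case True
    have "l2norm L (centred L (block_error L 1 :: (int ^ 'd) list \<Rightarrow> real)) \<le> l2norm L (block_error L 1 :: (int ^ 'd) list \<Rightarrow> real)"
      by (rule l2norm_centred_le)
    also have "\<dots> \<le> 0" by (rule l2norm_le_bound) (simp_all add: block_error_def)
    finally show ?thesis using True by (simp add: block_std_def)
  next
    case False
    define a where "a = k div 2"
    define b where "b = k - a"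
    define y where "y = ?r k"
    \<comment> \<open>One factor serves both parts, so that Pythagoras recombines the square roots
      of \<open>a\<close> and \<open>b\<close> into that of \<open>k\<close>. It is chosen so that
      \<open>y ^ 2 * \<theta>\<close> is \<open>y ^ 2 - (11 / 10) * y\<close>.\<close>
    define \<theta> where "\<theta> = 1 - (11 / 10) / y"
    have ab: "a \<ge> 1" "b \<ge> 1" "a < k" "b < k" "3 * a \<le> 2 * k" "3 * b \<le> 2 * k" "a + b = k"
      using False less.prems unfolding a_def b_def by linarith+
    have y: "y \<ge> 1" "y ^ 4 = real k" "y\<^sup>2 = sqrt (real k)"
      using less.prems r4[of k] r2[of k] by (auto simp: y_def ge_one_powr_ge_zero)
    have part: "block_std L c \<le> B * sqrt (real c) * \<theta> \<and> 0 \<le> \<theta>" if c: "c \<ge> 1" "c < k" "3 * c \<le> 2 * k" for c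
    proof -
      define x where "x = ?r c"
      have x: "x \<ge> 1" "x ^ 4 = real c" "x\<^sup>2 = sqrt (real c)"
        using c r4[of c] r2[of c] by (auto simp: x_def ge_one_powr_ge_zero)
      \<comment> \<open>Here \<open>(11 / 10) ^ 4 = 1.4641\<close> is below 3/2, while neither part
        exceeds two thirds of \<open>k\<close> (attained at \<open>k = 3\<close>).\<close>
      have "((11 / 10) * x) ^ 4 \<le> y ^ 4"
        unfolding power_mult_distrib x y using c by (simp add: power4_eq_xxxx)
      then have xy: "(11 / 10) * x \<le> y" using x y by (subst (asm) power_mono_iff) auto
      then have "(11 / 10) * x * x \<le> y * x" using x by (intro mult_right_mono) auto
      then have "(11 / 10) * x * x / y \<le> x" using y by (subst pos_divide_le_eq) (auto simp: mult.commute)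
      then have le: "x\<^sup>2 - x \<le> x\<^sup>2 * \<theta>" by (simp add: \<theta>_def power2_eq_square algebra_simps)
      have "block_std L c \<le> B * (x\<^sup>2 - x)"
        using less.IH[OF c(2,1)] x by (simp add: B_def x_def)
      also have "\<dots> \<le> B * (x\<^sup>2 * \<theta>)" by (intro mult_left_mono le B0)
      finally have "block_std L c \<le> B * sqrt (real c) * \<theta>" by (simp add: x mult.assoc)
      moreover have "0 \<le> \<theta>"
      proof -
        have "11 / 10 * 1 \<le> 11 / 10 * x" using x by simp
        then have "11 / 10 \<le> y" using xy by linarith
        then show ?thesis using y by (simp add: \<theta>_def)
      qed
      ultimately show ?thesis by blast
    qed
    have "(block_std L a)\<^sup>2 + (block_std L b)\<^sup>2 \<le> (B * sqrt (real a) * \<theta>)\<^sup>2 + (B * sqrt (real b) * \<theta>)\<^sup>2"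
      using part[of a] part[of b] ab by (intro add_mono power_mono) auto
    also have "\<dots> = (B * sqrt (real k) * \<theta>)\<^sup>2"
      by (simp add: power_mult_distrib ab(7)[symmetric]) (simp add: algebra_simps)
    finally have s: "sqrt ((block_std L a)\<^sup>2 + (block_std L b)\<^sup>2) \<le> B * sqrt (real k) * \<theta>"
      using part[of a] ab B0 by (intro real_le_lsqrt) auto
    have "(real (k * L) + 1) powr (1 / 4) \<le> (16 * (real k * real L)) powr (1 / 4)"
    proof (rule powr_mono2)
      have "1 \<le> real k * real L" using mult_mono[of 1 "real k" 1 "real L"] assms(1) less.prems by simp
      then show "real (k * L) + 1 \<le> 16 * (real k * real L)" unfolding of_nat_mult by linarith
    qed auto
    also have "\<dots> = 2 * (y * ?r L)"
    proof -
      have "(16 :: real) powr (1 / 4) = (2 powr 4) powr (1 / 4)" by simp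
      also have "\<dots> = 2" by (subst powr_powr) simp
      finally show ?thesis by (simp add: powr_mult y_def)
    qed
    finally have p: "(real (k * L) + 1) powr (1 / 4) \<le> 2 * (y * ?r L)" .
    have "block_std L k \<le> B * sqrt (real k) * \<theta> + 128 * C0 * (2 * (y * ?r L))"
    proof -
      have "128 * C0 * (real (k * L) + 1) powr (1 / 4) \<le> 128 * C0 * (2 * (y * ?r L))"
        using C0_ge_1 by (intro mult_left_mono p) simp
      then show ?thesis using block_std_add[of L a b] s unfolding ab(7) by linarith
    qed
    also have "B * sqrt (real k) * \<theta> = B * (y\<^sup>2 - (11 / 10) * y)"
      using y(1) unfolding \<theta>_def y(3)[symmetric] by (simp add: power2_eq_square field_simps)
    also have "B * (y\<^sup>2 - (11 / 10) * y) + 128 * C0 * (2 * (y * ?r L)) = B * (y\<^sup>2 - y)"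
      by (simp add: B_def BC_def algebra_simps)
    finally show ?thesis unfolding y(3) B_def by (simp only: y_def)
  qed
qed

text \<open>Besides the error of the complete blocks there is a remainder of fewer than
  \<open>L\<close> steps. By monotonicity and subadditivity it changes the capacity by an amount
  between 0 and \<open>L\<close>, whatever \<open>n\<close> is.\<close>

lemma centred_capr_approx:
  assumes "L \<ge> 1" "n \<ge> L"
  defines "k \<equiv> n div L"
  shows "l2norm n (\<lambda>l :: (int ^ 'd) list. centred n capr l - block_sum L (centred L capr) k l)
    \<le> BC * real L powr (1 / 4) * sqrt (real k) + real L"
proof -
  define r where "r = n mod L"
  have n: "n = k * L + r" "r < L" using assms by (simp_all add: k_def r_def)
  have k1: "k \<ge> 1" using assms by (simp add: k_def Suc_le_eq div_greater_zero_iff)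
  let ?c = "capr :: (int ^ 'd) list \<Rightarrow> real" and ?D = "block_error L k :: (int ^ 'd) list \<Rightarrow> real"
  define \<delta> where "\<delta> l = ?c l - ?c (take (k * L) l)" for l
  have \<delta>: "0 \<le> \<delta> l" "\<delta> l \<le> real L" if "length l = n" for l
  proof -
    show "0 \<le> \<delta> l" unfolding \<delta>_def using capr_append_ge[of "take (k * L) l" "drop (k * L) l"] by simp
    have "\<delta> l \<le> ?c (drop (k * L) l)"
      unfolding \<delta>_def using capr_append[of "take (k * L) l" "drop (k * L) l"]
        cross_nonneg[of "take (k * L) l" "drop (k * L) l"] by simp
    also have "\<dots> \<le> real r + 1" using capr_le[of "drop (k * L) l"] that n by simp
    also have "\<dots> \<le> real L" using n(2) by simp
    finally show "\<delta> l \<le> real L" .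
  qed
  have m\<delta>: "list_avg n \<delta> = list_avg n ?c - list_avg (k * L) ?c"
  proof -
    have "list_avg n (\<lambda>l. ?c (take (k * L) l)) = list_avg (k * L) ?c"
      unfolding n(1) by (rule list_avg_take)
    then show ?thesis by (simp add: \<delta>_def[abs_def] list_avg_diff)
  qed
  have mD: "list_avg (k * L) ?D = list_avg (k * L) ?c - real k * list_avg L ?c"
    using list_avg_diff[of "k * L" ?c "block_sum L ?c k"] by (simp add: block_error_def[abs_def] list_avg_block_sum)
  have eq: "centred n ?c l - block_sum L (centred L ?c) k l
     = centred (k * L) ?D (take (k * L) l) + centred n \<delta> l" if "length l = n" for l
    unfolding centred_def[abs_def] block_sum_diff_const m\<delta> mD block_error_def block_sum_take by (simp add: \<delta>_def)
  have "l2norm n (\<lambda>l. centred n ?c l - block_sum L (centred L ?c) k l)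
    = l2norm n (\<lambda>l. centred (k * L) ?D (take (k * L) l) + centred n \<delta> l)"
    by (intro l2norm_cong eq)
  also have "\<dots> \<le> l2norm n (\<lambda>l. centred (k * L) ?D (take (k * L) l)) + l2norm n (centred n \<delta>)"
    by (rule l2norm_triangle)
  also have "l2norm n (\<lambda>l. centred (k * L) ?D (take (k * L) l)) = block_std L k"
    unfolding n(1) l2norm_take block_std_def ..
  also have "block_std L k \<le> BC * real L powr (1 / 4) * (sqrt (real k) - real k powr (1 / 4))"
    by (rule block_std_le[OF assms(1) k1])
  also have "\<dots> \<le> BC * real L powr (1 / 4) * sqrt (real k)"
    using BC_pos by (intro mult_left_mono) auto
  also have "l2norm n (centred n \<delta>) \<le> l2norm n \<delta>" by (rule l2norm_centred_le)
  also have "\<dots> \<le> real L" using \<delta> by (intro l2norm_le_bound) auto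
  finally show ?thesis by simp
qed

definition cap_std :: "nat \<Rightarrow> real" where
  "cap_std n = l2norm n (centred n (capr :: (int ^ 'd) list \<Rightarrow> real))"

lemma cap_std_nonneg [simp]: "0 \<le> cap_std n"
  by (simp add: cap_std_def)

lemma approx_scaled:
  assumes "L \<ge> 1" "n \<ge> L"
  shows "(BC * real L powr (1 / 4) * sqrt (real (n div L)) + real L) / sqrt (real n)
    \<le> BC / real L powr (1 / 4) + real L / sqrt (real n)"
proof -
  have n0: "real n > 0" using assms by simp
  have "real (n div L) \<le> real n / real L" by (rule of_nat_div_le_of_nat)
  then have "sqrt (real (n div L)) \<le> sqrt (real n) / sqrt (real L)"
    by (simp flip: real_sqrt_divide)
  then have "BC * real L powr (1 / 4) * sqrt (real (n div L)) \<le> BC * real L powr (1 / 4) * (sqrt (real n) / sqrt (real L))"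
    using BC_pos by (intro mult_left_mono) auto
  then have "BC * real L powr (1 / 4) * sqrt (real (n div L)) / sqrt (real n) \<le> BC * real L powr (1 / 4) * (sqrt (real n) / sqrt (real L)) / sqrt (real n)"
    by (rule divide_right_mono) simp
  also have "\<dots> = BC * (real L powr (1 / 4) / sqrt (real L))" using n0 by simp
  also have "real L powr (1 / 4) / sqrt (real L) = 1 / real L powr (1 / 4)"
  proof -
    have "sqrt (real L) = real L powr (1 / 4) * real L powr (1 / 4)"
      unfolding powr_add[symmetric] using assms by (simp add: powr_half_sqrt)
    then show ?thesis using assms by simp
  qed
  finally show ?thesis by (simp add: add_divide_distrib)
qed

lemma cap_std_approx:
  assumes "L \<ge> 1" "n \<ge> L"
  shows "\<bar>cap_std n - sqrt (real (n div L)) * cap_std L\<bar> \<le> BC * real L powr (1 / 4) * sqrt (real (n div L)) + real L"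
proof -
  let ?c = "capr :: (int ^ 'd) list \<Rightarrow> real"
  define k r where "k = n div L" and "r = n mod L"
  have n: "n = k * L + r" by (simp add: k_def r_def)
  have "l2norm (k * L + r) (block_sum L (centred L ?c) k)
      = l2norm (k * L + r) (\<lambda>l. block_sum L (centred L ?c) k (take (k * L) l))"
    unfolding block_sum_take ..
  also have "\<dots> = sqrt (real k) * cap_std L"
    unfolding l2norm_take cap_std_def by (rule l2norm_block_sum) simp
  finally have e: "l2norm n (block_sum L (centred L ?c) k) = sqrt (real k) * cap_std L"
    by (simp only: n[symmetric])
  show ?thesis
    using order_trans[OF l2norm_diff_triangle centred_capr_approx[OF assms]] unfolding k_def[symmetric] e
    by (simp add: cap_std_def)
qed

end

subsection \<open>Characteristic functions\<close>

lemma cmod_iexp_diff_le: "cmod (iexp a - iexp b) \<le> \<bar>a - b\<bar>"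
proof -
  have "iexp a - iexp b = iexp b * (iexp (a - b) - 1)"
    by (simp add: algebra_simps exp_add[symmetric])
  then have "cmod (iexp a - iexp b) = cmod (iexp (a - b) - 1)" by (simp add: norm_mult)
  also have "\<dots> \<le> \<bar>a - b\<bar>" using iexp_approx1[of "a - b" 0] by simp
  finally show ?thesis .
qed

text \<open>Second-order Taylor expansion, with the third-order remainder controlled by the uniform
  bound \<open>M\<close>.\<close>

lemma list_avg_iexp_approx:
  fixes F :: "(int ^ 'd::finite) list \<Rightarrow> real"
  assumes M: "\<And>l. length l = L \<Longrightarrow> \<bar>F l\<bar> \<le> M" and mean: "list_avg L F = 0"
  shows "cmod (list_avg L (\<lambda>l. iexp (u * F l)) - of_real (1 - u\<^sup>2 * (l2norm L F)\<^sup>2 / 2)) \<le> \<bar>u\<bar> ^ 3 * M ^ 3 / 6"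
proof -
  let ?P = "\<lambda>l. (1 + \<i> * of_real u * of_real (F l)) - of_real (u\<^sup>2 / 2) * of_real ((F l)\<^sup>2) :: complex"
  have P: "(\<Sum>k\<le>2. (\<i> * of_real (u * F l)) ^ k / fact k) = ?P l" for l
    by (simp add: numeral_2_eq_2) (simp add: power2_eq_square algebra_simps)
  have "list_avg L ?P = of_real (1 - u\<^sup>2 * (l2norm L F)\<^sup>2 / 2)"
    by (simp only: list_avg_diff list_avg_add list_avg_cmult list_avg_const list_avg_of_real mean l2norm_power2) simp
  then have "cmod (list_avg L (\<lambda>l. iexp (u * F l)) - of_real (1 - u\<^sup>2 * (l2norm L F)\<^sup>2 / 2))
    = cmod (list_avg L (\<lambda>l. iexp (u * F l) - ?P l))"
    by (simp only: list_avg_diff)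
  also have "\<dots> \<le> list_avg L (\<lambda>l. cmod (iexp (u * F l) - ?P l))" by (rule norm_list_avg_le)
  also have "\<dots> \<le> \<bar>u\<bar> ^ 3 * M ^ 3 / 6"
  proof (rule list_avg_le_const)
    fix l :: "(int ^ 'd) list" assume l: "length l = L"
    have "cmod (iexp (u * F l) - ?P l) \<le> \<bar>u * F l\<bar> ^ Suc 2 / fact (Suc 2)"
      using iexp_approx1[of "u * F l" 2] unfolding P .
    also have "\<dots> = \<bar>u\<bar> ^ 3 * \<bar>F l\<bar> ^ 3 / 6"
    proof -
      have "Suc 2 = 3" "fact 3 = (6 :: real)" by (simp_all add: fact_numeral)
      then show ?thesis unfolding abs_mult power_mult_distrib by (simp only:)
    qed
    also have "\<dots> \<le> \<bar>u\<bar> ^ 3 * M ^ 3 / 6"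
      by (intro divide_right_mono mult_left_mono power_mono M l) auto
    finally show "cmod (iexp (u * F l) - ?P l) \<le> \<bar>u\<bar> ^ 3 * M ^ 3 / 6" .
  qed
  finally show ?thesis .
qed

lemma div_ratio_tendsto:
  assumes "L \<ge> 1"
  shows "(\<lambda>n. real (n div L) / real n) \<longlonglongrightarrow> 1 / real L"
proof (rule real_tendsto_sandwich[where f = "\<lambda>n. 1 / real L - 1 / real n" and h = "\<lambda>n. 1 / real L"])
  show "\<forall>\<^sub>F n in sequentially. 1 / real L - 1 / real n \<le> real (n div L) / real n"
    using eventually_gt_at_top[of 0]
  proof eventually_elim
    case (elim n)
    have "real n / real L \<le> real (n div L) + 1"
    proof -
      have "n \<le> (n div L + 1) * L" using dividend_less_div_times[of L n] assms by simp
      then have "real n \<le> (real (n div L) + 1) * real L"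
        by (metis of_nat_1 of_nat_add of_nat_le_iff of_nat_mult)
      then show ?thesis using assms by (simp add: pos_divide_le_eq)
    qed
    then have "(real n / real L) / real n \<le> (real (n div L) + 1) / real n" by (rule divide_right_mono) simp
    then show ?case using elim by (simp add: add_divide_distrib)
  qed
  show "\<forall>\<^sub>F n in sequentially. real (n div L) / real n \<le> 1 / real L"
    using eventually_gt_at_top[of 0]
  proof eventually_elim
    case (elim n)
    then have "real (n div L) / real n \<le> (real n / real L) / real n"
      by (intro divide_right_mono of_nat_div_le_of_nat) simp
    then show ?case using elim by simp
  qed
  show "(\<lambda>n. 1 / real L - 1 / real n) \<longlonglongrightarrow> 1 / real L"
    using tendsto_diff[OF tendsto_const lim_1_over_n] by simp
qed simp

text \<open>The exponent is only about n / L, so the power is written as the n-th power raised to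
  \<open>(n div L) / n\<close>; this is legitimate once \<open>n\<close> exceeds \<open>c\<close>
  and the base is positive.\<close>

lemma power_div_tendsto_exp:
  assumes "L \<ge> 1" "0 \<le> c"
  shows "(\<lambda>n. (1 - c / real n) ^ (n div L)) \<longlonglongrightarrow> exp (- c / real L)"
proof -
  have "(\<lambda>n. (1 + (- c) / real n) ^ n) \<longlonglongrightarrow> exp (- c)" by (rule tendsto_exp_limit_sequentially)
  then have "(\<lambda>n. ((1 - c / real n) ^ n) powr (real (n div L) / real n)) \<longlonglongrightarrow> exp (- c) powr (1 / real L)"
    by (intro tendsto_powr div_ratio_tendsto assms(1)) simp_all
  also have "exp (- c) powr (1 / real L) = exp (- c / real L)" by (simp add: powr_def)
  finally show ?thesis
  proof (rule Lim_transform_eventually)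
    show "\<forall>\<^sub>F n in sequentially. ((1 - c / real n) ^ n) powr (real (n div L) / real n) = (1 - c / real n) ^ (n div L)"
      using eventually_gt_at_top[of "nat \<lceil>c\<rceil>"]
    proof eventually_elim
      case (elim n)
      then have "real n > c" using assms by linarith
      then have n: "n > 0" "1 - c / real n > 0" using assms(2) by auto
      have "((1 - c / real n) ^ n) powr (real (n div L) / real n) = (1 - c / real n) powr (real n * (real (n div L) / real n))"
        using n by (simp add: powr_realpow[symmetric] powr_powr)
      then show ?case using n by (simp add: powr_realpow)
    qed
  qed
qed

text \<open>The central limit theorem for independent bounded blocks, scaled by the total length.
  Powers of two numbers of modulus at most 1 differ by at most the exponent times their distance; at
  most \<open>n\<close> times a distance of order n^(-3/2) vanishes.\<close>

lemma list_avg_iexp_power_tendsto: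
  fixes F :: "(int ^ 'd::finite) list \<Rightarrow> real"
  assumes M: "\<And>l. length l = L \<Longrightarrow> \<bar>F l\<bar> \<le> M" and mean: "list_avg L F = 0" and L: "L \<ge> 1"
  shows "(\<lambda>n. (list_avg L (\<lambda>l. iexp (t / sqrt (real n) * F l))) ^ (n div L))
    \<longlonglongrightarrow> of_real (exp (- (t\<^sup>2 * (l2norm L F)\<^sup>2 / 2) / real L))"
proof -
  define c where "c = t\<^sup>2 * (l2norm L F)\<^sup>2 / 2"
  define \<phi> where "\<phi> n = list_avg L (\<lambda>l. iexp (t / sqrt (real n) * F l))" for n
  define w where "w n = complex_of_real (1 - c / real n)" for n
  have c0: "c \<ge> 0" by (simp add: c_def)
  have M0: "M \<ge> 0" using M[of "replicate L 0"] by simp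
  have "(\<lambda>n. complex_of_real ((1 - c / real n) ^ (n div L))) \<longlonglongrightarrow> complex_of_real (exp (- c / real L))"
    by (intro tendsto_of_real power_div_tendsto_exp L c0)
  then have 1: "(\<lambda>n. w n ^ (n div L)) \<longlonglongrightarrow> complex_of_real (exp (- c / real L))"
    unfolding w_def by (simp only: of_real_power)
  have "(\<lambda>n. \<phi> n ^ (n div L) - w n ^ (n div L)) \<longlonglongrightarrow> 0"
  proof (rule Lim_null_comparison)
    show "(\<lambda>n. (\<bar>t\<bar> ^ 3 * M ^ 3 / 6) * (1 / sqrt (real n))) \<longlonglongrightarrow> 0"
      by (intro tendsto_mult_right_zero tendsto_divide_0[OF tendsto_const] filterlim_at_top_imp_at_infinity
        filterlim_compose[OF sqrt_at_top filterlim_real_sequentially])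
    show "\<forall>\<^sub>F n in sequentially. norm (\<phi> n ^ (n div L) - w n ^ (n div L)) \<le> (\<bar>t\<bar> ^ 3 * M ^ 3 / 6) * (1 / sqrt (real n))"
      using eventually_gt_at_top[of "nat \<lceil>c\<rceil>"]
    proof eventually_elim
      case (elim n)
      then have "real n > c" using c0 by linarith
      then have n: "n > 0" "1 - c / real n > 0" using c0 by auto
      have \<phi>1: "norm (\<phi> n) \<le> 1"
        unfolding \<phi>_def by (rule order_trans[OF norm_list_avg_le]) simp
      have w1: "norm (w n) \<le> 1" unfolding w_def norm_of_real using n c0 by simp
      have "(t / sqrt (real n))\<^sup>2 * (l2norm L F)\<^sup>2 / 2 = c / real n"
        by (simp add: c_def power_divide)
      then have "norm (\<phi> n - w n) \<le> \<bar>t / sqrt (real n)\<bar> ^ 3 * M ^ 3 / 6"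
        using list_avg_iexp_approx[OF M mean, of "t / sqrt (real n)"] unfolding \<phi>_def w_def by simp
      also have "\<dots> = (\<bar>t\<bar> ^ 3 * M ^ 3 / 6) / (real n * sqrt (real n))"
        by (simp add: power_divide power3_eq_cube abs_divide)
      finally have d: "norm (\<phi> n - w n) \<le> (\<bar>t\<bar> ^ 3 * M ^ 3 / 6) / (real n * sqrt (real n))" .
      have "norm (\<phi> n ^ (n div L) - w n ^ (n div L)) \<le> real (n div L) * norm (\<phi> n - w n)"
        by (rule norm_power_diff[OF \<phi>1 w1])
      also have "\<dots> \<le> real n * ((\<bar>t\<bar> ^ 3 * M ^ 3 / 6) / (real n * sqrt (real n)))"
        by (rule mult_mono[OF _ d]) auto
      also have "\<dots> = (\<bar>t\<bar> ^ 3 * M ^ 3 / 6) * (1 / sqrt (real n))" using n by simp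
      finally show ?case .
    qed
  qed
  then have "(\<lambda>n. (\<phi> n ^ (n div L) - w n ^ (n div L)) + w n ^ (n div L)) \<longlonglongrightarrow> 0 + complex_of_real (exp (- c / real L))"
    by (intro tendsto_add 1)
  then show ?thesis by (simp add: \<phi>_def c_def)
qed

lemma const_div_sqrt_tendsto_0: "(\<lambda>n. c / sqrt (real n)) \<longlonglongrightarrow> 0"
  by (intro tendsto_divide_0[OF tendsto_const] filterlim_at_top_imp_at_infinity
    filterlim_compose[OF sqrt_at_top filterlim_real_sequentially])

section \<open>Convergence of the normalised standard deviations and characteristic
  functions\<close>

context heat_bound begin

definition cap_char :: "nat \<Rightarrow> real \<Rightarrow> complex" where
  "cap_char n t = list_avg n (\<lambda>l :: (int ^ 'd) list. iexp (t / sqrt (real n) * centred n capr l))"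

lemma cap_char_approx:
  assumes "L \<ge> 1" "n \<ge> L"
  shows "cmod (cap_char n t - (list_avg L (\<lambda>l :: (int ^ 'd) list. iexp (t / sqrt (real n) * centred L capr l))) ^ (n div L))
    \<le> \<bar>t\<bar> * (BC / real L powr (1 / 4) + real L / sqrt (real n))"
proof -
  define k r where "k = n div L" and "r = n mod L"
  have n: "n = k * L + r" by (simp add: k_def r_def)
  let ?u = "t / sqrt (real n)"
  let ?G = "block_sum L (centred L (capr :: (int ^ 'd) list \<Rightarrow> real)) k"
  have "(list_avg L (\<lambda>l :: (int ^ 'd) list. iexp (?u * centred L capr l))) ^ k = list_avg (k * L) (\<lambda>l. iexp (?u * ?G l))"
    by (rule list_avg_iexp_block_sum[symmetric])
  also have "\<dots> = list_avg (k * L + r) (\<lambda>l. iexp (?u * ?G (take (k * L) l)))"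
    by (rule list_avg_take[symmetric])
  also have "\<dots> = list_avg n (\<lambda>l. iexp (?u * ?G l))" unfolding block_sum_take by (simp only: n[symmetric])
  finally have e: "(list_avg L (\<lambda>l :: (int ^ 'd) list. iexp (?u * centred L capr l))) ^ k = list_avg n (\<lambda>l. iexp (?u * ?G l))" .
  have "cmod (cap_char n t - list_avg n (\<lambda>l. iexp (?u * ?G l)))
    \<le> list_avg n (\<lambda>l. cmod (iexp (?u * centred n capr l) - iexp (?u * ?G l)))"
    unfolding cap_char_def list_avg_diff[symmetric] by (rule norm_list_avg_le)
  also have "\<dots> \<le> list_avg n (\<lambda>l. \<bar>?u\<bar> * \<bar>centred n capr l - ?G l\<bar>)"
  proof (rule list_avg_mono)
    fix l :: "(int ^ 'd) list"
    show "cmod (iexp (?u * centred n capr l) - iexp (?u * ?G l)) \<le> \<bar>?u\<bar> * \<bar>centred n capr l - ?G l\<bar>"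
      using cmod_iexp_diff_le[of "?u * centred n capr l" "?u * ?G l"]
      by (simp only: abs_mult[symmetric] right_diff_distrib)
  qed
  also have "\<dots> = \<bar>?u\<bar> * list_avg n (\<lambda>l. \<bar>centred n capr l - ?G l\<bar>)" by (rule list_avg_cmult)
  also have "\<dots> \<le> \<bar>?u\<bar> * (BC * real L powr (1 / 4) * sqrt (real k) + real L)"
    unfolding k_def by (intro mult_left_mono order_trans[OF list_avg_abs_le_l2norm centred_capr_approx] assms) simp
  also have "\<dots> = \<bar>t\<bar> * ((BC * real L powr (1 / 4) * sqrt (real k) + real L) / sqrt (real n))"
    by (simp add: abs_divide)
  also have "\<dots> \<le> \<bar>t\<bar> * (BC / real L powr (1 / 4) + real L / sqrt (real n))"
    unfolding k_def by (intro mult_left_mono approx_scaled assms) simp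
  finally show ?thesis unfolding k_def[symmetric] e .
qed

definition cap_rel_std :: "nat \<Rightarrow> real" where
  "cap_rel_std n = cap_std n / sqrt (real n)"

lemma BC_over_tendsto_0: "(\<lambda>L. BC / real L powr (1 / 4)) \<longlonglongrightarrow> 0"
proof -
  have "real L powr (1 / 4) = sqrt (sqrt (real L))" for L :: nat
    by (simp add: powr_half_sqrt[symmetric] powr_powr)
  then show ?thesis
    by (simp only:) (intro tendsto_divide_0[OF tendsto_const] filterlim_at_top_imp_at_infinity
      filterlim_compose[OF sqrt_at_top] filterlim_real_sequentially)
qed

lemma cap_rel_std_approx:
  assumes "L \<ge> 1" "n \<ge> L"
  shows "\<bar>cap_rel_std n - sqrt (real (n div L) / real n) * cap_std L\<bar> \<le> BC / real L powr (1 / 4) + real L / sqrt (real n)"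
proof -
  have "cap_rel_std n - sqrt (real (n div L) / real n) * cap_std L
    = (cap_std n - sqrt (real (n div L)) * cap_std L) / sqrt (real n)"
    by (simp add: cap_rel_std_def real_sqrt_divide diff_divide_distrib)
  then have "\<bar>cap_rel_std n - sqrt (real (n div L) / real n) * cap_std L\<bar>
    = \<bar>cap_std n - sqrt (real (n div L)) * cap_std L\<bar> / sqrt (real n)" by (simp add: abs_divide)
  also have "\<dots> \<le> (BC * real L powr (1 / 4) * sqrt (real (n div L)) + real L) / sqrt (real n)"
    by (intro divide_right_mono cap_std_approx assms) simp
  also have "\<dots> \<le> BC / real L powr (1 / 4) + real L / sqrt (real n)" by (rule approx_scaled[OF assms])
  finally show ?thesis .
qed

lemma cap_rel_std_diff_eventually:
  assumes "L \<ge> 1" "\<epsilon> > 0"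
  shows "\<forall>\<^sub>F n in sequentially. \<bar>cap_rel_std n - cap_rel_std L\<bar> < BC / real L powr (1 / 4) + \<epsilon>"
proof -
  have "(\<lambda>n. real L / sqrt (real n) + \<bar>sqrt (real (n div L) / real n) * cap_std L - cap_rel_std L\<bar>)
      \<longlonglongrightarrow> 0 + \<bar>sqrt (1 / real L) * cap_std L - cap_rel_std L\<bar>"
    by (intro tendsto_intros const_div_sqrt_tendsto_0 div_ratio_tendsto assms)
  also have "0 + \<bar>sqrt (1 / real L) * cap_std L - cap_rel_std L\<bar> = 0"
    by (simp add: cap_rel_std_def real_sqrt_divide)
  finally have "\<forall>\<^sub>F n in sequentially. real L / sqrt (real n) + \<bar>sqrt (real (n div L) / real n) * cap_std L - cap_rel_std L\<bar> < \<epsilon>"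
    using assms(2) by (rule order_tendstoD)
  then show ?thesis using eventually_ge_at_top[of L]
  proof eventually_elim
    case (elim n)
    then show ?case using cap_rel_std_approx[OF assms(1), of n] by linarith
  qed
qed

text \<open>Two late terms are compared through one block length \<open>L\<close>, fixed beforehand
  so that its error is below \<open>e / 4\<close>; each of them then lies within
  \<open>e / 2\<close> of \<open>cap_rel_std L\<close>.\<close>

lemma cap_rel_std_convergent: "convergent cap_rel_std"
proof -
  have "Cauchy cap_rel_std"
  proof (rule metric_CauchyI)
    fix e :: real assume e: "e > 0"
    have "\<forall>\<^sub>F L in sequentially. BC / real L powr (1 / 4) < e / 4"
      using BC_over_tendsto_0 e by (intro order_tendstoD(2)) auto
    then obtain L where L: "L \<ge> 1" "BC / real L powr (1 / 4) < e / 4"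
      using eventually_happens'[OF sequentially_bot eventually_conj[OF eventually_ge_at_top[of 1]]] by blast
    obtain N where N: "\<And>n. n \<ge> N \<Longrightarrow> \<bar>cap_rel_std n - cap_rel_std L\<bar> < BC / real L powr (1 / 4) + e / 4"
      using cap_rel_std_diff_eventually[OF L(1), of "e / 4"] e unfolding eventually_sequentially by auto
    show "\<exists>M. \<forall>m\<ge>M. \<forall>n\<ge>M. dist (cap_rel_std m) (cap_rel_std n) < e"
    proof (intro exI allI impI)
      fix m n assume "m \<ge> N" "n \<ge> N"
      from N[OF this(1)] N[OF this(2)] L(2) show "dist (cap_rel_std m) (cap_rel_std n) < e"
        unfolding dist_real_def by linarith
    qed
  qed
  then show ?thesis by (rule Cauchy_convergent)
qed

lemma cap_char_tendsto:
  assumes \<sigma>: "cap_rel_std \<longlonglongrightarrow> \<sigma>"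
  shows "(\<lambda>n. cap_char n t) \<longlonglongrightarrow> of_real (exp (- (t\<^sup>2 * \<sigma>\<^sup>2 / 2)))"
proof (rule tendstoI)
  fix e :: real assume e: "e > 0"
  let ?E = "\<lambda>L. exp (- (t\<^sup>2 * (cap_rel_std L)\<^sup>2 / 2))"
  have "(\<lambda>L. \<bar>t\<bar> * (BC / real L powr (1 / 4))) \<longlonglongrightarrow> \<bar>t\<bar> * 0"
    by (intro tendsto_mult_left BC_over_tendsto_0)
  then have 1: "\<forall>\<^sub>F L in sequentially. \<bar>t\<bar> * (BC / real L powr (1 / 4)) < e / 4"
    using e by (intro order_tendstoD(2)) auto
  have "?E \<longlonglongrightarrow> exp (- (t\<^sup>2 * \<sigma>\<^sup>2 / 2))" by (intro tendsto_intros \<sigma>) simp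
  then have 2: "\<forall>\<^sub>F L in sequentially. dist (?E L) (exp (- (t\<^sup>2 * \<sigma>\<^sup>2 / 2))) < e / 4"
    using e by (intro tendstoD) auto
  \<comment> \<open>Four quarters of \<open>e\<close>: the choice of \<open>L\<close> settles the
    block interaction and the distance of \<open>?E L\<close> from its limit; afterwards large
    \<open>n\<close> settles the limit theorem for blocks of length \<open>L\<close> and the term in
    L / sqrt n.\<close>
  obtain L where L: "L \<ge> 1" "\<bar>t\<bar> * (BC / real L powr (1 / 4)) < e / 4" "dist (?E L) (exp (- (t\<^sup>2 * \<sigma>\<^sup>2 / 2))) < e / 4"
    using eventually_happens'[OF sequentially_bot eventually_conj[OF eventually_ge_at_top[of 1] eventually_conj[OF 1 2]]] by blast
  let ?\<phi> = "\<lambda>n. (list_avg L (\<lambda>l :: (int ^ 'd) list. iexp (t / sqrt (real n) * centred L capr l))) ^ (n div L)"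
  have "?\<phi> \<longlonglongrightarrow> of_real (exp (- (t\<^sup>2 * (l2norm L (centred L (capr :: (int ^ 'd) list \<Rightarrow> real)))\<^sup>2 / 2) / real L))"
    by (rule list_avg_iexp_power_tendsto[OF abs_centred_capr_le _ L(1)]) auto
  also have "exp (- (t\<^sup>2 * (l2norm L (centred L (capr :: (int ^ 'd) list \<Rightarrow> real)))\<^sup>2 / 2) / real L) = ?E L"
    by (simp add: cap_rel_std_def cap_std_def power_divide)
  finally have 3: "\<forall>\<^sub>F n in sequentially. dist (?\<phi> n) (of_real (?E L)) < e / 4"
    using e by (intro tendstoD) auto
  have "(\<lambda>n. \<bar>t\<bar> * (real L / sqrt (real n))) \<longlonglongrightarrow> \<bar>t\<bar> * 0"
    by (intro tendsto_mult_left const_div_sqrt_tendsto_0)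
  then have 4: "\<forall>\<^sub>F n in sequentially. \<bar>t\<bar> * (real L / sqrt (real n)) < e / 4"
    using e by (intro order_tendstoD(2)) auto
  show "\<forall>\<^sub>F n in sequentially. dist (cap_char n t) (of_real (exp (- (t\<^sup>2 * \<sigma>\<^sup>2 / 2)))) < e"
    using 3 4 eventually_ge_at_top[of L]
  proof eventually_elim
    case (elim n)
    have "dist (cap_char n t) (?\<phi> n) \<le> \<bar>t\<bar> * (BC / real L powr (1 / 4)) + \<bar>t\<bar> * (real L / sqrt (real n))"
      using cap_char_approx[OF L(1) elim(3), of t] unfolding dist_norm by (simp only: distrib_left)
    moreover have "dist (complex_of_real (?E L)) (of_real (exp (- (t\<^sup>2 * \<sigma>\<^sup>2 / 2)))) < e / 4"
      using L(3) by (simp only: dist_of_real)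
    moreover have "dist (cap_char n t) (of_real (exp (- (t\<^sup>2 * \<sigma>\<^sup>2 / 2))))
      \<le> dist (cap_char n t) (?\<phi> n) + dist (?\<phi> n) (of_real (?E L)) + dist (complex_of_real (?E L)) (of_real (exp (- (t\<^sup>2 * \<sigma>\<^sup>2 / 2))))"
      using dist_triangle[of "cap_char n t" "of_real (exp (- (t\<^sup>2 * \<sigma>\<^sup>2 / 2)))" "?\<phi> n"]
        dist_triangle[of "?\<phi> n" "of_real (exp (- (t\<^sup>2 * \<sigma>\<^sup>2 / 2)))" "complex_of_real (?E L)"] by linarith
    ultimately show ?case using elim L(2) by linarith
  qed
qed

end

section \<open>The limit law and the law of the normalised capacity\<close>

lemma char_normal_density:
  assumes "\<sigma> > 0"
  shows "char (density lborel (normal_density 0 \<sigma>)) t = of_real (exp (- (t\<^sup>2 * \<sigma>\<^sup>2 / 2)))"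
proof -
  have "density lborel (normal_density 0 \<sigma>) = distr std_normal_distribution borel (\<lambda>x. \<sigma> * x)"
  proof -
    interpret prob_space std_normal_distribution by (rule prob_space_normal_density) simp
    have "distributed std_normal_distribution lborel (\<lambda>x. x) (normal_density 0 1)"
      unfolding distributed_def by (auto simp: distr_id2)
    from normal_density_affine[OF this, of \<sigma> 0] assms
    show ?thesis unfolding distributed_def by (auto simp: distr_cong[of _ _ lborel borel])
  qed
  then have "char (density lborel (normal_density 0 \<sigma>)) t = (\<integral>x. iexp (t * (\<sigma> * x)) \<partial>std_normal_distribution)"
    unfolding char_def by (simp add: integral_distr)
  also have "\<dots> = char std_normal_distribution (t * \<sigma>)" by (simp add: char_def mult.assoc)
  also have "\<dots> = of_real (exp (- (t\<^sup>2 * \<sigma>\<^sup>2 / 2)))"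
    by (simp add: char_std_normal_distribution power_mult_distrib)
  finally show ?thesis .
qed

lemma real_distribution_normal: "\<sigma> > 0 \<Longrightarrow> real_distribution (density lborel (normal_density 0 \<sigma>))"
  by (simp add: real_distribution_def real_distribution_axioms_def prob_space_normal_density)

lemma Cap_walk_range_distribution:
  fixes n :: nat
  defines "X \<equiv> \<lambda>w. (Cap (walk_range w n) - (\<integral>w'. Cap (walk_range w' n) \<partial>(SRW :: (int ^ 'd::finite) stream measure))) / sqrt (real n)"
  shows "real_distribution (distr (SRW :: (int ^ 'd) stream measure) borel X)"
    and "char (distr (SRW :: (int ^ 'd) stream measure) borel X) t
      = list_avg n (\<lambda>l :: (int ^ 'd) list. iexp (t / sqrt (real n) * centred n capr l))"
proof -
  have b: "\<bar>capr l\<bar> \<le> real n + 1" if "length l = n" for l :: "(int ^ 'd) list"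
    using capr_le[of l] capr_nonneg[of l] that by simp
  have "(\<integral>w'. Cap (walk_range w' n) \<partial>(SRW :: (int ^ 'd) stream measure)) = list_avg n (capr :: (int ^ 'd) list \<Rightarrow> real)"
    unfolding walk_range_eq capr_def[symmetric]
    by (rule integral_stake[OF b])
  then have X: "X = (\<lambda>w. centred n capr (stake n w) / sqrt (real n))"
    unfolding X_def centred_def walk_range_eq capr_def by simp
  have m: "X \<in> borel_measurable SRW" unfolding X by (rule borel_measurable_stake)
  show "real_distribution (distr (SRW :: (int ^ 'd) stream measure) borel X)"
    using m by (intro SRW.real_distribution_distr)
  have "char (distr (SRW :: (int ^ 'd) stream measure) borel X) t = (\<integral>w. iexp (t * X w) \<partial>SRW)"
    unfolding char_def by (rule integral_distr[OF m]) simp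
  also have "\<dots> = (\<integral>w. (\<lambda>l. iexp (t / sqrt (real n) * centred n capr l)) (stake n w) \<partial>(SRW :: (int ^ 'd) stream measure))"
    by (simp add: X)
  also have "\<dots> = list_avg n (\<lambda>l :: (int ^ 'd) list. iexp (t / sqrt (real n) * centred n capr l))"
    by (rule integral_stake_complex[where C = 1]) simp
  finally show "char (distr (SRW :: (int ^ 'd) stream measure) borel X) t
      = list_avg n (\<lambda>l :: (int ^ 'd) list. iexp (t / sqrt (real n) * centred n capr l))" .
qed

subsection \<open>Positivity of the limiting variance\<close>

text \<open>The walk is recentred to be at \<open>x\<close> at time \<open>t\<close>. Its future is
  the remaining step list, its past the negated steps in reverse order, so two avoidance events
  cover every other time.\<close>

lemma avoid_both_sides:
  fixes l :: "(int ^ 'd::finite) list"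
  assumes "avoid A x (map uminus (rev (take t l)))" "avoid A x (drop t l)"
    and "t \<le> length l" "j \<le> length l" "j \<noteq> t"
  shows "x - sum_list (take t l) + sum_list (take j l) \<notin> A"
proof (cases "j < t")
  case True
  have "take (t - j) (rev (take t l)) = rev (drop j (take t l))"
    using True assms(3) by (simp add: rev_drop min_absorb2)
  then have "sum_list (take (t - j) (map uminus (rev (take t l)))) = - sum_list (drop j (take t l))"
    by (simp add: take_map sum_list_map_uminus sum_list_rev)
  moreover have "sum_list (take t l) = sum_list (take j l) + sum_list (drop j (take t l))"
    using True by (metis append_take_drop_id less_imp_le_nat min.absorb1 sum_list_append take_take)
  moreover have "x + sum_list (take (t - j) (map uminus (rev (take t l)))) \<notin> A"
    using assms(1,3) True unfolding avoid_iff by auto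
  ultimately show ?thesis by (simp add: algebra_simps)
next
  case False
  then have "j = t + (j - t)" using assms by simp
  then have "sum_list (take j l) = sum_list (take t l) + sum_list (take (j - t) (drop t l))"
    by (metis sum_list_append take_add)
  moreover have "x + sum_list (take (j - t) (drop t l)) \<notin> A"
  proof -
    have "j - t \<in> {1..length (drop t l)}" using assms False by auto
    then show ?thesis using assms(2) unfolding avoid_iff by blast
  qed
  ultimately show ?thesis by (simp add: algebra_simps)
qed

text \<open>The new points of the sausage are \<open>x - S\<^sub>t\<close>, one for each time \<open>t\<close> such that the walk
  recentred at time \<open>t\<close> avoids the set both in the past and in the future.\<close>

lemma card_sausage_insert_ge:
  fixes l :: "(int ^ 'd::finite) list"
  assumes "finite B" "x \<notin> B" "length l = n"
  defines "A \<equiv> insert x B"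
  shows "real (card (sausage B l)) + (\<Sum>t\<le>n. of_bool (avoid A x (map uminus (rev (take t l))) \<and> avoid A x (drop t l)))
    \<le> real (card (sausage A l))"
proof -
  define T where "T = {t \<in> {..n}. avoid A x (map uminus (rev (take t l))) \<and> avoid A x (drop t l)}"
  let ?f = "\<lambda>t. x - sum_list (take t l)"
  have out: "?f t + sum_list (take j l) \<notin> A" if "t \<in> T" "j \<le> n" "j \<noteq> t" for t j
    using avoid_both_sides[of A x t l j] that assms(3) unfolding T_def by auto
  have inj: "inj_on ?f T"
  proof (rule inj_onI)
    fix s t assume st: "s \<in> T" "t \<in> T" "?f s = ?f t"
    show "s = t"
    proof (rule ccontr)
      assume "s \<noteq> t"
      then have "?f t + sum_list (take s l) \<notin> A" using out[of t s] st by (auto simp: T_def)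
      then show False using st(3) by (simp add: A_def)
    qed
  qed
  have fA: "finite (sausage A l)" and fB: "finite (sausage B l)" using assms(1) by (auto simp: A_def)
  have sub: "?f ` T \<subseteq> sausage A l - sausage B l"
  proof (intro subsetI DiffI)
    fix z assume "z \<in> ?f ` T"
    then obtain t where t: "t \<in> T" "z = ?f t" by blast
    then have tn: "t \<le> n" by (simp add: T_def)
    have "sum_list (take t l) \<in> lrange l" using tn assms(3) unfolding lrange_eq by auto
    then show "z \<in> sausage A l" unfolding in_sausage_iff t(2) by (rule bexI[rotated]) (simp add: A_def)
    show "z \<notin> sausage B l"
    proof
      assume "z \<in> sausage B l"
      then obtain j where j: "j \<le> n" "?f t + sum_list (take j l) \<in> B"
        unfolding in_sausage_iff lrange_eq t(2) assms(3) by auto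
      show False
      proof (cases "j = t")
        case True
        then show False using j(2) assms(2) by simp
      next
        case False
        then show False using out[OF t(1) j(1)] j(2) by (auto simp: A_def)
      qed
    qed
  qed
  have sm: "sausage B l \<subseteq> sausage A l" by (rule sausage_mono) (auto simp: A_def)
  have "card T \<le> card (sausage A l - sausage B l)"
    using card_mono[OF _ sub] fA by (simp add: card_image[OF inj])
  also have "\<dots> = card (sausage A l) - card (sausage B l)"
    by (rule card_Diff_subset[OF fB sm])
  finally have "card T + card (sausage B l) \<le> card (sausage A l)"
    using card_mono[OF fA sm] by linarith
  moreover have "real (card T) = (\<Sum>t\<le>n. of_bool (avoid A x (map uminus (rev (take t l))) \<and> avoid A x (drop t l)))"
    unfolding T_def by (simp add: sum_of_bool_eq Int_def)
  ultimately show ?thesis by linarith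
qed

text \<open>At each of the \<open>n + 1\<close> times the past and the future of the recentred walk
  are independent, and after reversal and reflection both are ordinary walks. Each avoids the set
  with at least the escape probability, hence the square.\<close>

lemma Cap_insert_ge:
  fixes B :: "(int ^ 'd::finite) set"
  assumes "finite B" "x \<notin> B"
  shows "Cap B + (escape_prob (insert x B) x)\<^sup>2 \<le> Cap (insert x B)"
proof -
  let ?A = "insert x B" and ?e = "escape_prob (insert x B) x"
  have "Cap B - Cap ?A \<le> - ?e\<^sup>2"
  proof (rule increment_limit_le)
    have fA: "finite ?A" using assms by simp
    show "(\<lambda>n. (vol (Suc n) B - vol (Suc n) ?A) - (vol n B - vol n ?A)) \<longlonglongrightarrow> Cap B - Cap ?A"
      using tendsto_diff[OF vol_Suc_tendsto_Cap[OF assms(1)] vol_Suc_tendsto_Cap[OF fA]] by (simp add: algebra_simps)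
    fix n
    have t: "?e\<^sup>2 \<le> list_avg n (\<lambda>l. of_bool (avoid ?A x (map uminus (rev (take t l))) \<and> avoid ?A x (drop t l)))"
      if "t \<le> n" for t
    proof -
      have n: "n = t + (n - t)" using that by simp
      have "list_avg (t + (n - t)) (\<lambda>l. of_bool (avoid ?A x (map uminus (rev (take t l))) \<and> avoid ?A x (drop t l)) :: real)
        = list_avg t (\<lambda>l. list_avg (n - t) (\<lambda>l'. of_bool (avoid ?A x (map uminus (rev l))) * of_bool (avoid ?A x l')))"
        unfolding list_avg_append by (intro list_avg_cong) (simp add: of_bool_conj)
      also have "\<dots> = list_avg t (\<lambda>l. of_bool (avoid ?A x (map uminus (rev l)))) * esc (n - t) ?A x"
        unfolding list_avg_cmult list_avg_multc esc_def ..
      also have "list_avg t (\<lambda>l. of_bool (avoid ?A x (map uminus (rev l)))) = esc t ?A x"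
        unfolding esc_def list_avg_rev[of t "\<lambda>l. of_bool (avoid ?A x (map uminus l))"]
        by (rule list_avg_map_uminus)
      also have "esc t ?A x * esc (n - t) ?A x \<ge> ?e * ?e"
        by (intro mult_mono escape_prob_le_esc order_trans[OF escape_prob_nonneg escape_prob_le_esc]) simp
      finally show ?thesis using n by (simp add: power2_eq_square)
    qed
    have "vol n B + ?e\<^sup>2 * (real n + 1) = vol n B + (\<Sum>t\<le>n. ?e\<^sup>2)" by (simp add: algebra_simps)
    also have "\<dots> \<le> vol n B + (\<Sum>t\<le>n. list_avg n (\<lambda>l. of_bool (avoid ?A x (map uminus (rev (take t l))) \<and> avoid ?A x (drop t l))))"
      by (intro add_left_mono sum_mono t) simp
    also have "\<dots> = list_avg n (\<lambda>l. real (card (sausage B l)) + (\<Sum>t\<le>n. of_bool (avoid ?A x (map uminus (rev (take t l))) \<and> avoid ?A x (drop t l))))"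
      by (simp only: vol_def list_avg_add list_avg_sum)
    also have "\<dots> \<le> vol n ?A"
      unfolding vol_def by (intro list_avg_mono card_sausage_insert_ge assms)
    finally show "vol n B - vol n ?A \<le> - ?e\<^sup>2 * (real n + 1)" by simp
  qed
  then show ?thesis by simp
qed

section \<open>Prescribed steps and the exchange of blocks\<close>

lemma list_avg_prefix_ge:
  fixes f :: "(int ^ 'd::finite) list \<Rightarrow> real"
  assumes "\<And>l. f l \<ge> 0" "set w \<subseteq> unit_steps"
  shows "(1 / real (card (unit_steps :: (int ^ 'd) set))) ^ length w * list_avg n (\<lambda>l. f (w @ l)) \<le> list_avg (length w + n) f"
  using assms
proof (induction w arbitrary: f)
  case (Cons v w)
  let ?p = "1 / real (card (unit_steps :: (int ^ 'd) set))"
  have "?p ^ length w * list_avg n (\<lambda>l. f (v # w @ l)) \<le> list_avg (length w + n) (\<lambda>l. f (v # l))"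
    using Cons.IH[of "\<lambda>l. f (v # l)"] Cons.prems by simp
  also have "\<dots> \<le> (\<Sum>u\<in>unit_steps. list_avg (length w + n) (\<lambda>l. f (u # l)))"
    using Cons.prems by (intro member_le_sum list_avg_nonneg) auto
  finally have "?p * (?p ^ length w * list_avg n (\<lambda>l. f (v # w @ l)))
      \<le> ?p * (\<Sum>u\<in>unit_steps. list_avg (length w + n) (\<lambda>l. f (u # l)))"
    by (intro mult_left_mono) auto
  then show ?case by (simp add: step_avg_def mult.assoc)
qed simp

lemma list_avg_point:
  fixes f :: "(int ^ 'd::finite) list \<Rightarrow> real"
  assumes "set w \<subseteq> unit_steps"
  shows "list_avg (length w) (\<lambda>l. f l * of_bool (l = w)) = (1 / real (card (unit_steps :: (int ^ 'd) set))) ^ length w * f w"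
  using assms
proof (induction w arbitrary: f)
  case (Cons v w)
  let ?p = "1 / real (card (unit_steps :: (int ^ 'd) set))"
  have "list_avg (length (v # w)) (\<lambda>l. f l * of_bool (l = v # w))
    = step_avg (\<lambda>u. if u = v then list_avg (length w) (\<lambda>l. f (v # l) * of_bool (l = w)) else 0)"
    unfolding list_avg.simps list.size(4) add_0_right add_Suc_right One_nat_def
    by (intro step_avg_cong) auto
  also have "\<dots> = ?p * list_avg (length w) (\<lambda>l. f (v # l) * of_bool (l = w))"
    using Cons.prems by (simp add: step_avg_def)
  also have "\<dots> = ?p * (?p ^ length w * f (v # w))"
    using Cons.IH[of "\<lambda>l. f (v # l)"] Cons.prems by simp
  finally show ?case by simp
qed simp

lemma lrange_map_uminus: "lrange (map uminus l) = uminus ` lrange (l :: (int ^ 'd::finite) list)"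
  by (induction l) (auto simp: image_image algebra_simps)

text \<open>The inserted loop closes up, so with the junction at the origin the reversed past, the
  future and the loop all start from the same point.\<close>

lemma capr_middle:
  fixes l :: "(int ^ 'd::finite) list"
  assumes "sum_list b = 0"
  shows "capr (l @ b @ l') = Cap (lrange (map uminus (rev l)) \<union> lrange l' \<union> lrange b)"
proof -
  have "lrange (l @ b @ l') = (+) (sum_list l) ` (lrange (map uminus (rev l)) \<union> lrange l' \<union> lrange b)"
    unfolding lrange_append image_Un assms lrange_map_uminus image_image lrange_rev[of l] by auto
  then show ?thesis unfolding capr_def by (simp only: Cap_translate)
qed

text \<open>The weight \<open>h\<close> on one block compares \<open>b1\<close> with
  \<open>b2\<close> there, each having probability \<open>p ^ K\<close>, while everything around it
  is averaged. The \<open>k\<close> block positions contribute separately.\<close>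

lemma block_covariance_ge:
  fixes X :: "(int ^ 'd::finite) list \<Rightarrow> real" and b1 b2 :: "(int ^ 'd) list"
  defines "h \<equiv> \<lambda>l. of_bool (l = b1) - of_bool (l = b2)"
    and "p \<equiv> (1 / real (card (unit_steps :: (int ^ 'd) set)))"
  assumes b: "length b1 = K" "length b2 = K" "set b1 \<subseteq> unit_steps" "set b2 \<subseteq> unit_steps"
    and X: "\<And>a b. a + K + b = k * K + r \<Longrightarrow> \<delta> \<le> list_avg a (\<lambda>l. list_avg b (\<lambda>l'. X (l @ b1 @ l') - X (l @ b2 @ l')))"
  shows "real k * p ^ K * \<delta> \<le> list_avg (k * K + r) (\<lambda>l. X l * block_sum K h k l)"
  using X
proof (induction k arbitrary: X)
  case (Suc k)
  let ?n = "k * K + r"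
  \<comment> \<open>Averaging out the first block leaves a functional of the rest. It inherits the
    hypothesis, because that block becomes part of the averaged prefix.\<close>
  define X' where "X' l = list_avg K (\<lambda>w. X (w @ l))" for l
  have h: "list_avg K (\<lambda>w. f w * h w) = p ^ K * (f b1 - f b2)" for f
  proof -
    have "list_avg K (\<lambda>w. f w * h w) = list_avg K (\<lambda>w. f w * of_bool (w = b1)) - list_avg K (\<lambda>w. f w * of_bool (w = b2))"
      unfolding h_def by (simp only: right_diff_distrib list_avg_diff)
    then show ?thesis using list_avg_point[OF b(3), of f] list_avg_point[OF b(4), of f]
      unfolding b(1,2) p_def by (simp only: right_diff_distrib)
  qed
  have n: "Suc k * K + r = K + ?n" by simp
  have "list_avg (Suc k * K + r) (\<lambda>l. X l * block_sum K h (Suc k) l)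
    = list_avg K (\<lambda>w. list_avg ?n (\<lambda>l. X (w @ l) * h w + X (w @ l) * block_sum K h k l))"
    unfolding n list_avg_append by (intro list_avg_cong) (simp add: distrib_left)
  also have "\<dots> = list_avg K (\<lambda>w. list_avg ?n (\<lambda>l. X (w @ l)) * h w) + list_avg ?n (\<lambda>l. X' l * block_sum K h k l)"
  proof -
    have "list_avg K (\<lambda>w. list_avg ?n (\<lambda>l. X (w @ l) * block_sum K h k l))
      = list_avg ?n (\<lambda>l. list_avg K (\<lambda>w. X (w @ l) * block_sum K h k l))" by (rule list_avg_swap)
    then show ?thesis by (simp only: list_avg_add list_avg_multc X'_def)
  qed
  also have "list_avg K (\<lambda>w. list_avg ?n (\<lambda>l. X (w @ l)) * h w)
     = p ^ K * list_avg ?n (\<lambda>l. X (b1 @ l) - X (b2 @ l))"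
    unfolding h list_avg_diff ..
  finally have e: "list_avg (Suc k * K + r) (\<lambda>l. X l * block_sum K h (Suc k) l)
    = p ^ K * list_avg ?n (\<lambda>l. X (b1 @ l) - X (b2 @ l)) + list_avg ?n (\<lambda>l. X' l * block_sum K h k l)" .
  have "\<delta> \<le> list_avg ?n (\<lambda>l. X (b1 @ l) - X (b2 @ l))"
    using Suc.prems[of 0 ?n] by simp
  then have 1: "p ^ K * \<delta> \<le> p ^ K * list_avg ?n (\<lambda>l. X (b1 @ l) - X (b2 @ l))"
    by (rule mult_left_mono) (simp add: p_def)
  have 2: "real k * p ^ K * \<delta> \<le> list_avg ?n (\<lambda>l. X' l * block_sum K h k l)"
  proof (rule Suc.IH)
    fix a b assume ab: "a + K + b = ?n"
    have "list_avg a (\<lambda>l. list_avg b (\<lambda>l'. X' (l @ b1 @ l') - X' (l @ b2 @ l')))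
      = list_avg a (\<lambda>l. list_avg b (\<lambda>l'. list_avg K (\<lambda>w. X (w @ l @ b1 @ l') - X (w @ l @ b2 @ l'))))"
      unfolding X'_def list_avg_diff ..
    also have "\<dots> = list_avg a (\<lambda>l. list_avg K (\<lambda>w. list_avg b (\<lambda>l'. X (w @ l @ b1 @ l') - X (w @ l @ b2 @ l'))))"
      by (intro list_avg_cong list_avg_swap)
    also have "\<dots> = list_avg K (\<lambda>w. list_avg a (\<lambda>l. list_avg b (\<lambda>l'. X (w @ l @ b1 @ l') - X (w @ l @ b2 @ l'))))"
      by (rule list_avg_swap)
    also have "\<dots> = list_avg (K + a) (\<lambda>l. list_avg b (\<lambda>l'. X (l @ b1 @ l') - X (l @ b2 @ l')))"
      unfolding list_avg_append by simp
    also have "\<dots> \<ge> \<delta>" by (rule Suc.prems) (use ab in simp)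
    finally show "\<delta> \<le> list_avg a (\<lambda>l. list_avg b (\<lambda>l'. X' (l @ b1 @ l') - X' (l @ b2 @ l')))" .
  qed
  show ?case unfolding e using 1 2 by (simp add: algebra_simps)
qed simp

section \<open>Hitting points far out on an axis\<close>

lemma abs_sum_list_coordinate_le:
  "set l \<subseteq> unit_steps \<Longrightarrow> \<bar>sum_list l $ i\<bar> \<le> int (length (l :: (int ^ 'd::finite) list))"
proof (induction l)
  case (Cons v l)
  then have "\<bar>v $ i\<bar> \<le> 1" by (auto simp: unit_steps_def axis_def)
  then show ?case using Cons by simp
qed simp

lemma hk_axis_eq_0: "t < r \<Longrightarrow> hk t (axis i (int r) :: int ^ 'd::finite) = 0"
proof -
  assume r: "t < r"
  have "hk t (axis i (int r) :: int ^ 'd) = list_avg t (\<lambda>l :: (int ^ 'd) list. 0)"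
    unfolding hk_def
  proof (rule list_avg_cong)
    fix l :: "(int ^ 'd) list" assume "length l = t" "set l \<subseteq> unit_steps"
    then have "\<bar>sum_list l $ i\<bar> < int r" using abs_sum_list_coordinate_le[of l i] r by simp
    then have "sum_list l \<noteq> axis i (int r)" by (auto simp: axis_def)
    then show "of_bool (sum_list l = axis i (int r)) = (0 :: real)" by simp
  qed
  then show ?thesis by simp
qed

lemma of_bool_le_sum:
  assumes "finite J" "P \<Longrightarrow> \<exists>j\<in>J. Q j"
  shows "of_bool P \<le> (\<Sum>j\<in>J. of_bool (Q j) :: real)"
proof (cases P)
  case True
  then obtain j where j: "j \<in> J" "Q j" using assms by blast
  have "of_bool (Q j) \<le> (\<Sum>j\<in>J. of_bool (Q j) :: real)"
    by (rule member_le_sum) (use j assms in auto)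
  then show ?thesis using j by simp
qed (simp add: sum_nonneg)

lemma sum_list_replicate_axis: "sum_list (replicate r (axis i 1)) = (axis i (int r) :: int ^ 'd::finite)"
  by (induction r) (auto simp: axis_def vec_eq_iff)

context heat_bound begin

text \<open>The target is \<open>r\<close> units away, so times below \<open>r\<close> contribute
  nothing and the others form part of a tail from \<open>m\<close> on.\<close>

lemma sum_hk_axis_le:
  fixes i :: 'd
  assumes "finite J" "\<And>u. u \<in> J \<Longrightarrow> u \<ge> m \<or> u < r"
  shows "(\<Sum>u\<in>J. hk u (axis i (int r))) \<le> gb m"
proof -
  let ?z = "axis i (int r) :: int ^ 'd"
  obtain T where T: "J \<subseteq> {..<T}" using assms(1) finite_nat_bounded by (auto simp: lessThan_def)
  have "(\<Sum>u\<in>J. hk u ?z) = (\<Sum>u\<in>J \<inter> {m..}. hk u ?z)"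
    using assms by (intro sum.mono_neutral_right) (auto intro!: hk_axis_eq_0)
  also have "\<dots> \<le> (\<Sum>u\<in>(\<lambda>t. t + m) ` {..<T}. hk u ?z)"
  proof (rule sum_mono2)
    show "J \<inter> {m..} \<subseteq> (\<lambda>t. t + m) ` {..<T}"
    proof
      fix u assume "u \<in> J \<inter> {m..}"
      then show "u \<in> (\<lambda>t. t + m) ` {..<T}" using T by (intro image_eqI[of _ _ "u - m"]) auto
    qed
  qed auto
  also have "\<dots> = (\<Sum>t<T. hk (t + m) ?z)" by (simp add: sum.reindex)
  also have "\<dots> \<le> gb m" by (rule sum_hk_le)
  finally show ?thesis .
qed

lemma hit_axis_le: "list_avg n (\<lambda>l. of_bool (axis i (int r) \<in> lrange l)) \<le> gb r" for i :: 'd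
proof -
  let ?z = "axis i (int r) :: int ^ 'd"
  have "list_avg n (\<lambda>l. of_bool (?z \<in> lrange l)) \<le> list_avg n (\<lambda>l. \<Sum>t\<le>n. of_bool (sum_list (take t l) = ?z) :: real)"
    by (intro list_avg_mono of_bool_le_sum) (auto simp: lrange_eq)
  also have "\<dots> = (\<Sum>t\<le>n. hk t ?z)"
    unfolding list_avg_sum
  proof (intro sum.cong refl)
    fix t assume "t \<in> {..n}"
    then show "list_avg n (\<lambda>l. of_bool (sum_list (take t l) = ?z)) = hk t ?z"
      using list_avg_take[of t "n - t" "\<lambda>l. of_bool (sum_list l = ?z)"] by (simp add: hk_def)
  qed
  also have "\<dots> \<le> gb r" by (intro sum_hk_axis_le) auto
  finally show ?thesis .
qed

lemma sum_gb_max_le: "(\<Sum>s\<le>a. gb (max s r)) \<le> 6 * C0 / (real r + 1)"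
proof -
  have "(\<Sum>s\<le>a. gb (max s r)) \<le> (\<Sum>s\<le>a. (if s < r then gb r else 0) + (if r \<le> s then gb s else 0))"
    by (intro sum_mono) (auto simp: max_def)
  also have "\<dots> = (\<Sum>s\<le>a. if s < r then gb r else 0) + (\<Sum>s\<le>a. if r \<le> s then gb s else 0)"
    by (rule sum.distrib)
  also have "(\<Sum>s\<le>a. if s < r then gb r else 0) \<le> 2 * C0 / (real r + 1)"
  proof -
    have "(\<Sum>s\<le>a. if s < r then gb r else 0) = (\<Sum>s\<in>{..a} \<inter> {..<r}. gb r)"
      by (subst sum.inter_restrict) (auto intro!: sum.cong simp del: sum_constant)
    also have "\<dots> \<le> (\<Sum>s<r. gb r)" by (rule sum_mono2) auto
    also have "\<dots> = real r * (2 * C0) / (real r + 1)\<^sup>2" by (simp add: gb_def)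
    also have "\<dots> \<le> (real r + 1) * (2 * C0) / (real r + 1)\<^sup>2"
      using C0_ge_1 by (intro divide_right_mono mult_right_mono) auto
    also have "\<dots> = 2 * C0 / (real r + 1)" by (simp add: power2_eq_square)
    finally show ?thesis .
  qed
  also have "(\<Sum>s\<le>a. if r \<le> s then gb s else 0) \<le> 4 * C0 / (real r + 1)" by (rule sum_gb_from_le)
  also have "2 * C0 / (real r + 1) + 4 * C0 / (real r + 1) = 6 * C0 / (real r + 1)"
    by (simp add: add_divide_distrib[symmetric])
  finally show ?thesis by simp
qed

text \<open>A union bound over pairs of times: a meeting at times \<open>s\<close> and
  \<open>t\<close> has the probability that one walk of \<open>s + t\<close> steps reaches the axis
  point. Summing over \<open>t\<close> first gives a tail from \<open>max s r\<close> on.\<close>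

lemma meet_axis_le:
  "list_avg a (\<lambda>l. list_avg b (\<lambda>l'. of_bool (\<exists>y\<in>lrange l. \<exists>y'\<in>lrange l'. axis i (int r) + y' = y))) \<le> 6 * C0 / (real r + 1)"
  for i :: 'd
proof -
  let ?z = "axis i (int r) :: int ^ 'd"
  let ?S = "\<lambda>s (l :: (int ^ 'd) list). sum_list (take s l)"
  have "list_avg a (\<lambda>l. list_avg b (\<lambda>l'. of_bool (\<exists>y\<in>lrange l. \<exists>y'\<in>lrange l'. ?z + y' = y)))
    \<le> list_avg a (\<lambda>l. list_avg b (\<lambda>l'. \<Sum>s\<le>a. \<Sum>t\<le>b. of_bool (?z + ?S t l' = ?S s l) :: real))"
  proof (intro list_avg_mono)
    fix l l' :: "(int ^ 'd) list" assume l: "length l = a" "length l' = b"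
    have "of_bool (\<exists>y\<in>lrange l. \<exists>y'\<in>lrange l'. ?z + y' = y)
      \<le> (\<Sum>q\<in>{..a} \<times> {..b}. of_bool (?z + ?S (snd q) l' = ?S (fst q) l) :: real)"
      by (rule of_bool_le_sum) (auto simp: lrange_eq l)
    then show "of_bool (\<exists>y\<in>lrange l. \<exists>y'\<in>lrange l'. ?z + y' = y)
      \<le> (\<Sum>s\<le>a. \<Sum>t\<le>b. of_bool (?z + ?S t l' = ?S s l) :: real)"
      by (simp add: sum.cartesian_product case_prod_unfold del: sum_of_bool_eq)
  qed
  also have "\<dots> = (\<Sum>s\<le>a. \<Sum>t\<le>b. list_avg a (\<lambda>l. list_avg b (\<lambda>l'. of_bool (?z + ?S t l' = ?S s l))))"
    by (simp add: list_avg_sum del: sum_of_bool_eq)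
  also have "\<dots> = (\<Sum>s\<le>a. \<Sum>t\<le>b. hk (s + t) ?z)"
  proof (intro sum.cong refl)
    fix s t assume st: "s \<in> {..a}" "t \<in> {..b}"
    have "list_avg a (\<lambda>l. list_avg b (\<lambda>l'. of_bool (?z + ?S t l' = ?S s l)) :: real)
      = list_avg s (\<lambda>l. list_avg b (\<lambda>l'. of_bool (?z + ?S t l' = sum_list l)))"
      using list_avg_take[of s "a - s" "\<lambda>l. list_avg b (\<lambda>l'. of_bool (?z + ?S t l' = sum_list l)) :: real"] st by simp
    also have "\<dots> = list_avg s (\<lambda>l. list_avg t (\<lambda>l'. of_bool (?z + sum_list l' = sum_list l)))"
      using list_avg_take[of t "b - t" "\<lambda>l'. of_bool (?z + sum_list l' = x) :: real" for x] st by simp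
    also have "\<dots> = list_avg t (\<lambda>l'. list_avg s (\<lambda>l. of_bool (sum_list l = ?z + sum_list l')))"
      by (subst list_avg_swap) (simp only: eq_commute)
    also have "\<dots> = hk (s + t) ?z" unfolding hk_def[symmetric] by (rule hk_add)
    finally show "list_avg a (\<lambda>l. list_avg b (\<lambda>l'. of_bool (?z + ?S t l' = ?S s l))) = hk (s + t) ?z" .
  qed
  also have "\<dots> \<le> (\<Sum>s\<le>a. gb (max s r))"
  proof (rule sum_mono)
    fix s
    have "(\<Sum>t\<le>b. hk (s + t) ?z) = (\<Sum>u\<in>(\<lambda>t. s + t) ` {..b}. hk u ?z)" by (simp add: sum.reindex)
    also have "\<dots> \<le> gb (max s r)" by (intro sum_hk_axis_le) auto
    finally show "(\<Sum>t\<le>b. hk (s + t) ?z) \<le> gb (max s r)" .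
  qed
  also have "\<dots> \<le> 6 * C0 / (real r + 1)" by (rule sum_gb_max_le)
  finally show ?thesis .
qed

end

text \<open>The segment stops one short of \<open>axis i m\<close>, the tip to be inserted. Without
  the tip the set covers everything visited with the near loop in between; with it, the set is still
  covered by what is visited with the far loop.\<close>

definition axis_nbhd :: "'d::finite \<Rightarrow> nat \<Rightarrow> (int ^ 'd) list \<Rightarrow> (int ^ 'd) list \<Rightarrow> (int ^ 'd) set" where
  "axis_nbhd i m l l' = lrange l \<union> lrange l' \<union> (\<lambda>r. axis i (int r)) ` {..<m}"

lemma finite_axis_nbhd [simp]: "finite (axis_nbhd i m l l')"
  by (simp add: axis_nbhd_def)

lemma axis_add: "axis i (int r) + axis i (int s) = (axis i (int (r + s)) :: int ^ 'd::finite)"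
  by (auto simp: axis_def vec_eq_iff)

text \<open>From the tip the walk first runs \<open>m\<close> more steps straight out. Only then is
  it left to chance, far from the segment, and the hypotheses list the events that could still spoil
  the escape.\<close>

lemma straight_escape:
  fixes i :: "'d::finite"
  defines "ax \<equiv> \<lambda>r. axis i (int r) :: int ^ 'd"
  assumes 1: "\<And>r. m \<le> r \<Longrightarrow> r \<le> 2 * m \<Longrightarrow> ax r \<notin> lrange l \<union> lrange l'"
    and 2: "\<And>r y'. r \<le> m \<Longrightarrow> y' \<in> lrange w \<Longrightarrow> ax (2 * m) + y' \<noteq> ax r"
    and 3: "\<And>y'. y' \<in> lrange w \<Longrightarrow> ax (2 * m) + y' \<notin> lrange l \<union> lrange l'"
  shows "ax m \<notin> axis_nbhd i m l l'"
    and "avoid (insert (ax m) (axis_nbhd i m l l')) (ax m) (replicate m (axis i 1) @ w)"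
proof -
  have inj: "ax r = ax s \<longleftrightarrow> r = s" for r s by (auto simp: ax_def axis_eq_axis)
  show "ax m \<notin> axis_nbhd i m l l'"
    using 1[of m] inj unfolding axis_nbhd_def ax_def by auto
  have A: "insert (ax m) (axis_nbhd i m l l') = lrange l \<union> lrange l' \<union> ax ` {..m}"
  proof -
    have "{..m} = insert m {..<m}" by auto
    then show ?thesis unfolding axis_nbhd_def ax_def by auto
  qed
  have P1: "ax m + sum_list (take t (replicate m (axis i 1))) \<notin> lrange l \<union> lrange l' \<union> ax ` {..m}"
    if "t \<in> {1..m}" for t
  proof -
    have "ax m + sum_list (take t (replicate m (axis i 1))) = ax (m + t)"
      using that by (simp add: sum_list_replicate_axis ax_def axis_add min_absorb1)
    moreover have "ax (m + t) \<notin> lrange l \<union> lrange l'" using that by (intro 1) auto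
    moreover have "ax (m + t) \<notin> ax ` {..m}" using that inj by auto
    ultimately show ?thesis by (simp only:) blast
  qed
  have P2: "ax (2 * m) + sum_list (take t w) \<notin> lrange l \<union> lrange l' \<union> ax ` {..m}" if "t \<in> {1..length w}" for t
  proof -
    have "sum_list (take t w) \<in> lrange w" using that unfolding lrange_eq by auto
    then show ?thesis using 2 3 by blast
  qed
  have P3: "ax m + sum_list (replicate m (axis i 1)) = ax (2 * m)"
    by (simp only: sum_list_replicate_axis ax_def axis_add mult_2)
  show "avoid (insert (ax m) (axis_nbhd i m l l')) (ax m) (replicate m (axis i 1) @ w)"
    unfolding A avoid_append P3 unfolding avoid_iff length_replicate using P1 P2 by blast
qed

lemma lrange_back_and_forth: "lrange (concat (replicate m [v, - v])) \<subseteq> {0, v :: int ^ 'd::finite}"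
  by (induction m) auto

lemma sum_list_back_and_forth: "sum_list (concat (replicate m [v, - v])) = (0 :: int ^ 'd::finite)"
  by (induction m) auto

lemma axis_in_lrange_replicate: "r \<le> m \<Longrightarrow> axis i (int r) \<in> lrange (replicate m (axis i 1) :: (int ^ 'd::finite) list)"
  unfolding lrange_eq by (rule image_eqI[of _ _ r]) (auto simp: sum_list_replicate_axis min_absorb1)

context heat_bound begin

definition step_prob :: real where
  "step_prob = 1 / real (card (unit_steps :: (int ^ 'd) set))"

lemma step_prob_pos: "step_prob > 0"
  by (simp add: step_prob_def)

text \<open>The straight run costs a factor \<open>step_prob ^ m\<close>; given the run, all bad
  events together have probability at most 1/2. The bound is uniform in \<open>a\<close>,
  \<open>b\<close> and \<open>N\<close>.\<close>

lemma escape_average_ge: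
  fixes i :: 'd
  assumes m: "36 * C0 \<le> real m"
  defines "x \<equiv> axis i (int m)"
  shows "step_prob ^ m / 2 \<le> list_avg a (\<lambda>l. list_avg b (\<lambda>l'.
    of_bool (x \<notin> axis_nbhd i m l l') * esc (m + N) (insert x (axis_nbhd i m l l')) x))"
proof -
  let ?ax = "\<lambda>r. axis i (int r) :: int ^ 'd"
  let ?A = "\<lambda>l l'. insert x (axis_nbhd i m l l')"
  define R where "R = (replicate m (axis i 1) :: (int ^ 'd) list)"
  \<comment> \<open>Counts of bad events: \<open>f1\<close> for a range that meets the outer half of
    the axis segment, \<open>f3\<close> for a return of the late walk to the inner half,
    \<open>f4\<close> for a meeting of the late walk with a range.\<close>
  define f1 where "f1 l = (\<Sum>r\<in>{m..2 * m}. of_bool (?ax r \<in> lrange l) :: real)" for l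
  define f3 where "f3 w = (\<Sum>r\<in>{..m}. of_bool (\<exists>y'\<in>lrange w. ?ax (2 * m) + y' = ?ax r) :: real)" for w
  define f4 where "f4 l w = (of_bool (\<exists>y\<in>lrange l. \<exists>y'\<in>lrange w. ?ax (2 * m) + y' = y) :: real)" for l w
  have gbm: "(real m + 1) * gb m = 2 * C0 / (real m + 1)" by (simp add: gb_def power2_eq_square)
  have c: "of_nat (Suc (2 * m) - m) = real m + 1" by (simp add: of_nat_diff)
  have e1: "list_avg n f1 \<le> 2 * C0 / (real m + 1)" for n
  proof -
    have "list_avg n f1 = (\<Sum>r\<in>{m..2 * m}. list_avg n (\<lambda>l. of_bool (?ax r \<in> lrange l)))"
      unfolding f1_def[abs_def] by (rule list_avg_sum)
    also have "\<dots> \<le> (\<Sum>r\<in>{m..2 * m}. gb m)"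
      by (intro sum_mono order_trans[OF hit_axis_le] gb_antimono) simp
    finally show ?thesis using gbm c by (simp add: add.commute)
  qed
  have e3: "list_avg n f3 \<le> 2 * C0 / (real m + 1)" for n
  proof -
    have "list_avg n f3 = (\<Sum>r\<in>{..m}. list_avg n (\<lambda>w. of_bool (\<exists>y'\<in>lrange w. ?ax (2 * m) + y' = ?ax r)))"
      unfolding f3_def[abs_def] by (rule list_avg_sum)
    also have "\<dots> \<le> (\<Sum>r\<in>{..m}. gb m)"
    proof (rule sum_mono)
      fix r assume "r \<in> {..m}"
      then have "r + (2 * m - r) = 2 * m" and r': "m \<le> 2 * m - r" by auto
      then have r: "?ax (2 * m) = ?ax r + ?ax (2 * m - r)" by (simp only: axis_add)
      have "(\<exists>y'\<in>lrange w. ?ax (2 * m) + y' = ?ax r) \<longleftrightarrow> ?ax (2 * m - r) \<in> lrange (map uminus w)" for w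
        unfolding lrange_map_uminus r by (force simp: add.assoc eq_neg_iff_add_eq_0)
      then have "list_avg n (\<lambda>w. of_bool (\<exists>y'\<in>lrange w. ?ax (2 * m) + y' = ?ax r) :: real)
        = list_avg n (\<lambda>w. of_bool (?ax (2 * m - r) \<in> lrange (map uminus w)))" by simp
      also have "\<dots> = list_avg n (\<lambda>w. of_bool (?ax (2 * m - r) \<in> lrange w))" by (rule list_avg_map_uminus)
      also have "\<dots> \<le> gb (2 * m - r)" by (rule hit_axis_le)
      also have "\<dots> \<le> gb m" by (rule gb_antimono[OF r'])
      finally show "list_avg n (\<lambda>w. of_bool (\<exists>y'\<in>lrange w. ?ax (2 * m) + y' = ?ax r)) \<le> gb m" .
    qed
    finally show ?thesis using gbm by (simp add: add.commute)
  qed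
  have e4: "list_avg n (\<lambda>l. list_avg N (f4 l)) \<le> 6 * C0 / (real m + 1)" for n
  proof -
    have "list_avg n (\<lambda>l. list_avg N (f4 l)) \<le> 6 * C0 / (real (2 * m) + 1)"
      unfolding f4_def[abs_def] by (rule meet_axis_le)
    also have "\<dots> \<le> 6 * C0 / (real m + 1)" using C0_ge_1 by (intro divide_left_mono) auto
    finally show ?thesis .
  qed
  have point: "1 - (f1 l + f1 l' + f3 w + f4 l w + f4 l' w) \<le> of_bool (x \<notin> axis_nbhd i m l l') * of_bool (avoid (?A l l') x (R @ w))"
    for l l' w
  proof (cases "x \<notin> axis_nbhd i m l l' \<and> avoid (?A l l') x (R @ w)")
    case True
    have "0 \<le> f1 l" "0 \<le> f1 l'" "0 \<le> f3 w" "0 \<le> f4 l w" "0 \<le> f4 l' w"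
      unfolding f1_def f3_def f4_def by (auto intro!: sum_nonneg simp del: sum_of_bool_eq)
    moreover have "of_bool (x \<notin> axis_nbhd i m l l') * of_bool (avoid (?A l l') x (R @ w)) = (1 :: real)"
      using True by simp
    ultimately show ?thesis by linarith
  next
    case False
    have f0: "0 \<le> f1 l" "0 \<le> f1 l'" "0 \<le> f3 w" "0 \<le> f4 l w" "0 \<le> f4 l' w"
      unfolding f1_def f3_def f4_def by (auto intro!: sum_nonneg simp del: sum_of_bool_eq)
    have "(\<exists>r\<in>{m..2 * m}. ?ax r \<in> lrange l) \<or> (\<exists>r\<in>{m..2 * m}. ?ax r \<in> lrange l') \<or>
      (\<exists>r\<in>{..m}. \<exists>y'\<in>lrange w. ?ax (2 * m) + y' = ?ax r) \<or>
      (\<exists>y\<in>lrange l. \<exists>y'\<in>lrange w. ?ax (2 * m) + y' = y) \<or> (\<exists>y\<in>lrange l'. \<exists>y'\<in>lrange w. ?ax (2 * m) + y' = y)"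
    proof (rule ccontr)
      assume n: "\<not> ?thesis"
      have "x \<notin> axis_nbhd i m l l'" "avoid (?A l l') x (R @ w)"
        unfolding x_def R_def by (rule straight_escape[of m i l l' w]; use n in auto)+
      then show False using False by simp
    qed
    moreover have "1 \<le> f1 l" if "\<exists>r\<in>{m..2 * m}. ?ax r \<in> lrange l" for l
      using of_bool_le_sum[of "{m..2 * m}" True "\<lambda>r. ?ax r \<in> lrange l"] that by (simp add: f1_def del: sum_of_bool_eq)
    moreover have "1 \<le> f3 w" if "\<exists>r\<in>{..m}. \<exists>y'\<in>lrange w. ?ax (2 * m) + y' = ?ax r"
      using of_bool_le_sum[of "{..m}" True "\<lambda>r. \<exists>y'\<in>lrange w. ?ax (2 * m) + y' = ?ax r"] that by (simp add: f3_def del: sum_of_bool_eq)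
    moreover have "1 \<le> f4 l w" if "\<exists>y\<in>lrange l. \<exists>y'\<in>lrange w. ?ax (2 * m) + y' = y" for l
      using that by (simp add: f4_def)
    ultimately have "1 \<le> f1 l \<or> 1 \<le> f1 l' \<or> 1 \<le> f3 w \<or> 1 \<le> f4 l w \<or> 1 \<le> f4 l' w" by blast
    then have "1 - (f1 l + f1 l' + f3 w + f4 l w + f4 l' w) \<le> 0" using f0 by linarith
    also have "0 \<le> of_bool (x \<notin> axis_nbhd i m l l') * (of_bool (avoid (?A l l') x (R @ w)) :: real)" by simp
    finally show ?thesis .
  qed
  \<comment> \<open>18 = 2 + 2 + 2 + 6 + 6 adds the bounds for \<open>f1\<close> (past and future),
    \<open>f3\<close>, and \<open>f4\<close> (past and future); \<open>m\<close> is at least twice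
    \<open>18 * C0\<close>.\<close>
  have "1 / 2 \<le> 1 - 18 * C0 / (real m + 1)" using m C0_ge_1 by (simp add: field_simps)
  also have "\<dots> \<le> 1 - (list_avg a f1 + list_avg b f1 + list_avg N f3 + list_avg a (\<lambda>l. list_avg N (f4 l)) + list_avg b (\<lambda>l. list_avg N (f4 l)))"
  proof -
    have "18 * C0 / (real m + 1) = 2 * C0 / (real m + 1) + 2 * C0 / (real m + 1) + 2 * C0 / (real m + 1) + 6 * C0 / (real m + 1) + 6 * C0 / (real m + 1)"
      by (simp add: add_divide_distrib[symmetric])
    then show ?thesis using e1[of a] e1[of b] e3[of N] e4[of a] e4[of b] by linarith
  qed
  also have "\<dots> = list_avg a (\<lambda>l. list_avg b (\<lambda>l'. list_avg N (\<lambda>w. 1 - (f1 l + f1 l' + f3 w + f4 l w + f4 l' w))))"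
    by (simp only: list_avg_add list_avg_diff list_avg_const)
  also have "\<dots> \<le> list_avg a (\<lambda>l. list_avg b (\<lambda>l'. list_avg N (\<lambda>w. of_bool (x \<notin> axis_nbhd i m l l') * of_bool (avoid (?A l l') x (R @ w)))))"
    by (intro list_avg_mono point)
  finally have half: "(1 / 2 :: real) \<le> list_avg a (\<lambda>l. list_avg b (\<lambda>l'. of_bool (x \<notin> axis_nbhd i m l l') * list_avg N (\<lambda>w. of_bool (avoid (?A l l') x (R @ w)))))"
    by (simp only: list_avg_cmult)
  have pre: "step_prob ^ m * list_avg N (\<lambda>w. of_bool (avoid (?A l l') x (R @ w))) \<le> esc (m + N) (?A l l') x" for l l'
  proof -
    have Rs: "set R \<subseteq> unit_steps" and Rl: "length R = m" by (auto simp: R_def)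
    have "(1 / real (card (unit_steps :: (int ^ 'd) set))) ^ length R * list_avg N (\<lambda>w. of_bool (avoid (?A l l') x (R @ w)))
      \<le> list_avg (length R + N) (\<lambda>w. of_bool (avoid (?A l l') x w))"
      by (rule list_avg_prefix_ge[OF _ Rs]) simp
    then show ?thesis unfolding Rl esc_def step_prob_def .
  qed
  have "step_prob ^ m / 2 = step_prob ^ m * (1 / 2)" by simp
  also have "\<dots> \<le> step_prob ^ m * list_avg a (\<lambda>l. list_avg b (\<lambda>l'. of_bool (x \<notin> axis_nbhd i m l l') * list_avg N (\<lambda>w. of_bool (avoid (?A l l') x (R @ w)))))"
    using step_prob_pos by (intro mult_left_mono half) simp
  also have "\<dots> = list_avg a (\<lambda>l. list_avg b (\<lambda>l'. of_bool (x \<notin> axis_nbhd i m l l') * (step_prob ^ m * list_avg N (\<lambda>w. of_bool (avoid (?A l l') x (R @ w))))))"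
    by (simp only: mult.left_commute[of _ "step_prob ^ m"] list_avg_cmult)
  also have "\<dots> \<le> list_avg a (\<lambda>l. list_avg b (\<lambda>l'. of_bool (x \<notin> axis_nbhd i m l l') * esc (m + N) (?A l l') x))"
    by (intro list_avg_mono mult_left_mono pre) simp
  finally show ?thesis .
qed

text \<open>\<open>Cap_insert_ge\<close> yields the square of the escape probability, whereas only
  its average is known. The tangent inequality \<open>2 * c * e - c ^ 2 \<le> e ^ 2\<close> at the
  known lower bound \<open>c\<close> passes from one to the other.\<close>

lemma insertion_average_ge:
  fixes i :: 'd
  assumes m: "36 * C0 \<le> real m"
  defines "x \<equiv> axis i (int m)"
  shows "(step_prob ^ m / 2)\<^sup>2 \<le> list_avg a (\<lambda>l. list_avg b (\<lambda>l'.
    Cap (insert x (axis_nbhd i m l l')) - Cap (axis_nbhd i m l l')))"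
proof -
  let ?c = "step_prob ^ m / 2"
  define e where "e l l' = of_bool (x \<notin> axis_nbhd i m l l') * escape_prob (insert x (axis_nbhd i m l l')) x" for l l'
  have "(\<lambda>N. list_avg a (\<lambda>l. list_avg b (\<lambda>l'.
      of_bool (x \<notin> axis_nbhd i m l l') * esc (m + N) (insert x (axis_nbhd i m l l')) x)))
    \<longlonglongrightarrow> list_avg a (\<lambda>l. list_avg b (e l))"
    unfolding e_def
    by (intro list_avg_tendsto tendsto_mult_left) (use LIMSEQ_ignore_initial_segment[OF esc_tendsto, where k = m] in \<open>simp add: add.commute\<close>)
  then have ec: "?c \<le> list_avg a (\<lambda>l. list_avg b (e l))"
    by (rule LIMSEQ_le_const) (use escape_average_ge[OF m, of a b i] in \<open>auto simp: x_def\<close>)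
  have "?c\<^sup>2 \<le> 2 * ?c * list_avg a (\<lambda>l. list_avg b (e l)) - ?c\<^sup>2"
    using mult_left_mono[OF ec, of "2 * ?c"] step_prob_pos by (simp add: power2_eq_square)
  also have "\<dots> = list_avg a (\<lambda>l. list_avg b (\<lambda>l'. 2 * ?c * e l l' - ?c\<^sup>2))"
    by (simp only: list_avg_diff list_avg_cmult list_avg_const)
  also have "\<dots> \<le> list_avg a (\<lambda>l. list_avg b (\<lambda>l'. Cap (insert x (axis_nbhd i m l l')) - Cap (axis_nbhd i m l l')))"
  proof (intro list_avg_mono)
    fix l l'
    have "2 * ?c * e l l' - ?c\<^sup>2 \<le> (e l l')\<^sup>2"
      using zero_le_power2[of "e l l' - ?c"] by (simp add: power2_eq_square algebra_simps)
    also have "\<dots> \<le> Cap (insert x (axis_nbhd i m l l')) - Cap (axis_nbhd i m l l')"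
    proof (cases "x \<in> axis_nbhd i m l l'")
      case True
      then show ?thesis by (simp add: e_def insert_absorb)
    next
      case False
      then show ?thesis using Cap_insert_ge[OF finite_axis_nbhd False] by (simp add: e_def)
    qed
    finally show "2 * ?c * e l l' - ?c\<^sup>2 \<le> Cap (insert x (axis_nbhd i m l l')) - Cap (axis_nbhd i m l l')" .
  qed
  finally show ?thesis .
qed

text \<open>Both loops have length \<open>2 * m\<close>, and the range of the second is contained in that of
  the first.\<close>

definition far_loop :: "'d \<Rightarrow> nat \<Rightarrow> (int ^ 'd) list" where
  "far_loop i m = replicate m (axis i 1) @ replicate m (- axis i 1)"

definition near_loop :: "'d \<Rightarrow> nat \<Rightarrow> (int ^ 'd) list" where
  "near_loop i m = concat (replicate m [axis i 1, - axis i 1])"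

text \<open>By monotonicity both ranges are compared with \<open>axis_nbhd\<close>, with and without
  the tip, so that the exchange gains at least what inserting the tip gains.\<close>

lemma loop_exchange_ge:
  fixes i :: 'd
  assumes m: "36 * C0 \<le> real m"
  shows "(step_prob ^ m / 2)\<^sup>2 \<le> list_avg a (\<lambda>l. list_avg b (\<lambda>l'. capr (l @ far_loop i m @ l') - capr (l @ near_loop i m @ l')))"
proof -
  define x where "x = (axis i (int m) :: int ^ 'd)"
  define G where "G l = list_avg b (\<lambda>l'. Cap (insert x (axis_nbhd i m l l')) - Cap (axis_nbhd i m l l'))" for l
  \<comment> \<open>The near loop visits \<open>axis i 1\<close>, which belongs to the truncated
    segment only for \<open>m \<ge> 2\<close>.\<close>
  have m2: "m \<ge> 2" using m C0_ge_1 by simp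
  have s: "sum_list (far_loop i m) = 0" "sum_list (near_loop i m) = 0"
    unfolding far_loop_def near_loop_def sum_list_append sum_list_back_and_forth
    using sum_list_map_uminus[of "replicate m (axis i 1 :: int ^ 'd)"] by simp_all
  have far: "axis i (int r) \<in> lrange (far_loop i m)" if "r \<le> m" for r
    using axis_in_lrange_replicate[OF that] unfolding far_loop_def lrange_append by blast
  have near: "lrange (near_loop i m) \<subseteq> (\<lambda>r. axis i (int r)) ` {..<m}"
  proof -
    have "0 \<in> (\<lambda>r. axis i (int r) :: int ^ 'd) ` {..<m}"
      by (rule image_eqI[of _ _ 0]) (use m2 in \<open>auto simp: axis_def vec_eq_iff\<close>)
    moreover have "axis i 1 \<in> (\<lambda>r. axis i (int r) :: int ^ 'd) ` {..<m}"
      by (rule image_eqI[of _ _ 1]) (use m2 in auto)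
    ultimately show ?thesis using lrange_back_and_forth unfolding near_loop_def by blast
  qed
  have "(step_prob ^ m / 2)\<^sup>2 \<le> list_avg a G"
    unfolding G_def x_def by (rule insertion_average_ge[OF m])
  also have "list_avg a G = list_avg a (\<lambda>l. G (map uminus (rev l)))"
    unfolding list_avg_rev[of a "\<lambda>l. G (map uminus l)"] by (rule list_avg_map_uminus[symmetric])
  also have "\<dots> \<le> list_avg a (\<lambda>l. list_avg b (\<lambda>l'. capr (l @ far_loop i m @ l') - capr (l @ near_loop i m @ l')))"
    unfolding G_def
  proof (intro list_avg_mono diff_mono)
    fix l l' :: "(int ^ 'd) list"
    show "Cap (insert x (axis_nbhd i m (map uminus (rev l)) l')) \<le> capr (l @ far_loop i m @ l')"
      unfolding capr_middle[OF s(1)] using far by (intro Cap_mono) (auto simp: axis_nbhd_def x_def)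
    show "capr (l @ near_loop i m @ l') \<le> Cap (axis_nbhd i m (map uminus (rev l)) l')"
      unfolding capr_middle[OF s(2)] using near by (intro Cap_mono) (auto simp: axis_nbhd_def)
  qed
  finally show ?thesis .
qed

text \<open>Cauchy-Schwarz against the block sum of \<open>h\<close>: its covariance with the
  capacity grows like \<open>k\<close>, its own norm only like \<open>sqrt k\<close>, so the
  standard deviation of the capacity is at least of order \<open>sqrt k\<close>. Both loops have the
  same length, hence the same probability, and \<open>h\<close> has mean zero.\<close>

lemma cap_rel_std_limit_pos:
  assumes \<sigma>: "cap_rel_std \<longlonglongrightarrow> \<sigma>"
  shows "\<sigma> > 0"
proof -
  obtain i :: 'd where True by simp
  obtain m :: nat where m: "36 * C0 \<le> real m" using real_arch_simple by blast
  define K where "K = 2 * m"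
  have K: "K \<ge> 1" using m C0_ge_1 by (simp add: K_def)
  define h where "h = (\<lambda>l. of_bool (l = far_loop i m) - of_bool (l = near_loop i m) :: real)"
  define \<delta> where "\<delta> = (step_prob ^ m / 2)\<^sup>2"
  \<comment> \<open>Adding 1 to the norm of \<open>h\<close> keeps the denominator positive at the
    price of a smaller constant.\<close>
  define \<kappa> where "\<kappa> = step_prob ^ K * \<delta> / (l2norm K h + 1)"
  have \<delta>: "\<delta> > 0" using step_prob_pos by (simp add: \<delta>_def)
  have \<kappa>: "\<kappa> > 0" unfolding \<kappa>_def using step_prob_pos \<delta> by (intro divide_pos_pos mult_pos_pos add_nonneg_pos) auto
  have len: "length (far_loop i m) = K" "length (near_loop i m) = K"
    by (simp_all add: far_loop_def near_loop_def K_def length_concat sum_list_replicate mult.commute)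
  have sub: "set (far_loop i m) \<subseteq> unit_steps" "set (near_loop i m) \<subseteq> unit_steps"
    by (auto simp: far_loop_def near_loop_def uminus_axis)
  have h0: "list_avg K h = 0"
    using list_avg_point[OF sub(1), of "\<lambda>_. 1"] list_avg_point[OF sub(2), of "\<lambda>_. 1"]
    unfolding len h_def list_avg_diff by simp
  have lower: "\<kappa> * sqrt (real (n div K)) \<le> cap_std n" for n
  proof -
    define k r where "k = n div K" and "r = n mod K"
    have n: "k * K + r = n" by (simp add: k_def r_def)
    let ?B = "block_sum K h k"
    have B0: "list_avg n ?B = 0"
      using list_avg_take[of "k * K" r ?B] h0 by (simp add: block_sum_take list_avg_block_sum n)
    have B2: "l2norm n ?B = sqrt (real k) * l2norm K h"
      using l2norm_take[of "k * K" r ?B] by (simp add: block_sum_take l2norm_block_sum[OF h0] n)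
    have "real k * step_prob ^ K * \<delta> \<le> list_avg n (\<lambda>l. capr l * ?B l)"
      using block_covariance_ge[OF len sub, of k r \<delta> capr] loop_exchange_ge[OF m]
      unfolding n step_prob_def h_def \<delta>_def by blast
    also have "\<dots> = list_avg n (\<lambda>l. centred n capr l * ?B l)"
      unfolding centred_def left_diff_distrib list_avg_diff list_avg_cmult B0 by simp
    also have "\<dots> \<le> cap_std n * (sqrt (real k) * l2norm K h)"
      using abs_list_avg_mult_le[of n "centred n capr" ?B] unfolding B2 cap_std_def by linarith
    also have "\<dots> \<le> cap_std n * (sqrt (real k) * (l2norm K h + 1))"
      by (intro mult_left_mono) auto
    finally have *: "sqrt (real k) * (sqrt (real k) * (step_prob ^ K * \<delta>)) \<le> sqrt (real k) * (cap_std n * (l2norm K h + 1))"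
      by (simp add: mult.assoc[symmetric]) (simp add: mult_ac)
    have "sqrt (real k) * (step_prob ^ K * \<delta>) \<le> cap_std n * (l2norm K h + 1)"
    proof (cases "k = 0")
      case False
      then show ?thesis using * by (simp add: mult_le_cancel_left)
    qed (simp add: add_nonneg_nonneg)
    moreover have "l2norm K h + 1 > 0" by (rule add_nonneg_pos) auto
    ultimately show ?thesis unfolding k_def[symmetric] \<kappa>_def by (simp add: field_simps)
  qed
  have "(\<lambda>n. \<kappa> * sqrt (real (n div K) / real n)) \<longlonglongrightarrow> \<kappa> * sqrt (1 / real K)"
    by (intro tendsto_intros div_ratio_tendsto K)
  then have "\<kappa> * sqrt (1 / real K) \<le> \<sigma>"
  proof (rule LIMSEQ_le[OF _ \<sigma>], intro exI allI impI)
    fix n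
    have "\<kappa> * sqrt (real (n div K)) / sqrt (real n) \<le> cap_std n / sqrt (real n)"
      by (intro divide_right_mono lower) simp
    then show "\<kappa> * sqrt (real (n div K) / real n) \<le> cap_rel_std n"
      by (simp add: cap_rel_std_def real_sqrt_divide)
  qed
  moreover have "\<kappa> * sqrt (1 / real K) > 0" using \<kappa> K by simp
  ultimately show ?thesis by linarith
qed

end

theorem theorem1p1:
  assumes "CARD('d::finite) \<ge> 6"
  shows "\<exists>\<sigma>>0. weak_conv_m
           (\<lambda>n. distr (SRW :: (int ^ 'd) stream measure) borel
              (\<lambda>w. (Cap (walk_range w n) - (\<integral>w'. Cap (walk_range w' n) \<partial>(SRW :: (int ^ 'd) stream measure))) / sqrt (real n)))
           (density lborel (normal_density 0 \<sigma>))"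
proof -
  interpret heat_bound "TYPE('d)" "36 * real CARD('d) ^ 3"
    by unfold_locales (rule hk_le[OF assms])
  obtain \<sigma> where \<sigma>: "cap_rel_std \<longlonglongrightarrow> \<sigma>"
    using cap_rel_std_convergent unfolding convergent_def by blast
  have pos: "\<sigma> > 0" by (rule cap_rel_std_limit_pos[OF \<sigma>])
  show ?thesis
  proof (intro exI conjI, rule pos, rule levy_continuity)
    show "real_distribution (distr (SRW :: (int ^ 'd) stream measure) borel
        (\<lambda>w. (Cap (walk_range w n) - (\<integral>w'. Cap (walk_range w' n) \<partial>(SRW :: (int ^ 'd) stream measure))) / sqrt (real n)))" for n
      by (rule Cap_walk_range_distribution(1))
    show "real_distribution (density lborel (normal_density 0 \<sigma>))"
      by (rule real_distribution_normal[OF pos])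
    show "(\<lambda>n. char (distr (SRW :: (int ^ 'd) stream measure) borel
        (\<lambda>w. (Cap (walk_range w n) - (\<integral>w'. Cap (walk_range w' n) \<partial>(SRW :: (int ^ 'd) stream measure))) / sqrt (real n))) t)
      \<longlonglongrightarrow> char (density lborel (normal_density 0 \<sigma>)) t" for t
      unfolding Cap_walk_range_distribution(2) char_normal_density[OF pos] cap_char_def[symmetric]
      by (rule cap_char_tendsto[OF \<sigma>])
  qed
qed

end
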